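(* Suppose $\kappa(n)=o(\eta(n))$ as $n\to\infty$. Then, as $t\to\infty$, $$\Big|\log\frac{u(t,Z^{(1)}_t)}{u(t,-Z^{(1)}_t)}\Big|\to\infty\qquad\text{in probability.}$$
   Context: Fix $\alpha\ge 2$. Let $(\xi_0(z))_{z\in\mathbb Z}$ be i.i.d. Pareto random variables with parameter $\alpha$, i.e. $\mathrm{Prob}(\xi_0(z)>x)=x^{-\alpha}$ for $x\ge 1$. Let $p:\mathbb N\to[0,1]$ be eventually nondecreasing with $p(n)\to 1$, and $q=1-p$. Define the potential $\xi:\mathbb Z\to[1,\infty)$ by $\xi(n)=\xi_0(n)$ for $n\ge 0$ and, independently for each $n\ge1$ (and independently of $\xi_0$), $\xi(-n)=\xi_0(n)$ with probability $p(n)$ and $\xi(-n)=\xi_0(-n)$ with probability $q(n)$. Let $u$ be the solution of $\partial_t u=\Delta u+\xi u$ on $(0,\infty)\times\mathbb Z$, $u(0,\cdot)=\mathbf 1_{\{0\}}$, with $(\Delta f)(z)=\sum_{|y-z|=1}(f(y)-f(z))$, given by $u(t,z)=\mathbb E[\exp\{\int_0^t\xi(X_s)ds\}\mathbf 1\{X_t=z\}]$ with $(X_s)$ the continuous-time random walk with generator $\Delta$ started at $0$. Let $D=\{z\in\mathbb N_0:\xi(z)=\xi(-z)\}$, $\Psi_t(z)=\xi(z)-\frac{|z|}{t}\log\xi(z)$, and $Z^{(1)}_t$ a maximiser of $\Psi_t$ over $D$. Let $\eta(n)=\sum_{z=1}^n q(z)$ and $\kappa(n)=n^{2/\alpha}$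 if $\alpha>2$, $\kappa(n)=n/\log n$ if $\alpha=2$. *)

theory Defs
  imports "HOL-Probability.Probability" "HOL-Library.Landau_Symbols"
begin

text \<open>One step of the walk: an Exp(2) holding time together with a uniform
  jump in {-1,1} (total jump rate 2, rate 1 to each neighbour).\<close>
definition step_measure :: "(real \<times> int) measure" where
  "step_measure = density lborel (\<lambda>x. ennreal (exponential_density 2 x))
      \<Otimes>\<^sub>M measure_pmf (pmf_of_set {-1, 1})"

definition walk_measure :: "(nat \<Rightarrow> real \<times> int) measure" where
  "walk_measure = (\<Pi>\<^sub>M k\<in>UNIV. step_measure)"

definition walk_pos :: "(nat \<Rightarrow> real \<times> int) \<Rightarrow> real \<Rightarrow> int" where
  "walk_pos w s = (\<Sum>k\<in>{k. (\<Sum>j\<le>k. fst (w j)) \<le> s}. snd (w k))"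

text \<open>Feynman--Kac solution u(t,z) of the PAM with potential xi, started at 1_{0}.\<close>
definition pam_u :: "(int \<Rightarrow> real) \<Rightarrow> real \<Rightarrow> int \<Rightarrow> real" where
  "pam_u xi t z = (\<integral>w. exp (LINT s:{0..t}|lborel. xi (walk_pos w s))
                        * indicator {w. walk_pos w t = z} w \<partial>walk_measure)"

definition potential :: "(int \<Rightarrow> real) \<Rightarrow> (nat \<Rightarrow> bool) \<Rightarrow> int \<Rightarrow> real" where
  "potential xi0 coin z =
     (if z \<ge> 0 then xi0 z else if coin (nat (-z)) then xi0 (-z) else xi0 z)"

definition Dset :: "(int \<Rightarrow> real) \<Rightarrow> nat set" where
  "Dset xi = {z. xi (int z) = xi (- int z)}"

definition Psi :: "(int \<Rightarrow> real) \<Rightarrow> real \<Rightarrow> int \<Rightarrow> real" where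
  "Psi xi t z = xi z - (real_of_int \<bar>z\<bar> / t) * ln (xi z)"

definition eta :: "(nat \<Rightarrow> real) \<Rightarrow> nat \<Rightarrow> real" where
  "eta p n = (\<Sum>z=1..n. 1 - p z)"

definition kappa :: "real \<Rightarrow> nat \<Rightarrow> real" where
  "kappa \<alpha> n = (if \<alpha> > 2 then real n powr (2 / \<alpha>) else real n / ln (real n))"

end

theory Submission
  imports Defs "HOL-Real_Asymp.Real_Asymp"
begin

text \<open>Exchanging the values \<open>\<xi>(y)\<close> and \<open>\<xi>(-y)\<close> at a site where they differ preserves the law of the
  potential, the set \<open>D\<close> and hence \<open>Z = Z\<^sub>t\<close>. Write \<open>a = (t / ln t)\<^bsup>1/(\<alpha>-1)\<^esup>\<close> and \<open>r = a\<^sup>\<alpha>\<close> for the scales of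
  \<open>\<xi>(Z)\<close> and \<open>Z\<close>. Expanding \<open>u(t, \<plusminus>Z)\<close> as a sum over jump sequences, for \<open>y < \<delta> r\<close> almost all of the mass of
  \<open>u(t, Z)\<close> comes from paths that run through \<open>y\<close> but avoid \<open>-y\<close>, so that such an exchange moves
  \<open>F = ln (u(t, Z) / u(t, -Z))\<close> in the direction of the larger value by at least a constant times
  \<open>\<bar>\<xi>(y) - \<xi>(-y)\<bar> / a\<close>. Thus \<open>F\<close> is strictly monotone in many independent fair signs, and it lies in a fixed
  interval with probability at most a constant times \<open>V\<^bsup>-1/2\<^esup>\<close>, where
  \<open>V = \<Sum>\<^sub>y (\<xi>(y) - \<xi>(-y))\<^sup>2 / a\<^sup>2\<close>. A second moment estimate shows that \<open>V\<close> is of order at least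
  \<open>\<eta>(r) / \<kappa>(r)\<close>, which tends to infinity.\<close>

section \<open>Path integrals\<close>

text \<open>Path sums are only ever compared with themselves before and after one exchange, so crude
  bounds suffice almost everywhere. Precision matters in one place: an exchange of two values at
  distance D changes \<open>ln u\<close> by about D/a, so the discarded paths must have relative
  mass well below 1/a. This dictates a relative error \<theta> of order 1/a and the neglect of all
  gaps smaller than 1. Three obstacles shape the set-up. Some site may carry a value above \<xi>(Z),
  and a path could profit from it; such a site lies in D, and the maximality of Z shows that
  reaching it does not pay. A detour through -y is too cheap when y is close to 0, because there are
  about r positions at which it can be inserted; only y beyond a fixed \<open>y0\<close> are
  exchanged. Finally, Z is an arbitrary selection of a maximiser, so the exchange argument runs with
  a measurable site that almost surely agrees with it on the good event.\<close>

definition conv :: "(real \<Rightarrow> ennreal) \<Rightarrow> (real \<Rightarrow> ennreal) \<Rightarrow> real \<Rightarrow> ennreal" where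
  "conv f g t = (\<integral>\<^sup>+s. f s * g (t - s) \<partial>lborel)"

lemma measurable_conv [measurable]:
  assumes [measurable]: "f \<in> borel_measurable borel" "g \<in> borel_measurable borel"
  shows "conv f g \<in> borel_measurable borel"
  unfolding conv_def by measurable

lemma conv_mono:
  assumes "\<And>s. f s \<le> f' s" "\<And>s. g s \<le> g' s"
  shows "conv f g t \<le> conv f' g' t"
  unfolding conv_def by (intro nn_integral_mono mult_mono assms) auto

lemma conv_commute:
  assumes [measurable]: "f \<in> borel_measurable borel" "g \<in> borel_measurable borel"
  shows "conv f g t = conv g f t"
  unfolding conv_def
  by (subst nn_integral_real_affine[where c = "-1" and t = t]) (auto simp: mult.commute)

lemma conv_left_commute:
  assumes [measurable]: "f \<in> borel_measurable borel" "g \<in> borel_measurable borel"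
    "h \<in> borel_measurable borel"
  shows "conv f (conv g h) t = conv g (conv f h) t"
proof -
  have "conv f (conv g h) t = (\<integral>\<^sup>+s. \<integral>\<^sup>+r. f s * (g r * h (t - s - r)) \<partial>lborel \<partial>lborel)"
    unfolding conv_def by (intro nn_integral_cong nn_integral_cmult[symmetric]) auto
  also have "\<dots> = (\<integral>\<^sup>+r. \<integral>\<^sup>+s. f s * (g r * h (t - s - r)) \<partial>lborel \<partial>lborel)"
    by (rule lborel_pair.Fubini') measurable
  also have "\<dots> = (\<integral>\<^sup>+r. g r * (\<integral>\<^sup>+s. f s * h (t - r - s) \<partial>lborel) \<partial>lborel)"
    by (intro nn_integral_cong, subst nn_integral_cmult[symmetric])
       (auto intro!: nn_integral_cong simp: mult_ac algebra_simps)
  finally show ?thesis unfolding conv_def .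
qed

lemma conv_assoc:
  assumes [measurable]: "f \<in> borel_measurable borel" "g \<in> borel_measurable borel"
    "h \<in> borel_measurable borel"
  shows "conv (conv f g) h t = conv f (conv g h) t"
proof -
  have "conv (conv f g) h t = conv h (conv f g) t"
    by (rule conv_commute) auto
  also have "\<dots> = conv f (conv h g) t"
    by (rule conv_left_commute) auto
  also have "conv h g = conv g h"
    by (intro ext conv_commute) auto
  finally show ?thesis .
qed

definition exp_kernel :: "real \<Rightarrow> real \<Rightarrow> ennreal" where
  "exp_kernel a s = ennreal (exp (a * s)) * indicator {0..} s"

lemma measurable_exp_kernel [measurable]: "exp_kernel a \<in> borel_measurable borel"
  unfolding exp_kernel_def by measurable

text \<open>\<open>path_int [a\<^sub>0, \<dots>, a\<^sub>n] t\<close> integrates \<open>exp (a\<^sub>0 s\<^sub>0 + \<dots> + a\<^sub>n s\<^sub>n)\<close> over the holding times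
  \<open>s\<^sub>i \<ge> 0\<close> with \<open>s\<^sub>0 + \<dots> + s\<^sub>n = t\<close>.\<close>

fun path_int :: "real list \<Rightarrow> real \<Rightarrow> ennreal" where
  "path_int [] = (\<lambda>t. 0)"
| "path_int [a] = exp_kernel a"
| "path_int (a # b # as) = conv (exp_kernel a) (path_int (b # as))"

text \<open>The unit of convolution is a point mass and not a function, so \<open>[]\<close> carries
  the dummy value 0 and the recursion needs a nonempty tail.\<close>

lemma path_int_Cons: "A \<noteq> [] \<Longrightarrow> path_int (a # A) = conv (exp_kernel a) (path_int A)"
  by (cases A) auto

lemma measurable_path_int [measurable]: "path_int A \<in> borel_measurable borel"
  by (induction A rule: path_int.induct) auto

lemma exp_kernel_neg [simp]: "t < 0 \<Longrightarrow> exp_kernel a t = 0"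
  by (simp add: exp_kernel_def)

lemma path_int_neg [simp]: "t < 0 \<Longrightarrow> path_int A t = 0"
proof (induction A arbitrary: t rule: path_int.induct)
  case (3 a b as)
  have "path_int (a # b # as) t = (\<integral>\<^sup>+(s::real). 0 \<partial>lborel)"
    unfolding path_int.simps conv_def
  proof (rule nn_integral_cong)
    fix s show "exp_kernel a s * path_int (b # as) (t - s) = 0"
      using 3 by (cases "s \<ge> 0") auto
  qed
  then show ?case by simp
qed auto

lemma path_int_swap: "path_int (a # b # A) = path_int (b # a # A)"
proof (cases A)
  case Nil
  then show ?thesis by (auto intro!: ext conv_commute)
next
  case (Cons c A')
  then show ?thesis by (auto intro!: ext conv_left_commute)
qed

lemma path_int_cong_Cons: "path_int A = path_int B \<Longrightarrow> A \<noteq> [] \<Longrightarrow> B \<noteq> [] \<Longrightarrow> path_int (a # A) = path_int (a # B)"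
  by (simp add: path_int_Cons)

text \<open>Convolution commutes, so the order of the rates is immaterial: any visited site can be
  brought to the front before it is altered or removed.\<close>

lemma path_int_move: "path_int (A @ b # C) = path_int (b # A @ C)"
proof (induction A)
  case (Cons a A)
  have "path_int (a # (A @ b # C)) = path_int (a # (b # A @ C))"
    by (rule path_int_cong_Cons[OF Cons]) auto
  then show ?case using path_int_swap[of a b "A @ C"] by (simp del: path_int.simps)
qed auto

lemma exp_kernel_mono: "a \<le> b \<Longrightarrow> exp_kernel a s \<le> exp_kernel b s"
  by (auto simp: exp_kernel_def indicator_def intro!: ennreal_leI mult_right_mono)

lemma path_int_mono: "list_all2 (\<le>) A B \<Longrightarrow> path_int A t \<le> path_int B t"
proof (induction A B arbitrary: t rule: list_all2_induct)
  case (Cons a A b B)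
  show ?case
  proof (cases "A = []")
    case True
    then show ?thesis using Cons by (auto simp: exp_kernel_mono)
  next
    case False
    then have "B \<noteq> []" using Cons by (auto simp: list_all2_lengthD)
    then show ?thesis using False Cons
      by (auto simp: path_int_Cons intro!: conv_mono exp_kernel_mono)
  qed
qed auto

lemma nn_integral_power_Icc:
  assumes "0 \<le> t"
  shows "(\<integral>\<^sup>+s. ennreal ((t - s) ^ n / fact n) * indicator {0..t} s \<partial>lborel) = ennreal (t ^ Suc n / fact (Suc n))"
proof -
  have "(\<integral>\<^sup>+s. ennreal ((t - s) ^ n / fact n) * indicator {0..t} s \<partial>lborel)
      = ennreal (- ((t - t) ^ Suc n / fact (Suc n)) - (- ((t - 0) ^ Suc n / fact (Suc n))))"
  proof (rule nn_integral_FTC_Icc)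
    fix x :: real assume "x \<in> {0..t}"
    show "((\<lambda>x. - ((t - x) ^ Suc n / fact (Suc n))) has_real_derivative (t - x) ^ n / fact n) (at x)"
    proof -
      have "((\<lambda>x. (t - x) ^ Suc n) has_real_derivative - (real (Suc n) * (t - x) ^ n)) (at x)"
        by (rule derivative_eq_intros refl)+ simp
      from DERIV_minus[OF DERIV_cdivide[OF this, of "fact (Suc n)"]]
      have "((\<lambda>x. - ((t - x) ^ Suc n / fact (Suc n))) has_real_derivative
         (real (Suc n) * (t - x) ^ n / fact (Suc n))) (at x)"
        by simp
      also have "real (Suc n) * (t - x) ^ n / fact (Suc n) = (t - x) ^ n / fact n"
        by (simp del: of_nat_Suc)
      finally show ?thesis .
    qed
  qed (use assms in \<open>auto\<close>)
  then show ?thesis by simp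
qed

text \<open>With every rate replaced by \<open>M\<close>, what remains is \<open>exp (M * t)\<close>
  times the volume of the simplex of holding times with sum \<open>t\<close>.\<close>

lemma path_int_upper:
  assumes "\<And>a. a \<in> set A \<Longrightarrow> a \<le> M" "A \<noteq> []" "0 \<le> t"
  shows "path_int A t \<le> ennreal (exp (M * t) * (t ^ (length A - 1) / fact (length A - 1)))"
  using assms
proof (induction A arbitrary: t rule: path_int.induct)
  case (2 a)
  then show ?case by (auto simp: exp_kernel_def intro!: ennreal_leI mult_right_mono)
next
  case (3 a b as)
  let ?n = "length as"
  have "path_int (a # b # as) t \<le> (\<integral>\<^sup>+s. ennreal (exp (M * t)) * (ennreal ((t - s) ^ ?n / fact ?n) * indicator {0..t} s) \<partial>lborel)"
    unfolding path_int.simps conv_def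
  proof (intro nn_integral_mono)
    fix s :: real
    show "exp_kernel a s * path_int (b # as) (t - s) \<le> ennreal (exp (M * t)) * (ennreal ((t - s) ^ ?n / fact ?n) * indicator {0..t} s)"
    proof (cases "0 \<le> s \<and> s \<le> t")
      case True
      have "exp_kernel a s * path_int (b # as) (t - s) \<le> ennreal (exp (M * s)) * ennreal (exp (M * (t - s)) * ((t - s) ^ ?n / fact ?n))"
      proof (rule mult_mono)
        show "exp_kernel a s \<le> ennreal (exp (M * s))"
          using exp_kernel_mono[of a M s] "3.prems"(1)[of a] True by (simp add: exp_kernel_def)
        show "path_int (b # as) (t - s) \<le> ennreal (exp (M * (t - s)) * ((t - s) ^ ?n / fact ?n))"
          using "3.IH"[of "t - s"] "3.prems"(1) True by simp
      qed auto
      also have "\<dots> = ennreal ((exp (M * s) * exp (M * (t - s))) * ((t - s) ^ ?n / fact ?n))"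
        by (simp only: ennreal_mult'[symmetric] exp_ge_zero mult.assoc)
      also have "exp (M * s) * exp (M * (t - s)) = exp (M * t)"
        by (simp add: mult_exp_exp algebra_simps)
      also have "ennreal (exp (M * t) * ((t - s) ^ ?n / fact ?n)) = ennreal (exp (M * t)) * ennreal ((t - s) ^ ?n / fact ?n)"
        by (rule ennreal_mult') simp
      finally show ?thesis using True by simp
    next
      case False
      then have "s < 0 \<or> t - s < 0" by auto
      then show ?thesis by auto
    qed
  qed
  also have "\<dots> = ennreal (exp (M * t)) * ennreal (t ^ Suc ?n / fact (Suc ?n))"
    by (subst nn_integral_cmult) (auto simp: nn_integral_power_Icc[OF 3(4)] simp del: fact_Suc)
  also have "\<dots> = ennreal (exp (M * t) * (t ^ Suc ?n / fact (Suc ?n)))"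
    by (rule ennreal_mult'[symmetric]) simp
  finally show ?case by (simp only: list.size add_Suc_right add_0_right diff_Suc_1)
qed auto

text \<open>Restrict the holding times of \<open>A\<close> to sum at most \<open>t1\<close>: their
  rates are nonnegative, the last site keeps at least \<open>t - t1\<close>, and the simplex has
  volume \<open>t1 ^ length A / fact (length A)\<close>.\<close>

lemma path_int_lower:
  assumes "\<And>a. a \<in> set A \<Longrightarrow> 0 \<le> a" "0 \<le> m" "0 \<le> t1" "t1 \<le> t"
  shows "ennreal (exp (m * (t - t1)) * (t1 ^ length A / fact (length A))) \<le> path_int (A @ [m]) t"
  using assms
proof (induction A arbitrary: t t1)
  case Nil
  then show ?case by (auto simp: exp_kernel_def mult_left_mono)
next
  case (Cons a A)
  let ?n = "length A"
  have "ennreal (exp (m * (t - t1)) * (t1 ^ Suc ?n / fact (Suc ?n)))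
      = ennreal (exp (m * (t - t1))) * (\<integral>\<^sup>+s. (ennreal ((t1 - s) ^ ?n / fact ?n) * indicator {0..t1} s) \<partial>lborel)"
    using Cons by (subst nn_integral_power_Icc) (simp_all add: ennreal_mult'[symmetric] del: fact_Suc)
  also have "\<dots> = (\<integral>\<^sup>+s. ennreal (exp (m * (t - t1))) * (ennreal ((t1 - s) ^ ?n / fact ?n) * indicator {0..t1} s) \<partial>lborel)"
    by (subst nn_integral_cmult) auto
  also have "\<dots> \<le> (\<integral>\<^sup>+s. exp_kernel a s * path_int (A @ [m]) (t - s) \<partial>lborel)"
  proof (intro nn_integral_mono)
    fix s :: real
    show "ennreal (exp (m * (t - t1))) * (ennreal ((t1 - s) ^ ?n / fact ?n) * indicator {0..t1} s) \<le> exp_kernel a s * path_int (A @ [m]) (t - s)"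
    proof (cases "0 \<le> s \<and> s \<le> t1")
      case True
      have "1 * ennreal (exp (m * ((t - s) - (t1 - s))) * ((t1 - s) ^ ?n / fact ?n)) \<le> exp_kernel a s * path_int (A @ [m]) (t - s)"
      proof (rule mult_mono)
        show "ennreal (exp (m * (t - s - (t1 - s))) * ((t1 - s) ^ ?n / fact ?n)) \<le> path_int (A @ [m]) (t - s)"
          by (rule Cons.IH) (use Cons True in auto)
        show "1 \<le> exp_kernel a s" using True Cons by (auto simp: exp_kernel_def)
      qed auto
      then show ?thesis using True ennreal_mult'[of "exp (m * (t - t1))" "(t1 - s) ^ ?n / fact ?n"] by simp
    next
      case False
      then show ?thesis by auto
    qed
  qed
  also have "\<dots> = path_int ((a # A) @ [m]) t"
    by (simp add: path_int_Cons conv_def)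
  finally show ?case by simp
qed

lemma exp_kernel_shift_le:
  assumes "0 \<le> s"
  shows "exp_kernel m (v - s) \<le> ennreal (exp (- m * s)) * exp_kernel m v"
proof (cases "s \<le> v")
  case True
  have "exp (m * (v - s)) = exp (- m * s) * exp (m * v)"
    unfolding mult_exp_exp by (simp add: algebra_simps)
  then show ?thesis using True assms by (simp add: exp_kernel_def ennreal_mult'[symmetric])
qed simp

text \<open>Extending the stay at a site of rate \<open>m\<close> by \<open>s\<close> turns the time
  budget \<open>t - s\<close> into \<open>t\<close> and multiplies the integrand by
  \<open>exp (m * s)\<close>.\<close>

lemma path_int_decay:
  assumes "m \<in> set A" "0 \<le> s"
  shows "path_int A (t - s) \<le> ennreal (exp (- m * s)) * path_int A t"
proof -
  obtain A1 A2 where A: "A = A1 @ m # A2" using assms by (meson split_list)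
  have [simp]: "path_int A = path_int (m # A1 @ A2)" by (simp add: A path_int_move)
  show ?thesis
  proof (cases "A1 @ A2 = []")
    case True
    then show ?thesis using assms exp_kernel_shift_le[of s m t] by simp
  next
    case False
    let ?A = "A1 @ A2"
    have "path_int A (t - s) = (\<integral>\<^sup>+v. exp_kernel m v * path_int ?A (t - s - v) \<partial>lborel)"
      using False by (simp add: path_int_Cons conv_def)
    also have "\<dots> = (\<integral>\<^sup>+v. exp_kernel m (v - s) * path_int ?A (t - v) \<partial>lborel)"
      by (subst nn_integral_real_affine[where c = 1 and t = "- s"]) auto
    also have "\<dots> \<le> (\<integral>\<^sup>+v. ennreal (exp (- m * s)) * (exp_kernel m v * path_int ?A (t - v)) \<partial>lborel)"
    proof (intro nn_integral_mono)
      fix v :: real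
      from exp_kernel_shift_le[OF assms(2), of m v]
      show "exp_kernel m (v - s) * path_int ?A (t - v) \<le> ennreal (exp (- m * s)) * (exp_kernel m v * path_int ?A (t - v))"
        by (metis mult.assoc mult_right_mono zero_le)
    qed
    also have "\<dots> = ennreal (exp (- m * s)) * path_int A t"
      using False by (subst nn_integral_cmult) (auto simp: path_int_Cons conv_def)
    finally show ?thesis .
  qed
qed

lemma nn_integral_exp_kernel:
  assumes "c > 0"
  shows "(\<integral>\<^sup>+s. exp_kernel (- c) s \<partial>lborel) = ennreal (1 / c)"
proof -
  have "(\<integral>\<^sup>+s. exp_kernel (- c) s \<partial>lborel) = (\<integral>\<^sup>+s. ennreal (exp (- c * s)) * indicator {0..} s \<partial>lborel)"
    by (simp add: exp_kernel_def)
  also have "\<dots> = ennreal (0 - (- exp (- c * 0) / c))"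
  proof (rule nn_integral_FTC_atLeast)
    show "((\<lambda>s. - exp (- c * s) / c) \<longlongrightarrow> 0) at_top"
      using assms by real_asymp
  qed (use assms in \<open>auto intro!: derivative_eq_intros\<close>)
  finally show ?thesis by simp
qed

text \<open>Integrate the decay estimate over the holding time of the extra site; the net rate
  \<open>b - m\<close> is negative and gives \<open>1 / (m - b)\<close>.\<close>

lemma path_int_remove1:
  assumes "m \<in> set A" "b < m"
  shows "path_int (b # A) t \<le> ennreal (1 / (m - b)) * path_int A t"
proof -
  have "A \<noteq> []" using assms by auto
  then have "path_int (b # A) t = (\<integral>\<^sup>+s. exp_kernel b s * path_int A (t - s) \<partial>lborel)"
    by (simp add: path_int_Cons conv_def)
  also have "\<dots> \<le> (\<integral>\<^sup>+s. exp_kernel (- (m - b)) s * path_int A t \<partial>lborel)"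
  proof (intro nn_integral_mono)
    fix s :: real
    show "exp_kernel b s * path_int A (t - s) \<le> exp_kernel (- (m - b)) s * path_int A t"
    proof (cases "s \<ge> 0")
      case True
      have "exp_kernel b s * path_int A (t - s) \<le> exp_kernel b s * (ennreal (exp (- m * s)) * path_int A t)"
        by (intro mult_left_mono path_int_decay assms True) auto
      also have "\<dots> = ennreal (exp (b * s) * exp (- m * s)) * path_int A t"
        using True by (simp add: exp_kernel_def ennreal_mult' mult.assoc)
      also have "exp (b * s) * exp (- m * s) = exp (- (m - b) * s)"
        by (simp add: mult_exp_exp algebra_simps)
      finally show ?thesis using True by (simp add: exp_kernel_def)
    qed auto
  qed
  also have "\<dots> = ennreal (1 / (m - b)) * path_int A t"
    using nn_integral_exp_kernel[of "m - b"] assms by (subst nn_integral_multc) auto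
  finally show ?thesis .
qed

lemma path_int_remove:
  assumes "m \<in> set (A @ C)" "\<And>b. b \<in> set B \<Longrightarrow> b \<le> m / 2" "m > 0"
  shows "path_int (A @ B @ C) t \<le> ennreal ((2 / m) ^ length B) * path_int (A @ C) t"
  using assms
proof (induction B)
  case (Cons b B)
  have "path_int (A @ (b # B) @ C) t = path_int (b # A @ B @ C) t"
    by (simp add: path_int_move)
  also have "\<dots> \<le> ennreal (1 / (m - b)) * path_int (A @ B @ C) t"
    using Cons.prems(2)[of b] Cons.prems(1,3) by (intro path_int_remove1) auto
  also have "\<dots> \<le> ennreal (2 / m) * (ennreal ((2 / m) ^ length B) * path_int (A @ C) t)"
  proof (intro mult_mono ennreal_leI)
    have "b \<le> m / 2" using Cons.prems(2)[of b] by simp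
    then have "m / 2 \<le> m - b" by simp
    then have "1 / (m - b) \<le> 1 / (m / 2)" using Cons.prems(3) by (intro divide_left_mono) auto
    then show "1 / (m - b) \<le> 2 / m" by simp
    show "path_int (A @ B @ C) t \<le> ennreal ((2 / m) ^ length B) * path_int (A @ C) t"
      using Cons.IH[OF Cons.prems(1)] Cons.prems(2,3) by simp
  qed auto
  also have "\<dots> = ennreal ((2 / m) ^ length (b # B)) * path_int (A @ C) t"
  proof -
    have "ennreal ((2 / m) ^ length (b # B)) = ennreal (2 / m) * ennreal ((2 / m) ^ length B)"
      using Cons.prems(3) by (subst ennreal_mult'[symmetric]) auto
    then show ?thesis by (simp add: mult.assoc)
  qed
  finally show ?case .
qed auto

lemma exp_kernel_scale_le:
  assumes "a \<le> M" "0 < l" "l \<le> 1" "0 \<le> s"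
  shows "ennreal (exp (- M * (1 - l) * s)) * exp_kernel a s \<le> exp_kernel a (l * s)"
proof -
  have "a * ((1 - l) * s) \<le> M * ((1 - l) * s)"
    using assms by (intro mult_right_mono) auto
  then have "exp (- M * (1 - l) * s + a * s) \<le> exp (a * (l * s))"
    by (simp add: algebra_simps)
  then show ?thesis using assms
    by (simp add: exp_kernel_def ennreal_mult'[symmetric] mult_exp_exp)
qed

text \<open>Substitute \<open>l * s\<close> for every holding time \<open>s\<close>: the Jacobian is
  \<open>l\<close> to the number of free holding times, and the exponent drops by at most
  \<open>M * (1 - l) * t\<close>.\<close>

lemma path_int_scale:
  assumes "\<And>a. a \<in> set A \<Longrightarrow> a \<le> M" "0 < l" "l \<le> 1" "0 \<le> t"
  shows "ennreal (l ^ (length A - 1) * exp (- M * (1 - l) * t)) * path_int A t \<le> path_int A (l * t)"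
  using assms
proof (induction A arbitrary: t rule: path_int.induct)
  case (2 a)
  then show ?case using exp_kernel_scale_le[of a M l t] by simp
next
  case (3 a b as)
  let ?n = "length as" and ?c = "ennreal (l ^ length as * exp (- M * (1 - l) * t))"
  have "ennreal (l ^ Suc ?n * exp (- M * (1 - l) * t)) * path_int (a # b # as) t
     = ennreal l * (?c * (\<integral>\<^sup>+s. exp_kernel a s * path_int (b # as) (t - s) \<partial>lborel))"
    using 3 by (simp add: conv_def ennreal_mult'[symmetric] mult.assoc[symmetric])
  also have "\<dots> = ennreal l * (\<integral>\<^sup>+s. ?c * (exp_kernel a s * path_int (b # as) (t - s)) \<partial>lborel)"
    by (subst nn_integral_cmult) auto
  also have "\<dots> \<le> ennreal l * (\<integral>\<^sup>+s. exp_kernel a (l * s) * path_int (b # as) (l * t - l * s) \<partial>lborel)"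
  proof (intro mult_left_mono nn_integral_mono)
    fix s :: real
    show "?c * (exp_kernel a s * path_int (b # as) (t - s)) \<le> exp_kernel a (l * s) * path_int (b # as) (l * t - l * s)"
    proof (cases "0 \<le> s \<and> s \<le> t")
      case True
      have "ennreal (exp (- M * (1 - l) * s)) * exp_kernel a s \<le> exp_kernel a (l * s)"
        using True 3 by (intro exp_kernel_scale_le) auto
      moreover have "ennreal (l ^ ?n * exp (- M * (1 - l) * (t - s))) * path_int (b # as) (t - s) \<le> path_int (b # as) (l * (t - s))"
        using 3 True by (intro order_trans[OF _ "3.IH"]) auto
      ultimately have "(ennreal (exp (- M * (1 - l) * s)) * exp_kernel a s) *
         (ennreal (l ^ ?n * exp (- M * (1 - l) * (t - s))) * path_int (b # as) (t - s))
         \<le> exp_kernel a (l * s) * path_int (b # as) (l * t - l * s)"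
        by (intro mult_mono) (auto simp: algebra_simps)
      moreover have "?c = ennreal (exp (- M * (1 - l) * s)) * ennreal (l ^ ?n * exp (- M * (1 - l) * (t - s)))"
      proof -
        have "l ^ ?n * exp (- M * (1 - l) * t) = exp (- M * (1 - l) * s) * (l ^ ?n * exp (- M * (1 - l) * (t - s)))"
          using mult_exp_exp[of "- M * (1 - l) * s" "- M * (1 - l) * (t - s)"] by (simp add: algebra_simps)
        then show ?thesis by (simp only: ennreal_mult'[symmetric] exp_ge_zero)
      qed
      ultimately show ?thesis by (simp add: mult_ac)
    next
      case False
      then have "s < 0 \<or> t - s < 0" by auto
      then show ?thesis by auto
    qed
  qed auto
  also have "\<dots> = (\<integral>\<^sup>+s. exp_kernel a s * path_int (b # as) (l * t - s) \<partial>lborel)"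
    using 3 by (subst (2) nn_integral_real_affine[where c = l and t = 0]) auto
  also have "\<dots> = path_int (a # b # as) (l * t)" by (simp add: conv_def)
  finally show ?case by simp
qed auto

lemma conv_exp_kernel_same: "conv (exp_kernel b) (exp_kernel b) t = ennreal t * exp_kernel b t"
proof (cases "t \<ge> 0")
  case True
  have "conv (exp_kernel b) (exp_kernel b) t = (\<integral>\<^sup>+s. ennreal (exp (b * t)) * indicator {0..t} s \<partial>lborel)"
    unfolding conv_def
  proof (rule nn_integral_cong)
    fix s :: real
    have "exp (b * s) * exp (b * (t - s)) = exp (b * t)"
      by (simp add: mult_exp_exp algebra_simps)
    then show "exp_kernel b s * exp_kernel b (t - s) = ennreal (exp (b * t)) * indicator {0..t} s"
      by (auto simp: exp_kernel_def indicator_def ennreal_mult'[symmetric])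
  qed
  also have "\<dots> = ennreal t * exp_kernel b t"
    using True by (simp add: nn_integral_cmult exp_kernel_def mult.commute)
  finally show ?thesis .
next
  case False
  have "conv (exp_kernel b) (exp_kernel b) t = path_int [b, b] t" by simp
  also have "\<dots> = 0" using False by (subst path_int_neg) auto
  finally show ?thesis using False by simp
qed

text \<open>This is \<open>1 + d * s \<le> exp (d * s)\<close>. The linear term is written as a
  convolution, that is as a doubled visit, so that it can be compared with the original
  path.\<close>

lemma exp_kernel_bump:
  assumes "0 \<le> d"
  shows "exp_kernel b s + ennreal d * conv (exp_kernel b) (exp_kernel b) s \<le> exp_kernel (b + d) s"
proof (cases "s \<ge> 0")
  case True
  have "exp (b * s) + d * (s * exp (b * s)) = (1 + d * s) * exp (b * s)"
    by (simp add: algebra_simps)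
  also have "\<dots> \<le> exp (d * s) * exp (b * s)"
    by (intro mult_right_mono) (auto simp: exp_ge_add_one_self)
  also have "\<dots> = exp ((b + d) * s)"
    by (simp add: mult_exp_exp algebra_simps)
  finally have "ennreal (exp (b * s) + d * (s * exp (b * s))) \<le> ennreal (exp ((b + d) * s))"
    by (rule ennreal_leI)
  moreover have "ennreal (exp (b * s) + d * (s * exp (b * s))) = ennreal (exp (b * s)) + ennreal d * (ennreal s * ennreal (exp (b * s)))"
    using True assms by (simp add: ennreal_plus ennreal_mult)
  ultimately show ?thesis using True by (simp add: conv_exp_kernel_same exp_kernel_def)
qed (simp add: conv_exp_kernel_same)

text \<open>The derivative of a path integral in the rate \<open>b\<close> is the integral with
  \<open>b\<close> entered twice. The doubled visit is worth at least
  \<open>1 / (2 * exp 1 * M)\<close> of the original: let the extra holding time run over an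
  interval of length \<open>1 / M\<close> and make room for it by shrinking all the others.\<close>

lemma path_int_bump:
  assumes "A \<noteq> []" "\<And>a. a \<in> set (b # A) \<Longrightarrow> a \<le> M" "0 \<le> b" "0 \<le> d" "0 < M" "0 < t"
    and n: "1 \<le> length A" "2 * real (length A) \<le> M * t"
  shows "ennreal (1 + d / (2 * exp 1 * M)) * path_int (b # A) t \<le> path_int ((b + d) # A) t"
proof -
  let ?F = "path_int (b # A)" and ?E = "exp_kernel b" and ?h = "path_int A"
  have Mt: "M * t \<ge> 2" using n by simp
  have lower: "ennreal (1 / (2 * exp 1 * M)) * ?F t \<le> conv ?E ?F t"
  proof -
    have "ennreal (1 / (2 * exp 1 * M)) * ?F t = (\<integral>\<^sup>+s. (ennreal (1 / (2 * exp 1)) * ?F t) * indicator {0..1 / M} s \<partial>lborel)"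
    proof -
      have "ennreal (1 / (2 * exp 1 * M)) = ennreal (1 / (2 * exp 1)) * ennreal (1 / M)"
        using assms by (subst ennreal_mult'[symmetric]) auto
      then show ?thesis using assms by (subst nn_integral_cmult) (auto simp: mult_ac)
    qed
    also have "\<dots> \<le> conv ?E ?F t"
      unfolding conv_def
    proof (rule nn_integral_mono)
      fix s :: real
      show "(ennreal (1 / (2 * exp 1)) * ?F t) * indicator {0..1 / M} s \<le> ?E s * ?F (t - s)"
      proof (cases "0 \<le> s \<and> s \<le> 1 / M")
        case True
        \<comment> \<open>The total time shrinks from \<open>t\<close> to \<open>t - s\<close>.
          Since \<open>s \<le> 1 / M\<close> and \<open>2 * length A \<le> M * t\<close>, Bernoulli
          gives a Jacobian of at least 1/2, and the exponent loses at most 1.\<close>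
        define l where "l = 1 - s / t"
        have sM: "s * M \<le> 1" using True assms by (simp add: field_simps)
        have "s < t"
        proof -
          have "s * M < t * M" using sM Mt by (simp add: mult.commute)
          then show ?thesis using assms by simp
        qed
        then have l: "0 < l" "l \<le> 1" using True assms by (auto simp: l_def field_simps)
        have lt: "l * t = t - s" using assms by (simp add: l_def field_simps)
        have "1 - l = s / t" by (simp add: l_def)
        also have "\<dots> \<le> 1 / (M * t)" using sM assms True by (simp add: field_simps)
        finally have dl: "real (length A) * (1 - l) \<le> 1 / 2"
        proof -
          assume "1 - l \<le> 1 / (M * t)"
          then have "real (length A) * (1 - l) \<le> real (length A) * (1 / (M * t))"
            by (intro mult_left_mono) auto
          also have "\<dots> \<le> 1 / 2" using n assms Mt by (simp add: field_simps)
          finally show ?thesis .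
        qed
        have "1 / 2 \<le> 1 + real (length A) * (l - 1)"
          using dl by (simp add: algebra_simps)
        also have "\<dots> \<le> (1 + (l - 1)) ^ length A"
          using l by (intro Bernoulli_inequality) auto
        finally have l2: "1 / 2 \<le> l ^ length A" by simp
        have "(1 - l) * t = s" using assms by (simp add: l_def)
        then have "M * (1 - l) * t \<le> 1" using sM by (metis mult.assoc mult.commute)
        then have e2: "exp (- 1) \<le> exp (- M * (1 - l) * t)" by simp
        have "1 / (2 * exp 1) = (1 / 2) * exp (- 1 :: real)" by (simp add: exp_minus field_simps)
        also have "\<dots> \<le> l ^ length A * exp (- M * (1 - l) * t)"
          using l2 e2 l by (intro mult_mono) auto
        finally have "ennreal (1 / (2 * exp 1)) * ?F t \<le> ennreal (l ^ (length (b # A) - 1) * exp (- M * (1 - l) * t)) * ?F t"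
          by (intro mult_right_mono ennreal_leI) auto
        also have "\<dots> \<le> ?F (l * t)"
          using assms l by (intro path_int_scale) auto
        also have "\<dots> = 1 * ?F (t - s)" by (simp add: lt)
        also have "\<dots> \<le> ?E s * ?F (t - s)"
          using True assms by (intro mult_right_mono) (auto simp: exp_kernel_def)
        finally show ?thesis using True by simp
      qed auto
    qed
    finally show ?thesis .
  qed
  have "ennreal (1 + d / (2 * exp 1 * M)) * ?F t = ?F t + ennreal d * (ennreal (1 / (2 * exp 1 * M)) * ?F t)"
    using assms by (simp add: ennreal_plus distrib_right mult.assoc[symmetric] ennreal_mult[symmetric])
  also have "\<dots> \<le> ?F t + ennreal d * conv ?E ?F t"
    by (intro add_left_mono mult_left_mono lower) auto
  also have "conv ?E ?F t = conv ?E (conv ?E ?h) t"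
    using assms by (simp add: path_int_Cons)
  also have "\<dots> = conv (conv ?E ?E) ?h t"
    by (rule conv_assoc[symmetric]) auto
  also have "?F t = conv ?E ?h t" using assms by (simp add: path_int_Cons)
  also have "conv ?E ?h t + ennreal d * conv (conv ?E ?E) ?h t = conv (\<lambda>s. ?E s + ennreal d * conv ?E ?E s) ?h t"
    unfolding conv_def[of _ ?h]
    by (subst nn_integral_cmult[symmetric], simp, subst nn_integral_add[symmetric])
       (auto simp: distrib_right mult.assoc)
  also have "\<dots> \<le> conv (exp_kernel (b + d)) ?h t"
    by (intro conv_mono exp_kernel_bump assms) auto
  also have "\<dots> = path_int ((b + d) # A) t" using assms by (simp add: path_int_Cons)
  finally show ?thesis using assms by (simp add: path_int_Cons)
qed

section \<open>The Feynman--Kac formula as a sum over jump sequences\<close>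

lemma measurable_sum_int:
  fixes f :: "'c \<Rightarrow> 'a \<Rightarrow> int"
  assumes "\<And>i. i \<in> S \<Longrightarrow> f i \<in> measurable M (count_space UNIV)"
  shows "(\<lambda>x. \<Sum>i\<in>S. f i x) \<in> measurable M (count_space UNIV)"
proof cases
  assume "finite S"
  then show ?thesis using assms by induct auto
qed simp

abbreviation walk_space :: "(nat \<Rightarrow> real \<times> int) measure" where
  "walk_space \<equiv> (\<Pi>\<^sub>M k\<in>UNIV. borel \<Otimes>\<^sub>M count_space UNIV)"

lemma sets_step_measure [measurable_cong]: "sets step_measure = sets (borel \<Otimes>\<^sub>M count_space UNIV)"
  unfolding step_measure_def by (rule sets_pair_measure_cong) simp_all

lemma sets_walk_measure [measurable_cong]: "sets walk_measure = sets walk_space"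
  unfolding walk_measure_def by (intro sets_PiM_cong sets_step_measure refl)

interpretation exp_density: prob_space "density lborel (\<lambda>x. ennreal (exponential_density 2 x))"
  using prob_space_exponential_density[of 2] by simp

interpretation step: pair_prob_space "density lborel (\<lambda>x. ennreal (exponential_density 2 x))"
  "measure_pmf (pmf_of_set {-1, 1 :: int})"
  by unfold_locales

lemma prob_space_step: "prob_space step_measure"
  unfolding step_measure_def by (rule step.P.prob_space_axioms)

interpretation walk: sequence_space step_measure
  by (intro sequence_space.intro product_prob_space.intro product_sigma_finite.intro product_prob_space_axioms.intro)
     (auto intro: prob_space_imp_sigma_finite prob_space_step)

lemma prob_space_walk: "prob_space walk_measure"
  unfolding walk_measure_def by (rule walk.P.prob_space_axioms)

section \<open>Arrival times and measurability of the walk\<close>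

definition arrival :: "(nat \<Rightarrow> real \<times> int) \<Rightarrow> nat \<Rightarrow> real" where
  "arrival w n = (\<Sum>j<n. fst (w j))"

lemma walk_pos_arrival: "walk_pos w s = (\<Sum>k\<in>{k. arrival w (Suc k) \<le> s}. snd (w k))"
  by (simp add: walk_pos_def arrival_def lessThan_Suc_atMost)

lemma measurable_arrival [measurable]: "(\<lambda>w. arrival w n) \<in> borel_measurable walk_space"
  unfolding arrival_def by measurable

lemma finite_set_alt: "finite {k::nat. P k} \<longleftrightarrow> (\<exists>K. \<forall>k\<ge>K. \<not> P k)"
  by (metis (mono_tags, lifting) finite_nat_set_iff_bounded mem_Collect_eq not_le)

text \<open>A sum over an infinite index set is 0 by convention, and the else branch reproduces
  this. Below the least bound \<open>K\<close> the sum has finitely many measurable terms, which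
  yields measurability of the position.\<close>

lemma walk_pos_alt:
  "walk_pos w s = (if \<exists>K. \<forall>k\<ge>K. s < arrival w (Suc k)
     then \<Sum>k<(LEAST K. \<forall>k\<ge>K. s < arrival w (Suc k)). if arrival w (Suc k) \<le> s then snd (w k) else 0 else 0)"
proof (cases "\<exists>K. \<forall>k\<ge>K. s < arrival w (Suc k)")
  case True
  define K where "K = (LEAST K. \<forall>k\<ge>K. s < arrival w (Suc k))"
  have K: "\<forall>k\<ge>K. s < arrival w (Suc k)" unfolding K_def using True by (rule LeastI_ex)
  have eq: "{k. arrival w (Suc k) \<le> s} = {k \<in> {..<K}. arrival w (Suc k) \<le> s}"
    using K by (auto simp: not_le[symmetric])
  show ?thesis
    unfolding walk_pos_arrival if_P[OF True] K_def[symmetric] eq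
    by (subst sum.inter_filter) auto
next
  case False
  then have "infinite {k. arrival w (Suc k) \<le> s}"
    by (subst finite_set_alt) (auto simp: not_le)
  then show ?thesis unfolding walk_pos_arrival if_not_P[OF False] by simp
qed

lemma measurable_walk_pos [measurable]:
  "(\<lambda>x. walk_pos (fst x) (snd x)) \<in> measurable (walk_space \<Otimes>\<^sub>M borel) (count_space UNIV)"
proof -
  have [measurable]: "Measurable.pred (walk_space \<Otimes>\<^sub>M borel) (\<lambda>x. snd x < arrival (fst x) (Suc k))" for k
    by measurable
  have [measurable]: "Measurable.pred (walk_space \<Otimes>\<^sub>M borel) (\<lambda>x. arrival (fst x) (Suc k) \<le> snd x)" for k
    by measurable
  have [measurable]: "(\<lambda>x. snd (fst x k)) \<in> measurable (walk_space \<Otimes>\<^sub>M (borel :: real measure)) (count_space UNIV)" for k :: nat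
    by measurable
  have [measurable]: "(\<lambda>x. LEAST K. \<forall>k\<ge>K. snd x < arrival (fst x) (Suc k)) \<in> measurable (walk_space \<Otimes>\<^sub>M borel) (count_space UNIV)"
    by measurable
  have *: "(\<lambda>x. \<Sum>k<K. if arrival (fst x) (Suc k) \<le> snd x then snd (fst x k) else 0) \<in> measurable (walk_space \<Otimes>\<^sub>M borel) (count_space UNIV)" for K
    by (rule measurable_sum_int) measurable
  have "(\<lambda>x. \<Sum>k<(LEAST K. \<forall>k\<ge>K. snd x < arrival (fst x) (Suc k)). if arrival (fst x) (Suc k) \<le> snd x then snd (fst x k) else 0) \<in> measurable (walk_space \<Otimes>\<^sub>M borel) (count_space UNIV)"
    by (rule measurable_compose_countable[OF *]) measurable
  then show ?thesis unfolding walk_pos_alt by measurable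
qed

lemma measurable_walk_pos' [measurable (raw)]:
  assumes "f \<in> measurable N walk_space" "g \<in> borel_measurable N"
  shows "(\<lambda>x. walk_pos (f x) (g x)) \<in> measurable N (count_space UNIV)"
  using measurable_compose[OF measurable_Pair[OF assms] measurable_walk_pos] by simp

text \<open>The starting point \<open>x\<close> is a parameter so that the walk can be restarted
  after its first jump; \<open>pam_u\<close> is the case \<open>x = 0\<close>.\<close>

definition fk_weight :: "(int \<Rightarrow> real) \<Rightarrow> int \<Rightarrow> real \<Rightarrow> (nat \<Rightarrow> real \<times> int) \<Rightarrow> real" where
  "fk_weight xi x t w = exp (LINT s:{0..t}|lborel. xi (x + walk_pos w s))"

lemma measurable_fk_weight [measurable]:
  "(\<lambda>(t, w). fk_weight xi x t w) \<in> borel_measurable (borel \<Otimes>\<^sub>M walk_space)"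
proof -
  have [measurable]: "(\<lambda>q. xi (x + walk_pos (snd (fst q)) (snd q))) \<in> borel_measurable ((borel \<Otimes>\<^sub>M walk_space) \<Otimes>\<^sub>M lborel)"
    by (rule measurable_compose[of _ _ "count_space UNIV" "\<lambda>z. xi (x + z)"]) measurable
  have "(\<lambda>p. LINT s|lborel. (if 0 \<le> s \<and> s \<le> fst p then xi (x + walk_pos (snd p) s) else 0))
    \<in> borel_measurable (borel \<Otimes>\<^sub>M walk_space)"
    by measurable
  moreover have "(if 0 \<le> s \<and> s \<le> fst p then xi (x + walk_pos (snd p) s) else 0) = indicator {0..fst p} s *\<^sub>R xi (x + walk_pos (snd p) s)" for s p
    by (simp add: indicator_def)
  ultimately show ?thesis unfolding fk_weight_def set_lebesgue_integral_def
    by (simp add: split_beta')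
qed

section \<open>Decomposition of the walk at its first jump\<close>

lemma arrival_case_nat [simp]: "arrival (case_nat p w) (Suc n) = fst p + arrival w n"
  unfolding arrival_def by (subst sum.lessThan_Suc_shift) simp

lemma arrival_0 [simp]: "arrival w 0 = 0" by (simp add: arrival_def)

definition pos_times :: "(nat \<Rightarrow> real \<times> int) \<Rightarrow> bool" where
  "pos_times w \<longleftrightarrow> (\<forall>k. 0 < fst (w k))"

definition num_jumps_at :: "nat \<Rightarrow> real \<Rightarrow> (nat \<Rightarrow> real \<times> int) \<Rightarrow> bool" where
  "num_jumps_at n t w \<longleftrightarrow> arrival w n \<le> t \<and> t < arrival w (Suc n)"

lemma arrival_strict_mono: "pos_times w \<Longrightarrow> strict_mono (arrival w)"
  by (auto simp: strict_mono_Suc_iff arrival_def pos_times_def)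

lemma arrival_mono: "pos_times w \<Longrightarrow> m \<le> n \<Longrightarrow> arrival w m \<le> arrival w n"
  using arrival_strict_mono strict_mono_less_eq by blast

lemma finite_jumps:
  assumes "pos_times w" "num_jumps_at n t w" "s \<le> t"
  shows "finite {k. arrival w (Suc k) \<le> s}"
proof (rule finite_subset[of _ "{..<n}"])
  show "{k. arrival w (Suc k) \<le> s} \<subseteq> {..<n}"
  proof safe
    fix k assume k: "arrival w (Suc k) \<le> s"
    show "k < n"
    proof (rule ccontr)
      assume "\<not> k < n"
      then have "arrival w (Suc n) \<le> arrival w (Suc k)" by (intro arrival_mono assms) auto
      then show False using k assms by (simp add: num_jumps_at_def)
    qed
  qed
qed simp

lemma walk_pos_before:
  assumes "pos_times w" "s < fst (w 0)"
  shows "walk_pos w s = 0"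
proof -
  have "arrival w 1 \<le> arrival w (Suc k)" for k by (intro arrival_mono assms) auto
  moreover have "arrival w 1 = fst (w 0)" by (simp add: arrival_def)
  ultimately have "{k. arrival w (Suc k) \<le> s} = {}" using assms by (auto simp: not_le intro: less_le_trans)
  then show ?thesis by (simp add: walk_pos_arrival)
qed

lemma walk_pos_case_nat:
  assumes "pos_times w" "num_jumps_at n (t - h) w" "s \<le> t" "h \<le> s"
  shows "walk_pos (case_nat (h, j) w) s = j + walk_pos w (s - h)"
proof -
  have "{k. arrival (case_nat (h, j) w) (Suc k) \<le> s} = insert 0 (Suc ` {k. arrival w (Suc k) \<le> s - h})"
  proof (intro set_eqI)
    fix k show "k \<in> {k. arrival (case_nat (h, j) w) (Suc k) \<le> s} \<longleftrightarrow> k \<in> insert 0 (Suc ` {k. arrival w (Suc k) \<le> s - h})"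
      using assms by (cases k) (auto simp: algebra_simps)
  qed
  moreover have "finite {k. arrival w (Suc k) \<le> s - h}"
    using assms by (intro finite_jumps[of w n "t - h"]) auto
  ultimately show ?thesis
    unfolding walk_pos_arrival by (simp add: sum.reindex)
qed

lemma pos_times_case_nat [simp]: "pos_times (case_nat p w) \<longleftrightarrow> 0 < fst p \<and> pos_times w"
proof
  assume *: "pos_times (case_nat p w)"
  show "0 < fst p \<and> pos_times w"
    using *[unfolded pos_times_def, rule_format, of 0] *[unfolded pos_times_def, rule_format, of "Suc _"]
    by (simp add: pos_times_def)
qed (auto simp: pos_times_def split: nat.splits)

lemma num_jumps_at_Suc_case_nat [simp]:
  "num_jumps_at (Suc n) t (case_nat (h, j) w) \<longleftrightarrow> num_jumps_at n (t - h) w"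
  by (auto simp: num_jumps_at_def algebra_simps)

lemma num_jumps_at_nonneg: "pos_times w \<Longrightarrow> num_jumps_at n t w \<Longrightarrow> 0 \<le> t"
  using arrival_mono[of w 0 n] by (auto simp: num_jumps_at_def)

lemma walk_pos_finite_range:
  assumes "pos_times w" "num_jumps_at n t w" "s \<le> t"
  shows "walk_pos w s \<in> (\<lambda>A. \<Sum>k\<in>A. snd (w k)) ` Pow {..<n}"
proof -
  have "{k. arrival w (Suc k) \<le> s} \<subseteq> {..<n}"
  proof safe
    fix k assume k: "arrival w (Suc k) \<le> s"
    show "k < n"
    proof (rule ccontr)
      assume "\<not> k < n"
      then have "arrival w (Suc n) \<le> arrival w (Suc k)" by (intro arrival_mono assms) auto
      then show False using k assms by (simp add: num_jumps_at_def)
    qed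
  qed
  then show ?thesis unfolding walk_pos_arrival by blast
qed

text \<open>\<open>xi\<close> is arbitrary, but up to time \<open>t\<close> the walk stays in a
  finite set. Integrability is what permits splitting the time integral at the first jump.\<close>

lemma set_integrable_walk:
  fixes xi :: "int \<Rightarrow> real"
  assumes "pos_times w" "num_jumps_at n t w" "w \<in> space walk_space"
  shows "set_integrable lborel {0..t} (\<lambda>s. xi (x + walk_pos w s))"
proof -
  let ?S = "(\<lambda>A. \<Sum>k\<in>A. snd (w k)) ` Pow {..<n}"
  define B where "B = Max ((\<lambda>z. \<bar>xi (x + z)\<bar>) ` ?S)"
  have "(\<lambda>s. walk_pos w s) \<in> measurable borel (count_space UNIV)"
    by (rule measurable_walk_pos') (use assms(3) in simp_all)
  then have m: "(\<lambda>s. xi (x + walk_pos w s)) \<in> borel_measurable lborel"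
    using measurable_compose[of "walk_pos w" borel "count_space UNIV" "\<lambda>z. xi (x + z)" borel] by simp
  have fin: "finite ((\<lambda>z. \<bar>xi (x + z)\<bar>) ` ?S)" by simp
  have bound: "norm (xi (x + walk_pos w s)) \<le> B" if "s \<in> {0..t}" for s
  proof -
    have "walk_pos w s \<in> ?S" using walk_pos_finite_range[OF assms(1,2)] that by simp
    then show ?thesis unfolding B_def real_norm_def by (intro Max_ge[OF fin] imageI)
  qed
  show ?thesis
    unfolding set_integrable_def
    by (rule integrableI_bounded_set_indicator[where B = B]) (use bound m in \<open>simp_all add: emeasure_lborel_Icc_eq\<close>)
qed

lemma fk_weight_case_nat:
  assumes w: "pos_times w" "num_jumps_at n (t - h) w" "w \<in> space walk_space" and h: "h > 0"
  shows "fk_weight xi x t (case_nat (h, j) w) = exp (xi x * h) * fk_weight xi (x + j) (t - h) w"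
proof -
  let ?w = "case_nat (h, j) w"
  have th: "h \<le> t" using num_jumps_at_nonneg[OF w(1,2)] by simp
  have w': "pos_times ?w" "num_jumps_at (Suc n) t ?w" using w h by auto
  have sp: "?w \<in> space walk_space" by (simp add: space_PiM space_pair_measure)
  have int: "set_integrable lborel {0..t} (\<lambda>s. xi (x + walk_pos ?w s))"
    by (rule set_integrable_walk[OF w' sp])
  have "(LINT s:{0..t}|lborel. xi (x + walk_pos ?w s)) =
      (LINT s:{0..<h} \<union> {h..t}|lborel. xi (x + walk_pos ?w s))"
    using th h by (simp add: ivl_disj_un)
  also have "\<dots> = (LINT s:{0..<h}|lborel. xi (x + walk_pos ?w s)) + (LINT s:{h..t}|lborel. xi (x + walk_pos ?w s))"
    using th h by (intro set_integral_Un set_integrable_subset[OF int]) auto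
  also have "(LINT s:{0..<h}|lborel. xi (x + walk_pos ?w s)) = (LINT s:{0..<h}|lborel. xi x)"
    by (intro set_lebesgue_integral_cong allI impI) (use w' in \<open>auto simp: walk_pos_before\<close>)
  also have "\<dots> = xi x * h" using h by (simp add: set_lebesgue_integral_def)
  also have "(LINT s:{h..t}|lborel. xi (x + walk_pos ?w s)) = (LINT s:{h..t}|lborel. xi (x + j + walk_pos w (s - h)))"
    by (intro set_lebesgue_integral_cong allI impI)
       (use w in \<open>auto simp: walk_pos_case_nat[OF w(1,2)] add.assoc\<close>)
  also have "\<dots> = (LINT s:{0..t-h}|lborel. xi (x + j + walk_pos w s))"
    unfolding set_lebesgue_integral_def
    by (subst lborel_integral_real_affine[where c = 1 and t = h])
       (auto intro!: Bochner_Integration.integral_cong simp: indicator_def)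
  finally show ?thesis by (simp add: fk_weight_def exp_add)
qed

lemma fk_weight_const:
  assumes "pos_times w" "0 \<le> t" "t < fst (w 0)"
  shows "fk_weight xi x t w = exp (xi x * t)"
proof -
  have "(LINT s:{0..t}|lborel. xi (x + walk_pos w s)) = (LINT s:{0..t}|lborel. xi x)"
    by (intro set_lebesgue_integral_cong allI impI) (use assms in \<open>auto simp: walk_pos_before\<close>)
  then show ?thesis using assms by (simp add: fk_weight_def set_lebesgue_integral_def)
qed

lemma AE_step_pos: "AE p in step_measure. 0 < fst p"
  unfolding step_measure_def
proof (rule step.AE_pair_measure)
  have "AE x in lborel. x \<noteq> (0::real)" by (rule AE_lborel_singleton)
  then have "AE x in density lborel (\<lambda>x. ennreal (exponential_density 2 x)). 0 < x"
    by (subst AE_density) (auto simp: exponential_density_def not_less split: if_splits elim: eventually_mono)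
  then show "AE x in density lborel (\<lambda>x. ennreal (exponential_density 2 x)).
    AE y in measure_pmf (pmf_of_set {- 1, 1::int}). 0 < fst (x, y)" by simp
qed measurable

lemma AE_pos_times: "AE w in walk_measure. pos_times w"
  unfolding pos_times_def AE_all_countable walk_measure_def
  by (intro allI AE_PiM_component[of UNIV "\<lambda>_. step_measure"] prob_space_step AE_step_pos) auto

text \<open>The density \<open>2 * exp (- 2 * h)\<close> times the jump probability 1/2 leaves the
  kernel of rate -2 for each direction, so sums over jump sequences carry no further
  weights.\<close>

lemma nn_integral_step:
  assumes [measurable]: "f \<in> borel_measurable (borel \<Otimes>\<^sub>M count_space UNIV)"
  shows "(\<integral>\<^sup>+p. f p \<partial>step_measure) = (\<integral>\<^sup>+h. exp_kernel (-2) h * (f (h, -1) + f (h, 1)) \<partial>lborel)"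
proof -
  have [measurable]: "(\<lambda>h. f (h, j)) \<in> borel_measurable borel" for j
    by measurable
  have "(\<integral>\<^sup>+p. f p \<partial>step_measure) = (\<integral>\<^sup>+h. \<integral>\<^sup>+j. f (h, j) \<partial>measure_pmf (pmf_of_set {-1, 1}) \<partial>density lborel (\<lambda>x. ennreal (exponential_density 2 x)))"
    unfolding step_measure_def
    by (rule measure_pmf.nn_integral_fst[symmetric])
       (use assms in \<open>simp cong: measurable_cong_sets sets_pair_measure_cong\<close>)
  also have "\<dots> = (\<integral>\<^sup>+h. (f (h, -1) + f (h, 1)) / 2 \<partial>density lborel (\<lambda>x. ennreal (exponential_density 2 x)))"
    by (intro nn_integral_cong) (simp add: nn_integral_pmf_of_set)
  also have "\<dots> = (\<integral>\<^sup>+h. ennreal (exponential_density 2 h) * ((f (h, -1) + f (h, 1)) / 2) \<partial>lborel)"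
    by (rule nn_integral_density) measurable
  also have "\<dots> = (\<integral>\<^sup>+h. exp_kernel (-2) h * (f (h, -1) + f (h, 1)) \<partial>lborel)"
  proof (intro nn_integral_cong)
    fix h :: real
    have "ennreal (exponential_density 2 h) = 2 * exp_kernel (-2) h"
      by (auto simp: exponential_density_def exp_kernel_def ennreal_mult mult.commute)
    then show "ennreal (exponential_density 2 h) * ((f (h, -1) + f (h, 1)) / 2) = exp_kernel (-2) h * (f (h, -1) + f (h, 1))"
      using mult_divide_eq_ennreal[of 2 "exp_kernel (-2) h * (f (h, -1) + f (h, 1))"]
      by (simp add: ennreal_times_divide mult.assoc mult.commute[of 2])
  qed
  finally show ?thesis .
qed

lemma nn_integral_walk:
  assumes [measurable]: "f \<in> borel_measurable walk_space"
  shows "(\<integral>\<^sup>+w. f w \<partial>walk_measure) = (\<integral>\<^sup>+p. \<integral>\<^sup>+w. f (case_nat p w) \<partial>walk_measure \<partial>step_measure)"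
proof -
  interpret W: prob_space walk_measure by (rule prob_space_walk)
  have f: "f \<in> borel_measurable walk_measure" by measurable
  have cn: "(\<lambda>(s, \<omega>). case_nat s \<omega>) \<in> measurable (step_measure \<Otimes>\<^sub>M walk_measure) walk_measure"
    unfolding walk_measure_def by measurable
  have iter: "distr (step_measure \<Otimes>\<^sub>M walk_measure) walk_measure (\<lambda>(s, \<omega>). case_nat s \<omega>) = walk_measure"
    unfolding walk_measure_def by (rule walk.PiM_iter)
  have "(\<integral>\<^sup>+w. f w \<partial>walk_measure) = (\<integral>\<^sup>+w. f w \<partial>distr (step_measure \<Otimes>\<^sub>M walk_measure) walk_measure (\<lambda>(s, \<omega>). case_nat s \<omega>))"
    unfolding iter ..
  also have "\<dots> = (\<integral>\<^sup>+q. f (case q of (s, \<omega>) \<Rightarrow> case_nat s \<omega>) \<partial>(step_measure \<Otimes>\<^sub>M walk_measure))"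
    by (rule nn_integral_distr[OF cn]) (use f in simp)
  also have "\<dots> = (\<integral>\<^sup>+p. \<integral>\<^sup>+w. f (case (p, w) of (s, \<omega>) \<Rightarrow> case_nat s \<omega>) \<partial>walk_measure \<partial>step_measure)"
    by (rule W.nn_integral_fst[symmetric], rule measurable_compose[OF cn f])
  finally show ?thesis by simp
qed

section \<open>Jump sequences and the sites they visit\<close>

fun psites :: "int \<Rightarrow> int list \<Rightarrow> int list" where
  "psites x [] = []"
| "psites x (j # js) = (x + j) # psites (x + j) js"

definition steps :: "nat \<Rightarrow> int list set" where
  "steps n = {js. length js = n \<and> set js \<subseteq> {-1, 1}}"

lemma steps_0 [simp]: "steps 0 = {[]}" by (auto simp: steps_def)

lemma steps_Suc: "steps (Suc n) = (\<lambda>(j, js). j # js) ` ({-1, 1} \<times> steps n)"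
  by (auto simp: steps_def length_Suc_conv image_iff)

lemma finite_steps [simp]: "finite (steps n)"
  by (induction n) (auto simp: steps_Suc)

lemma card_steps: "card (steps n) = 2 ^ n"
proof (induction n)
  case (Suc n)
  have "card (steps (Suc n)) = card ({-1, 1 :: int} \<times> steps n)"
    unfolding steps_Suc by (intro card_image) (auto simp: inj_on_def)
  then show ?case using Suc by (simp add: card_cartesian_product)
qed simp

lemma sum_steps_Suc: "(\<Sum>js\<in>steps (Suc n). f js) = (\<Sum>js\<in>steps n. f ((-1) # js)) + (\<Sum>js\<in>steps n. f (1 # js))"
proof -
  have "(\<Sum>js\<in>steps (Suc n). f js) = (\<Sum>(j, js)\<in>{-1, 1} \<times> steps n. f (j # js))"
    unfolding steps_Suc by (subst sum.reindex) (auto simp: inj_on_def intro!: sum.cong)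
  also have "\<dots> = (\<Sum>j\<in>{-1, 1}. \<Sum>js\<in>steps n. f (j # js))"
    by (rule sum.cartesian_product[symmetric])
  finally show ?thesis by simp
qed

definition path_sum :: "(int \<Rightarrow> real) \<Rightarrow> int \<Rightarrow> nat \<Rightarrow> int \<Rightarrow> real \<Rightarrow> ennreal" where
  "path_sum xi z n x t = (\<Sum>js\<in>steps n. if x + sum_list js = z then path_int (map xi (x # psites x js)) t else 0)"

lemma measurable_path_sum [measurable]: "path_sum xi z n x \<in> borel_measurable borel"
  unfolding path_sum_def by measurable

lemma path_sum_Suc:
  "path_sum xi z (Suc n) x t = (\<integral>\<^sup>+h. exp_kernel (xi x) h * (path_sum xi z n (x - 1) (t - h) + path_sum xi z n (x + 1) (t - h)) \<partial>lborel)"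
proof -
  have *: "(\<integral>\<^sup>+h. exp_kernel (xi x) h * path_sum xi z n (x + j) (t - h) \<partial>lborel) =
     (\<Sum>js\<in>steps n. if x + sum_list (j # js) = z then path_int (map xi (x # psites x (j # js))) t else 0)" for j
  proof -
    have "(\<integral>\<^sup>+h. exp_kernel (xi x) h * path_sum xi z n (x + j) (t - h) \<partial>lborel) =
      (\<Sum>js\<in>steps n. \<integral>\<^sup>+h. exp_kernel (xi x) h * (if x + j + sum_list js = z then path_int (map xi ((x + j) # psites (x + j) js)) (t - h) else 0) \<partial>lborel)"
      unfolding path_sum_def sum_distrib_left by (rule nn_integral_sum) measurable
    also have "\<dots> = (\<Sum>js\<in>steps n. if x + sum_list (j # js) = z then path_int (map xi (x # psites x (j # js))) t else 0)"
      by (intro sum.cong refl) (simp add: conv_def add.assoc)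
    finally show ?thesis .
  qed
  have "path_sum xi z (Suc n) x t = (\<integral>\<^sup>+h. exp_kernel (xi x) h * path_sum xi z n (x - 1) (t - h) \<partial>lborel) + (\<integral>\<^sup>+h. exp_kernel (xi x) h * path_sum xi z n (x + 1) (t - h) \<partial>lborel)"
    using *[of "-1"] *[of 1] unfolding path_sum_def[of _ _ "Suc n"] by (simp only: sum_steps_Suc uminus_add_conv_diff diff_conv_add_uminus)
  also have "\<dots> = (\<integral>\<^sup>+h. exp_kernel (xi x) h * (path_sum xi z n (x - 1) (t - h) + path_sum xi z n (x + 1) (t - h)) \<partial>lborel)"
    by (subst nn_integral_add[symmetric]) (auto simp: distrib_left)
  finally show ?thesis .
qed

definition fk_part :: "(int \<Rightarrow> real) \<Rightarrow> int \<Rightarrow> nat \<Rightarrow> int \<Rightarrow> real \<Rightarrow> (nat \<Rightarrow> real \<times> int) \<Rightarrow> ennreal" where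
  "fk_part xi z n x t w = ennreal (fk_weight xi x t w) * indicator {w. num_jumps_at n t w \<and> x + walk_pos w t = z} w"

lemma measurable_fk_part [measurable (raw)]:
  assumes f [measurable]: "f \<in> borel_measurable N" and g [measurable]: "g \<in> measurable N walk_space"
  shows "(\<lambda>q. fk_part xi z n x (f q) (g q)) \<in> borel_measurable N"
proof -
  have [measurable]: "Measurable.pred N (\<lambda>q. x + walk_pos (g q) (f q) = z)"
    by (rule measurable_compose[OF measurable_walk_pos'[OF g f], of "\<lambda>y. x + y = z"]) simp
  have "(\<lambda>q. if num_jumps_at n (f q) (g q) \<and> x + walk_pos (g q) (f q) = z then ennreal (fk_weight xi x (f q) (g q)) else 0) \<in> borel_measurable N"
    unfolding num_jumps_at_def by measurable
  moreover have "fk_part xi z n x t w = (if num_jumps_at n t w \<and> x + walk_pos w t = z then ennreal (fk_weight xi x t w) else 0)" for t w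
    by (simp add: fk_part_def)
  ultimately show ?thesis by simp
qed

lemma AE_walk_good: "AE w in walk_measure. pos_times w \<and> w \<in> space walk_space"
proof -
  have "AE w in walk_measure. w \<in> space walk_measure" by (rule AE_space)
  moreover have "space walk_measure = space walk_space" by (intro sets_eq_imp_space_eq sets_walk_measure)
  ultimately show ?thesis using AE_pos_times by auto
qed

lemma fk_part_case_nat:
  assumes "pos_times w" "w \<in> space walk_space" "0 < h"
  shows "fk_part xi z (Suc n) x t (case_nat (h, j) w) = ennreal (exp (xi x * h)) * fk_part xi z n (x + j) (t - h) w"
proof (cases "num_jumps_at n (t - h) w")
  case True
  have "0 \<le> t - h" using num_jumps_at_nonneg[OF assms(1) True] .
  then have "walk_pos (case_nat (h, j) w) t = j + walk_pos w (t - h)"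
    using walk_pos_case_nat[OF assms(1) True] by simp
  then show ?thesis using True fk_weight_case_nat[OF assms(1) True assms(2,3), of xi x j]
    by (simp add: fk_part_def ennreal_mult' indicator_def add.assoc)
qed (simp add: fk_part_def)

lemma nn_integral_fk_part_0:
  "(\<integral>\<^sup>+w. fk_part xi z 0 x t w \<partial>walk_measure) = ennreal (exp (- 2 * t)) * path_sum xi z 0 x t"
proof (cases "0 \<le> t")
  case False
  have "(\<integral>\<^sup>+w. fk_part xi z 0 x t w \<partial>walk_measure) = (\<integral>\<^sup>+w. 0 \<partial>walk_measure)"
    using False by (intro nn_integral_cong) (simp add: fk_part_def num_jumps_at_def)
  then show ?thesis using False by (simp add: path_sum_def)
next
  case True
  let ?c = "ennreal (exp (xi x * t)) * (if x = z then 1 else 0)"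
  interpret W: prob_space walk_measure by (rule prob_space_walk)
  have [measurable]: "(\<lambda>p. indicator {t<..} (fst p) :: ennreal) \<in> borel_measurable (borel \<Otimes>\<^sub>M count_space UNIV)"
    by measurable
  have "(\<integral>\<^sup>+w. fk_part xi z 0 x t w \<partial>walk_measure) = (\<integral>\<^sup>+w. ?c * indicator {t<..} (fst (w 0)) \<partial>walk_measure)"
    using AE_pos_times
  proof (intro nn_integral_cong_AE, eventually_elim)
    case (elim w)
    have "arrival w (Suc 0) = fst (w 0)" by (simp add: arrival_def)
    then show ?case using True elim
      by (auto simp: fk_part_def num_jumps_at_def indicator_def fk_weight_const walk_pos_before)
  qed
  also have "\<dots> = (\<integral>\<^sup>+p. \<integral>\<^sup>+w. ?c * indicator {t<..} (fst p) \<partial>walk_measure \<partial>step_measure)"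
    by (subst nn_integral_walk) simp_all
  also have "\<dots> = (\<integral>\<^sup>+p. ?c * indicator {t<..} (fst p) \<partial>step_measure)"
    by (simp add: W.emeasure_space_1)
  also have "\<dots> = ?c * (\<integral>\<^sup>+p. indicator {t<..} (fst p) \<partial>step_measure)"
    by (rule nn_integral_cmult) measurable
  also have "(\<integral>\<^sup>+p. indicator {t<..} (fst p) \<partial>step_measure) = (\<integral>\<^sup>+h. exp_kernel (-2) h * (indicator {t<..} h + indicator {t<..} h) \<partial>lborel)"
    by (subst nn_integral_step) simp_all
  also have "\<dots> = (\<integral>\<^sup>+h. ennreal (2 * exp (- 2 * h)) * indicator {t..} h \<partial>lborel)"
    using AE_lborel_singleton[of t]
  proof (intro nn_integral_cong_AE, eventually_elim)
    case (elim h)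
    then show ?case using True
      by (auto simp: exp_kernel_def indicator_def ennreal_mult mult.commute)
  qed
  also have "\<dots> = ennreal (0 - (- exp (- 2 * t)))"
  proof (rule nn_integral_FTC_atLeast)
    show "((\<lambda>h. - exp (- 2 * h)) \<longlongrightarrow> (0::real)) at_top" by real_asymp
  qed (auto intro!: derivative_eq_intros)
  finally show ?thesis using True by (simp add: path_sum_def exp_kernel_def mult.commute)
qed

text \<open>Conditioning on the first jump. Every completed holding time \<open>s\<close>
  contributes \<open>exp (- 2 * s)\<close>, and so does the unfinished last one; the product is
  \<open>exp (- 2 * t)\<close> whatever the jumps are.\<close>

lemma nn_integral_fk_part:
  "(\<integral>\<^sup>+w. fk_part xi z n x t w \<partial>walk_measure) = ennreal (exp (- 2 * t)) * path_sum xi z n x t"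
proof (induction n arbitrary: x t)
  case 0
  show ?case by (rule nn_integral_fk_part_0)
next
  case (Suc n)
  let ?g = "\<lambda>p. ennreal (exp (xi x * fst p)) * (\<integral>\<^sup>+w. fk_part xi z n (x + snd p) (t - fst p) w \<partial>walk_measure)"
  have [measurable]: "?g \<in> borel_measurable (borel \<Otimes>\<^sub>M count_space UNIV)"
    unfolding Suc
    by (rule measurable_compose_countable'[where g = snd and I = UNIV, where f = "\<lambda>j p. ennreal (exp (xi x * fst p)) * (ennreal (exp (- 2 * (t - fst p))) * path_sum xi z n (x + j) (t - fst p))"]) simp_all
  have "(\<integral>\<^sup>+w. fk_part xi z (Suc n) x t w \<partial>walk_measure)
     = (\<integral>\<^sup>+p. \<integral>\<^sup>+w. fk_part xi z (Suc n) x t (case_nat p w) \<partial>walk_measure \<partial>step_measure)"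
    by (rule nn_integral_walk) measurable
  also have "\<dots> = (\<integral>\<^sup>+p. ?g p \<partial>step_measure)"
    using AE_step_pos
  proof (intro nn_integral_cong_AE, eventually_elim)
    case (elim p)
    have "(\<integral>\<^sup>+w. fk_part xi z (Suc n) x t (case_nat p w) \<partial>walk_measure) =
      (\<integral>\<^sup>+w. ennreal (exp (xi x * fst p)) * fk_part xi z n (x + snd p) (t - fst p) w \<partial>walk_measure)"
      using AE_walk_good
    proof (intro nn_integral_cong_AE, eventually_elim)
      case (elim w)
      then show ?case using fk_part_case_nat[of w "fst p" xi z n x t "snd p"] \<open>0 < fst p\<close> by simp
    qed
    also have "\<dots> = ?g p" by (rule nn_integral_cmult) measurable
    finally show ?case .
  qed
  also have "\<dots> = (\<integral>\<^sup>+h. exp_kernel (-2) h * (?g (h, -1) + ?g (h, 1)) \<partial>lborel)"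
    by (rule nn_integral_step) measurable
  also have "\<dots> = (\<integral>\<^sup>+h. ennreal (exp (- 2 * t)) * (exp_kernel (xi x) h * (path_sum xi z n (x - 1) (t - h) + path_sum xi z n (x + 1) (t - h))) \<partial>lborel)"
  proof (intro nn_integral_cong)
    fix h :: real
    have e: "exp (- 2 * h) * (exp (xi x * h) * exp (- 2 * (t - h))) = exp (- 2 * t) * exp (xi x * h)"
      by (simp add: mult_exp_exp algebra_simps)
    have "exp_kernel (-2) h * (?g (h, -1) + ?g (h, 1)) =
      (indicator {0..} h * ennreal (exp (- 2 * h) * (exp (xi x * h) * exp (- 2 * (t - h))))) * (path_sum xi z n (x - 1) (t - h) + path_sum xi z n (x + 1) (t - h))"
      unfolding Suc exp_kernel_def
      by (simp add: ennreal_mult' distrib_left mult_ac)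
    also have "\<dots> = ennreal (exp (- 2 * t)) * (exp_kernel (xi x) h * (path_sum xi z n (x - 1) (t - h) + path_sum xi z n (x + 1) (t - h)))"
      unfolding e by (simp add: exp_kernel_def ennreal_mult' mult_ac)
    finally show "exp_kernel (-2) h * (?g (h, -1) + ?g (h, 1)) = ennreal (exp (- 2 * t)) * (exp_kernel (xi x) h * (path_sum xi z n (x - 1) (t - h) + path_sum xi z n (x + 1) (t - h)))" .
  qed
  also have "\<dots> = ennreal (exp (- 2 * t)) * path_sum xi z (Suc n) x t"
    unfolding path_sum_Suc by (rule nn_integral_cmult) measurable
  finally show ?case .
qed

text \<open>The Laplace transform of an Exp(2) variable at 1 is 2/3, and the holding times are
  independent.\<close>

lemma nn_integral_exp_arrival:
  "(\<integral>\<^sup>+w. ennreal (exp (- arrival w n)) \<partial>walk_measure) = ennreal ((2 / 3) ^ n)"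
proof (induction n)
  case 0
  interpret W: prob_space walk_measure by (rule prob_space_walk)
  show ?case by (simp add: W.emeasure_space_1)
next
  case (Suc n)
  have "(\<integral>\<^sup>+w. ennreal (exp (- arrival w (Suc n))) \<partial>walk_measure)
     = (\<integral>\<^sup>+p. \<integral>\<^sup>+w. ennreal (exp (- arrival (case_nat p w) (Suc n))) \<partial>walk_measure \<partial>step_measure)"
    by (rule nn_integral_walk) measurable
  also have "\<dots> = (\<integral>\<^sup>+p. \<integral>\<^sup>+w. ennreal (exp (- fst p)) * ennreal (exp (- arrival w n)) \<partial>walk_measure \<partial>step_measure)"
    by (simp add: ennreal_mult'[symmetric] mult_exp_exp)
  also have "\<dots> = (\<integral>\<^sup>+p. ennreal (exp (- fst p)) * ennreal ((2 / 3) ^ n) \<partial>step_measure)"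
    unfolding Suc.IH[symmetric] by (intro nn_integral_cong nn_integral_cmult) measurable
  also have "\<dots> = (\<integral>\<^sup>+p. ennreal (exp (- fst p)) \<partial>step_measure) * ennreal ((2 / 3) ^ n)"
    by (rule nn_integral_multc) measurable
  also have "(\<integral>\<^sup>+p. ennreal (exp (- fst p)) \<partial>step_measure) = (\<integral>\<^sup>+h. 2 * exp_kernel (-3) h \<partial>lborel)"
  proof (subst nn_integral_step)
    show "(\<integral>\<^sup>+h. exp_kernel (-2) h * (ennreal (exp (- fst (h, -1::int))) + ennreal (exp (- fst (h, 1::int)))) \<partial>lborel) = (\<integral>\<^sup>+h. 2 * exp_kernel (-3) h \<partial>lborel)"
    proof (intro nn_integral_cong)
      fix h :: real
      have "exp (- 3 * h) = exp (- 2 * h) * exp (- h)" by (simp add: mult_exp_exp)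
      then show "exp_kernel (-2) h * (ennreal (exp (- fst (h, -1::int))) + ennreal (exp (- fst (h, 1::int)))) = 2 * exp_kernel (-3) h"
        by (simp add: exp_kernel_def ennreal_mult' mult_ac mult_2[symmetric] distrib_left)
    qed
  qed measurable
  also have "\<dots> = ennreal (2 / 3)"
    using nn_integral_exp_kernel[of 3] ennreal_mult'[of 2 "1/3"] by (subst nn_integral_cmult) auto
  finally show ?case by (simp add: ennreal_mult'[symmetric])
qed

text \<open>Absence of explosion, by Markov's inequality for \<open>exp (- arrival w n)\<close>: the
  bound tends to 0 as \<open>n\<close> grows.\<close>

lemma AE_arrival_unbounded: "AE w in walk_measure. \<exists>n. t < arrival w n"
proof -
  have [measurable]: "(\<lambda>w. arrival w n) \<in> borel_measurable walk_measure" for n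
    by measurable
  let ?B = "{w \<in> space walk_measure. \<not> (\<exists>n. t < arrival w n)}"
  have B: "?B \<in> sets walk_measure" by measurable
  have "emeasure walk_measure ?B \<le> ennreal (exp t * (2 / 3) ^ n)" for n
  proof -
    have "emeasure walk_measure ?B = (\<integral>\<^sup>+w. indicator ?B w \<partial>walk_measure)"
      using B by simp
    also have "\<dots> \<le> (\<integral>\<^sup>+w. ennreal (exp t) * ennreal (exp (- arrival w n)) \<partial>walk_measure)"
    proof (intro nn_integral_mono)
      fix w
      show "indicator ?B w \<le> ennreal (exp t) * ennreal (exp (- arrival w n))"
        by (auto simp: indicator_def ennreal_mult'[symmetric] mult_exp_exp not_less)
    qed
    also have "\<dots> = ennreal (exp t * (2 / 3) ^ n)"
      by (subst nn_integral_cmult) (auto simp: nn_integral_exp_arrival ennreal_mult')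
    finally show ?thesis .
  qed
  moreover have "(\<lambda>n. ennreal (exp t * (2 / 3) ^ n)) \<longlonglongrightarrow> ennreal 0"
    by (intro tendsto_ennrealI tendsto_mult_right_zero LIMSEQ_realpow_zero) auto
  ultimately have "emeasure walk_measure ?B \<le> ennreal 0"
    by (intro LIMSEQ_le_const) auto
  then show ?thesis
    by (intro AE_I[OF _ _ B]) auto
qed

lemma suminf_fk_part:
  assumes "pos_times w" "\<exists>n. t < arrival w n" "0 \<le> t"
  shows "(\<Sum>n. fk_part xi z n x t w) = ennreal (fk_weight xi x t w) * indicator {w. x + walk_pos w t = z} w"
proof -
  define N where "N = (LEAST n. t < arrival w n)"
  have N: "t < arrival w N" unfolding N_def using assms(2) by (rule LeastI_ex)
  have "N \<noteq> 0" using N assms(3) by (cases N) auto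
  then obtain n where n: "N = Suc n" by (cases N) auto
  have "\<not> t < arrival w n" using not_less_Least[of n "\<lambda>n. t < arrival w n"] n by (simp add: N_def)
  then have nj: "num_jumps_at n t w" using N n by (simp add: num_jumps_at_def)
  have uniq: "m = n" if "num_jumps_at m t w" for m
  proof (rule ccontr)
    assume "m \<noteq> n"
    then consider "Suc m \<le> n" | "Suc n \<le> m" by linarith
    then show False
      using arrival_mono[OF assms(1), of "Suc m" n] arrival_mono[OF assms(1), of "Suc n" m] that nj
      by cases (auto simp: num_jumps_at_def)
  qed
  have "(\<Sum>n. fk_part xi z n x t w) = (\<Sum>n\<in>{n}. fk_part xi z n x t w)"
    by (rule suminf_finite) (use uniq in \<open>auto simp: fk_part_def indicator_def\<close>)
  then show ?thesis using nj by (simp add: fk_part_def indicator_def)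
qed

definition path_weight :: "(int \<Rightarrow> real) \<Rightarrow> real \<Rightarrow> int list \<Rightarrow> ennreal" where
  "path_weight xi t js = path_int (map xi (0 # psites 0 js)) t"

definition paths_to :: "int \<Rightarrow> int list set" where
  "paths_to z = {js. set js \<subseteq> {-1, 1} \<and> sum_list js = z}"

text \<open>An integral against counting measure with values in \<open>ennreal\<close>: infinite
  families of paths are summed without convergence conditions.\<close>

definition weight_sum :: "(int \<Rightarrow> real) \<Rightarrow> real \<Rightarrow> int list set \<Rightarrow> ennreal" where
  "weight_sum xi t P = (\<integral>\<^sup>+js\<in>P. path_weight xi t js \<partial>count_space UNIV)"

lemma nn_integral_steps:
  assumes "P \<subseteq> {js. set js \<subseteq> {-1, 1}}"
  shows "(\<integral>\<^sup>+js\<in>P. f js \<partial>count_space UNIV) = (\<Sum>n. \<Sum>js\<in>steps n. f js * indicator P js)"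
proof -
  have "(\<integral>\<^sup>+js\<in>P. f js \<partial>count_space UNIV) = (\<integral>\<^sup>+js. (\<Sum>n. f js * indicator P js * indicator (steps n) js) \<partial>count_space UNIV)"
  proof (intro nn_integral_cong)
    fix js
    have "(\<Sum>n. f js * indicator P js * indicator (steps n) js) = (\<Sum>n\<in>{length js}. f js * indicator P js * indicator (steps n) js)"
      by (rule suminf_finite) (auto simp: steps_def)
    then show "f js * indicator P js = (\<Sum>n. f js * indicator P js * indicator (steps n) js)"
      using assms by (auto simp: steps_def indicator_def)
  qed
  also have "\<dots> = (\<Sum>n. \<integral>\<^sup>+js. f js * indicator P js * indicator (steps n) js \<partial>count_space UNIV)"
    by (rule nn_integral_suminf) simp
  also have "\<dots> = (\<Sum>n. \<Sum>js\<in>steps n. f js * indicator P js)"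
  proof (intro suminf_cong)
    fix n
    show "(\<integral>\<^sup>+js. f js * indicator P js * indicator (steps n) js \<partial>count_space UNIV) = (\<Sum>js\<in>steps n. f js * indicator P js)"
      by (subst nn_integral_count_space'[of "steps n"]) (auto simp: indicator_def)
  qed
  finally show ?thesis .
qed

lemma weight_sum_paths_to: "weight_sum xi t (paths_to z) = (\<Sum>n. path_sum xi z n 0 t)"
  unfolding weight_sum_def
  by (subst nn_integral_steps)
     (auto simp: paths_to_def path_sum_def path_weight_def steps_def indicator_def intro!: suminf_cong sum.cong)

text \<open>The identity holds for every potential: if the path sum diverges, both sides are 0 by
  the conventions for the Bochner integral and for \<open>enn2real\<close>.\<close>

theorem pam_u_eq_weight_sum:
  assumes "0 \<le> t"
  shows "pam_u xi t z = exp (- 2 * t) * enn2real (weight_sum xi t (paths_to z))"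
proof -
  have w: "walk_pos w t = z \<longleftrightarrow> w \<in> {w. 0 + walk_pos w t = z}" for w by simp
  have "pam_u xi t z = (\<integral>w. fk_weight xi 0 t w * indicator {w. 0 + walk_pos w t = z} w \<partial>walk_measure)"
    by (simp add: pam_u_def fk_weight_def)
  also have "\<dots> = enn2real (\<integral>\<^sup>+w. ennreal (fk_weight xi 0 t w * indicator {w. 0 + walk_pos w t = z} w) \<partial>walk_measure)"
  proof (rule integral_eq_nn_integral)
    have [measurable]: "Measurable.pred walk_space (\<lambda>w. walk_pos w t = z)"
      by (rule measurable_compose[OF measurable_walk_pos'[of "\<lambda>w. w" walk_space "\<lambda>w. t"], of "\<lambda>y. y = z" "count_space UNIV"]) simp_all
    have "(\<lambda>w. if walk_pos w t = z then fk_weight xi 0 t w else 0) \<in> borel_measurable walk_measure"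
      by measurable
    then show "(\<lambda>w. fk_weight xi 0 t w * indicator {w. 0 + walk_pos w t = z} w) \<in> borel_measurable walk_measure"
      by (rule measurable_cong[THEN iffD1, rotated]) (simp add: indicator_def)
    show "AE w in walk_measure. 0 \<le> fk_weight xi 0 t w * indicator {w. 0 + walk_pos w t = z} w"
      by (simp add: fk_weight_def)
  qed
  also have "(\<integral>\<^sup>+w. ennreal (fk_weight xi 0 t w * indicator {w. 0 + walk_pos w t = z} w) \<partial>walk_measure) = (\<integral>\<^sup>+w. (\<Sum>n. fk_part xi z n 0 t w) \<partial>walk_measure)"
    using AE_pos_times AE_arrival_unbounded[of t]
  proof (intro nn_integral_cong_AE, eventually_elim)
    case (elim w)
    then show ?case using assms by (simp add: suminf_fk_part indicator_def)
  qed
  also have "\<dots> = (\<Sum>n. \<integral>\<^sup>+w. fk_part xi z n 0 t w \<partial>walk_measure)"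
    by (rule nn_integral_suminf) measurable
  also have "\<dots> = (\<Sum>n. ennreal (exp (- 2 * t)) * path_sum xi z n 0 t)"
    by (simp add: nn_integral_fk_part)
  also have "\<dots> = ennreal (exp (- 2 * t)) * weight_sum xi t (paths_to z)"
    unfolding weight_sum_paths_to by (rule ennreal_suminf_cmult)
  finally show ?thesis by (simp add: enn2real_mult)
qed

section \<open>Path sums under an exchange of two values\<close>

text \<open>Past the end of the list the position stays at the end point, so increments are bounded
  by 1 for all \<open>k\<close>.\<close>

definition pos :: "int list \<Rightarrow> nat \<Rightarrow> int" where
  "pos js k = sum_list (take k js)"

lemma pos_0 [simp]: "pos js 0 = 0" by (simp add: pos_def)

lemma pos_length [simp]: "pos js (length js) = sum_list js" by (simp add: pos_def)

lemma pos_Cons_Suc [simp]: "pos (j # js) (Suc k) = j + pos js k" by (simp add: pos_def)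

lemma set_sites: "set (x # psites x js) = (\<lambda>k. x + pos js k) ` {..length js}"
proof (induction js arbitrary: x)
  case (Cons j js)
  have "set (x # psites x (j # js)) = insert x ((\<lambda>k. x + j + pos js k) ` {..length js})"
    using Cons.IH[of "x + j"] by simp
  also have "\<dots> = (\<lambda>k. x + pos (j # js) k) ` insert 0 (Suc ` {..length js})"
    by (simp add: image_image add.assoc)
  finally show ?case by (simp add: atMost_Suc_eq_insert_0)
qed simp

lemma set_psites: "set (psites x js) = (\<lambda>k. x + pos js k) ` {1..length js}"
proof (cases js)
  case (Cons j js')
  have "{1..length js} = Suc ` {..length js'}"
    by (simp add: Cons image_Suc_atMost)
  then show ?thesis using set_sites[of "x + j" js'] by (simp add: Cons image_image add.assoc)
qed simp

lemma length_psites [simp]: "length (psites x js) = length js"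
  by (induction js arbitrary: x) auto

lemma psites_append: "psites x (as @ bs) = psites x as @ psites (x + sum_list as) bs"
  by (induction as arbitrary: x) (auto simp: add.assoc)

lemma pos_step:
  assumes "set js \<subseteq> {-1, 1}"
  shows "\<bar>pos js (Suc k) - pos js k\<bar> \<le> 1"
proof (cases "k < length js")
  case True
  then have "js ! k \<in> {-1, 1}" using assms nth_mem by blast
  then show ?thesis using True by (auto simp: pos_def take_Suc_conv_app_nth)
qed (simp add: pos_def)

lemma pos_dist:
  assumes "set js \<subseteq> {-1, 1}"
  shows "\<bar>pos js (i + k) - pos js i\<bar> \<le> int k"
proof (induction k)
  case (Suc k)
  then show ?case using pos_step[OF assms, of "i + k"] by simp
qed simp

lemma pos_dist':
  assumes "set js \<subseteq> {-1, 1}"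
  shows "\<bar>pos js i - pos js k\<bar> \<le> \<bar>int i - int k\<bar>"
proof (cases "i \<le> k")
  case True
  then show ?thesis using pos_dist[OF assms, of i "k - i"] by simp
next
  case False
  then show ?thesis using pos_dist[OF assms, of k "i - k"] by simp
qed

lemma pos_abs_le:
  assumes "set js \<subseteq> {-1, 1}"
  shows "\<bar>pos js k\<bar> \<le> int k"
  using pos_dist[OF assms, of 0 k] by simp

lemma pos_ivt:
  assumes "set js \<subseteq> {-1, 1}" "i \<le> k" "pos js i \<le> y" "y \<le> pos js k"
  shows "\<exists>l. i \<le> l \<and> l \<le> k \<and> pos js l = y"
proof -
  have "\<exists>l\<le>k - i. pos js (i + l) = y"
    using pos_step[OF assms(1)] assms(2-) nat0_intermed_int_val[of "k - i" "\<lambda>l. pos js (i + l)" y] by simp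
  then obtain l where "l \<le> k - i" "pos js (i + l) = y" by blast
  then show ?thesis using assms(2) by (intro exI[of _ "i + l"]) auto
qed

lemma pos_uminus: "pos (map uminus js) k = - pos js k"
proof (induction js arbitrary: k)
  case (Cons j js)
  then show ?case by (cases k) auto
qed (simp add: pos_def)

lemma pos_ivt_down:
  assumes "set js \<subseteq> {-1, 1}" "i \<le> k" "y \<le> pos js i" "pos js k \<le> y"
  shows "\<exists>l. i \<le> l \<and> l \<le> k \<and> pos js l = y"
proof -
  have "set (map uminus js) \<subseteq> {-1, 1}" using assms(1) by auto
  from pos_ivt[OF this assms(2), of "- y"] assms show ?thesis by (simp add: pos_uminus)
qed

section \<open>Bounds for sums over families of jump sequences\<close>

lemma weight_sum_mono: "P \<subseteq> Q \<Longrightarrow> weight_sum xi t P \<le> weight_sum xi t Q"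
  unfolding weight_sum_def by (intro nn_integral_mono mult_left_mono) (auto simp: indicator_def)

lemma weight_sum_UN:
  assumes "finite I" "P \<subseteq> (\<Union>i\<in>I. Q i)"
  shows "weight_sum xi t P \<le> (\<Sum>i\<in>I. weight_sum xi t (Q i))"
proof -
  have "weight_sum xi t P \<le> (\<integral>\<^sup>+js. (\<Sum>i\<in>I. path_weight xi t js * indicator (Q i) js) \<partial>count_space UNIV)"
    unfolding weight_sum_def
  proof (intro nn_integral_mono)
    fix js
    show "path_weight xi t js * indicator P js \<le> (\<Sum>i\<in>I. path_weight xi t js * indicator (Q i) js)"
    proof (cases "js \<in> P")
      case True
      then obtain i where "i \<in> I" "js \<in> Q i" using assms by auto
      then have "path_weight xi t js * indicator P js \<le> path_weight xi t js * indicator (Q i) js" using True by simp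
      also have "\<dots> \<le> (\<Sum>i\<in>I. path_weight xi t js * indicator (Q i) js)"
        using assms \<open>i \<in> I\<close> by (intro member_le_sum) auto
      finally show ?thesis .
    qed auto
  qed
  also have "\<dots> = (\<Sum>i\<in>I. weight_sum xi t (Q i))"
    unfolding weight_sum_def by (rule nn_integral_sum) simp
  finally show ?thesis .
qed

lemma weight_sum_Un: "weight_sum xi t (P \<union> Q) \<le> weight_sum xi t P + weight_sum xi t Q"
proof -
  have "weight_sum xi t (P \<union> Q) \<le> (\<integral>\<^sup>+js. path_weight xi t js * indicator P js + path_weight xi t js * indicator Q js \<partial>count_space UNIV)"
    unfolding weight_sum_def by (intro nn_integral_mono) (auto simp: indicator_def)
  also have "\<dots> = weight_sum xi t P + weight_sum xi t Q"
    unfolding weight_sum_def by (rule nn_integral_add) auto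
  finally show ?thesis .
qed

lemma path_weight_upper:
  assumes "js \<in> steps n" "\<And>k. k \<le> n \<Longrightarrow> xi (pos js k) \<le> L" "0 \<le> t"
  shows "path_weight xi t js \<le> ennreal (exp (L * t) * (t ^ n / fact n))"
proof -
  have n: "length js = n" using assms by (simp add: steps_def)
  have "path_weight xi t js \<le> ennreal (exp (L * t) * (t ^ (length (map xi (0 # psites 0 js)) - 1) / fact (length (map xi (0 # psites 0 js)) - 1)))"
    unfolding path_weight_def
  proof (rule path_int_upper)
    fix a assume "a \<in> set (map xi (0 # psites 0 js))"
    then have "a \<in> xi ` (\<lambda>k. 0 + pos js k) ` {..length js}"
      unfolding set_sites[symmetric] by simp
    then show "a \<le> L" using assms n by auto
  qed (use assms in auto)
  then show ?thesis using n by simp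
qed

lemma weight_sum_le_suminf:
  assumes "P \<subseteq> {js. set js \<subseteq> {-1, 1}}"
    and "\<And>n js. js \<in> steps n \<Longrightarrow> js \<in> P \<Longrightarrow> path_weight xi t js \<le> ennreal (c n)"
    and "\<And>n. 0 \<le> c n"
    and "\<And>n. n \<notin> I \<Longrightarrow> steps n \<inter> P = {}"
  shows "weight_sum xi t P \<le> (\<Sum>n. ennreal (2 ^ n * c n) * indicator I n)"
  unfolding weight_sum_def nn_integral_steps[OF assms(1)]
proof (intro suminf_le summableI)
  fix n
  show "(\<Sum>js\<in>steps n. path_weight xi t js * indicator P js) \<le> ennreal (2 ^ n * c n) * indicator I n"
  proof (cases "n \<in> I")
    case True
    have "(\<Sum>js\<in>steps n. path_weight xi t js * indicator P js) \<le> (\<Sum>js\<in>steps n. ennreal (c n))"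
      using assms(2) by (intro sum_mono) (auto simp: indicator_def)
    also have "\<dots> = ennreal (2 ^ n * c n)"
      using assms(3) by (simp add: card_steps ennreal_mult ennreal_power[symmetric])
    finally show ?thesis using True by simp
  next
    case False
    then have "path_weight xi t js * indicator P js = 0" if "js \<in> steps n" for js
      using assms(4)[of n] that by (auto simp: indicator_def)
    then have "(\<Sum>js\<in>steps n. path_weight xi t js * indicator P js) = 0"
      by (intro sum.neutral) blast
    then show ?thesis by simp
  qed
qed

text \<open>One straight path suffices: time \<open>z / m\<close> is spent on the way and the rest
  at \<open>z\<close>. The volume of the simplex is estimated through
  \<open>fact z \<le> z ^ z\<close>.\<close>

lemma weight_sum_lower:
  assumes "\<And>w. 0 \<le> xi w" "xi (int z) = m" "0 < m" "0 < z" "real z \<le> m * t"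
  shows "ennreal (exp (m * t - z - z * ln m)) \<le> weight_sum xi t (paths_to z)"
proof -
  let ?js = "replicate z 1 :: int list"
  have js: "?js \<in> paths_to z" by (auto simp: paths_to_def sum_list_replicate)
  have ps: "psites x (replicate n 1) = map (\<lambda>k. x + 1 + int k) [0..<n]" for x n
  proof (induction n arbitrary: x)
    case (Suc n)
    show ?case
      unfolding replicate_Suc psites.simps Suc upt_conv_Cons[OF zero_less_Suc] map_Suc_upt[symmetric] list.map
      by (simp add: o_def algebra_simps)
  qed simp
  obtain k where k: "z = Suc k" using assms by (cases z) auto
  define A where "A = map xi (0 # map (\<lambda>k. 0 + 1 + int k) [0..<k])"
  have eq: "map xi (0 # psites 0 ?js) = A @ [m]"
    using assms(2) unfolding ps A_def k by (simp add: algebra_simps)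
  have lA: "length A = z" by (simp add: A_def k)
  have t1: "real z / m \<le> t" using assms by (simp add: field_simps)
  have "exp (m * t - z - z * ln m) = exp (m * (t - z / m)) * exp (- real z * ln m)"
    using assms by (simp add: mult_exp_exp right_diff_distrib)
  also have "exp (- real z * ln m) = (1 / m) ^ z"
    using assms by (simp add: exp_minus exp_of_nat_mult power_one_over field_simps)
  also have "(1 / m) ^ z \<le> (z / m) ^ z / fact z"
  proof -
    have "fact z \<le> real z ^ z" using fact_le_power[of z, where ?'a = real] by simp
    then have "1 \<le> real z ^ z / fact z" by simp
    then have "(1 / m) ^ z * 1 \<le> (1 / m) ^ z * (real z ^ z / fact z)"
      using assms by (intro mult_left_mono) auto
    then show ?thesis by (simp add: power_divide)
  qed
  finally have "exp (m * t - z - z * ln m) \<le> exp (m * (t - z / m)) * ((z / m) ^ z / fact z)"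
    by simp
  then have "ennreal (exp (m * t - z - z * ln m)) \<le> ennreal (exp (m * (t - z / m)) * ((z / m) ^ length A / fact (length A)))"
    by (intro ennreal_leI) (simp add: lA)
  also have "\<dots> \<le> path_int (A @ [m]) t"
    using assms t1 by (intro path_int_lower) (auto simp: A_def)
  also have "\<dots> = path_weight xi t ?js" by (simp only: path_weight_def eq)
  also have "\<dots> = weight_sum xi t {?js}"
    unfolding weight_sum_def by simp
  also have "\<dots> \<le> weight_sum xi t (paths_to z)"
    using js by (intro weight_sum_mono) auto
  finally show ?thesis .
qed

text \<open>For \<open>n < N\<close> insert the factor \<open>L ^ (N - n) \<ge> 1\<close>. In the
  application \<open>x\<close> is of order \<open>r * ln t\<close>, \<open>N\<close> of order
  \<open>r\<close> and \<open>L = ln t\<close>, so the exponent becomes of order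
  \<open>r * ln (ln t)\<close> instead of \<open>r * ln t\<close>.\<close>

lemma sum_power_fact_le:
  assumes "0 \<le> x" "1 \<le> (L::real)"
  shows "(\<Sum>n<N. x ^ n / fact n) \<le> L ^ N * exp (x / L)"
proof -
  have "(\<Sum>n<N. x ^ n / fact n) \<le> (\<Sum>n<N. L ^ N * ((x / L) ^ n / fact n))"
  proof (intro sum_mono)
    fix n assume "n \<in> {..<N}"
    then have "L ^ n \<le> L ^ N" using assms by (intro power_increasing) auto
    then have "x ^ n / fact n * (L ^ n / L ^ n) \<le> x ^ n / fact n * (L ^ N / L ^ n)"
      using assms by (intro mult_left_mono divide_right_mono) auto
    then show "x ^ n / fact n \<le> L ^ N * ((x / L) ^ n / fact n)"
      using assms by (simp add: power_divide mult.commute)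
  qed
  also have "\<dots> = L ^ N * (\<Sum>n<N. (x / L) ^ n / fact n)" by (simp add: sum_distrib_left)
  also have "\<dots> \<le> L ^ N * exp (x / L)"
  proof (intro mult_left_mono)
    show "(\<Sum>n<N. (x / L) ^ n / fact n) \<le> exp (x / L)"
      using sum_le_suminf[OF summable_exp[of "x / L"], of "{..<N}"] assms
      by (simp add: exp_def divide_inverse mult.commute)
  qed (use assms in auto)
  finally show ?thesis .
qed

lemma weight_sum_long:
  assumes "0 \<le> t" "0 \<le> \<beta>"
    and "\<And>n w. N \<le> n \<Longrightarrow> \<bar>w\<bar> \<le> int n \<Longrightarrow> xi w \<le> L n"
    and "\<And>n. N \<le> n \<Longrightarrow> 2 ^ n * (exp (L n * t) * (t ^ n / fact n)) \<le> \<beta> * (1 / 2) ^ n"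
  shows "weight_sum xi t {js \<in> paths_to z. N \<le> length js} \<le> ennreal (2 * \<beta>)"
proof -
  have "weight_sum xi t {js \<in> paths_to z. N \<le> length js} \<le> (\<Sum>n. ennreal (2 ^ n * (exp (L n * t) * (t ^ n / fact n))) * indicator {N..} n)"
  proof (rule weight_sum_le_suminf)
    fix n js assume js: "js \<in> steps n" "js \<in> {js \<in> paths_to z. N \<le> length js}"
    then have pm: "set js \<subseteq> {-1, 1}" and n: "N \<le> n" by (auto simp: steps_def)
    show "path_weight xi t js \<le> ennreal (exp (L n * t) * (t ^ n / fact n))"
    proof (rule path_weight_upper[OF js(1) _ assms(1)])
      fix k assume "k \<le> n"
      then have "\<bar>pos js k\<bar> \<le> int n" using pos_abs_le[OF pm, of k] by simp
      then show "xi (pos js k) \<le> L n" by (rule assms(3)[OF n])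
    qed
  qed (use assms in \<open>auto simp: paths_to_def steps_def\<close>)
  also have "\<dots> \<le> (\<Sum>n. ennreal (\<beta> * (1 / 2) ^ n))"
    using assms(4) by (intro suminf_le summableI) (auto simp: indicator_def intro!: ennreal_leI)
  also have "\<dots> = ennreal (\<Sum>n. \<beta> * (1 / 2) ^ n)"
    using assms(2) by (intro suminf_ennreal2) (auto intro!: summable_mult summable_geometric)
  also have "(\<Sum>n. \<beta> * (1 / 2) ^ n) = \<beta> * 2"
    by (subst suminf_mult) (auto simp: suminf_geometric intro!: summable_geometric)
  finally show ?thesis by (simp add: mult.commute)
qed

text \<open>A path that passes \<open>-d\<close>, visits \<open>w\<close> and ends at
  \<open>z\<close> has at least \<open>\<bar>w\<bar> + d\<close> jumps. By the last hypothesis a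
  value above \<open>m\<close> at \<open>w\<close> exceeds the target exponent
  \<open>t * m - z * ln m\<close> by at most \<open>\<bar>w\<bar> * ln M\<close>. A factor
  \<open>M\<close> per jump absorbs this, and the remaining \<open>d * ln M\<close> is the
  saving.\<close>

lemma weight_sum_far:
  assumes t: "0 < t" and m: "1 \<le> m" "m \<le> M" and d: "d \<le> z" and L: "1 \<le> L"
    and w: "\<And>w. \<bar>w\<bar> \<le> int N \<Longrightarrow> m < xi w \<Longrightarrow> t * xi w \<le> t * m - z * ln m + real_of_int \<bar>w\<bar> * ln M"
  shows "weight_sum xi t {js \<in> paths_to (int z). length js < N \<and> (\<exists>k\<le>length js. pos js k = - int d)}
     \<le> ennreal (exp (t * m - z * ln m - d * ln M) * (L ^ N * exp (2 * t * M / L)))"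
    (is "weight_sum xi t ?P \<le> _")
proof -
  define C where "C = exp (t * m - z * ln m - d * ln M)"
  have "weight_sum xi t ?P \<le> (\<Sum>n. ennreal (2 ^ n * (C * ((t * M) ^ n / fact n))) * indicator {..<N} n)"
  proof (rule weight_sum_le_suminf)
    fix n js assume js: "js \<in> steps n" "js \<in> ?P"
    then obtain j where j: "j \<le> n" "pos js j = - int d" and n: "length js = n" "n < N"
      and pm: "set js \<subseteq> {-1, 1}" and z: "pos js n = int z"
      by (auto simp: steps_def paths_to_def)
    have zn: "z + d \<le> n"
      using pos_dist'[OF pm, of n j] j z by simp
    have wn: "\<bar>pos js k\<bar> + int d \<le> int n" if "k \<le> n" for k
      using pos_dist'[OF pm, of k j] pos_dist'[OF pm, of n k] j z that d by linarith
    \<comment> \<open>A common bound for the potential along all such paths of length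
      \<open>n\<close>, chosen so that \<open>exp (Ln * t)\<close> is a constant times
      \<open>M ^ n\<close>.\<close>
    define Ln where "Ln = (t * m - z * ln m + (real n - real d) * ln M) / t"
    have lnM: "0 \<le> ln M" "ln m \<le> ln M" using m by auto
    have "path_weight xi t js \<le> ennreal (exp (Ln * t) * (t ^ n / fact n))"
    proof (rule path_weight_upper[OF js(1)])
      fix k assume k: "k \<le> n"
      have "t * xi (pos js k) \<le> t * m - z * ln m + (real n - real d) * ln M"
      proof (cases "m < xi (pos js k)")
        case True
        have le: "\<bar>pos js k\<bar> \<le> int N" using wn[OF k] n by linarith
        have "real_of_int \<bar>pos js k\<bar> \<le> real n - real d" using wn[OF k] by linarith
        then have "real_of_int \<bar>pos js k\<bar> * ln M \<le> (real n - real d) * ln M"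
          using lnM by (intro mult_right_mono) auto
        then show ?thesis using w[OF le True] by linarith
      next
        case False
        then have "t * xi (pos js k) \<le> t * m" using t by simp
        moreover have "z * ln m \<le> (real n - real d) * ln M"
          using lnM zn m by (intro mult_mono) auto
        ultimately show ?thesis by linarith
      qed
      then show "xi (pos js k) \<le> Ln" using t by (simp add: Ln_def field_simps)
    qed (use t in simp)
    also have "exp (Ln * t) = C * M ^ n"
    proof -
      have "M ^ n = exp (n * ln M)" using m by (simp add: exp_of_nat_mult)
      moreover have "Ln * t = (t * m - z * ln m - d * ln M) + n * ln M"
        using t by (simp add: Ln_def left_diff_distrib)
      ultimately show ?thesis by (simp add: C_def exp_add)
    qed
    finally show "path_weight xi t js \<le> ennreal (C * ((t * M) ^ n / fact n))"
      by (simp add: power_mult_distrib mult_ac)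
  next
    fix n show "0 \<le> C * ((t * M) ^ n / fact n)" using t m by (simp add: C_def)
  qed (auto simp: paths_to_def steps_def)
  also have "\<dots> = (\<Sum>n\<in>{..<N}. ennreal (2 ^ n * (C * ((t * M) ^ n / fact n))) * indicator {..<N} n)"
    by (rule suminf_finite) auto
  also have "\<dots> = (\<Sum>n<N. ennreal (C * ((2 * t * M) ^ n / fact n)))"
    by (intro sum.cong refl) (simp add: power_mult_distrib mult_ac)
  also have "\<dots> = ennreal (C * (\<Sum>n<N. (2 * t * M) ^ n / fact n))"
    using t m by (simp add: sum_distrib_left C_def)
  also have "\<dots> \<le> ennreal (C * (L ^ N * exp (2 * t * M / L)))"
    using sum_power_fact_le[of "2 * t * M" L N] t m L by (intro ennreal_leI mult_left_mono) (auto simp: C_def)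
  finally show ?thesis by (simp add: C_def)
qed

text \<open>A jump sequence that visits \<open>-y\<close> contains an excursion \<open>e\<close> of \<open>l\<close> jumps from 0 to 0 through
  \<open>-y\<close>; deleting it costs a factor \<open>(2 / m) ^ l\<close>.\<close>

lemma excursion_decomposition:
  assumes js: "js \<in> paths_to (int z)" and z: "0 < z" and y: "0 < y"
    and visit: "k \<le> length js" "pos js k = - int y"
    and nd: "\<And>k. k \<le> length js \<Longrightarrow> pos js k \<noteq> - int d" and d: "0 < d"
    and m: "0 < m" "xi (int z) = m" "\<And>w. \<bar>w\<bar> \<le> int d \<Longrightarrow> xi w \<le> m / 2"
  obtains i e js' where "i \<le> length js'" "js = take i js' @ e @ drop i js'" "js' \<in> paths_to (int z)"
    "2 * y \<le> length e" "set e \<subseteq> {-1, 1}"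
    "path_weight xi t js \<le> ennreal ((2 / m) ^ length e) * path_weight xi t js'"
proof -
  let ?n = "length js"
  have pm: "set js \<subseteq> {-1, 1}" and pn: "pos js ?n = int z" using js by (auto simp: paths_to_def)
  \<comment> \<open>\<open>i\<close> is the last visit to 0 not later than \<open>k\<close>, and
    \<open>i1\<close> the first one from \<open>k\<close> on. In between the path stays in
    \<open>[-d, 0]\<close>, where the potential is at most \<open>m / 2\<close>, and it travels at
    least \<open>2 * y\<close>.\<close>
  define i where "i = Max {i. i \<le> k \<and> pos js i = 0}"
  have "i \<in> {i. i \<le> k \<and> pos js i = 0}" unfolding i_def by (rule Max_in) (auto intro: exI[of _ 0])
  then have i: "i \<le> k" "pos js i = 0" by auto
  have i_max: "pos js l \<noteq> 0" if "i < l" "l \<le> k" for l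
    using Max_ge[of "{i. i \<le> k \<and> pos js i = 0}" l] that unfolding i_def[symmetric] by auto
  have ex: "\<exists>l. k \<le> l \<and> l \<le> ?n \<and> pos js l = 0"
    using visit pn by (intro pos_ivt pm) auto
  define i1 where "i1 = (LEAST l. k \<le> l \<and> l \<le> ?n \<and> pos js l = 0)"
  have i1: "k \<le> i1" "i1 \<le> ?n" "pos js i1 = 0" using LeastI_ex[OF ex] by (auto simp: i1_def)
  have i1_min: "pos js l \<noteq> 0" if "k \<le> l" "l < i1" for l
    using not_less_Least[of l "\<lambda>l. k \<le> l \<and> l \<le> ?n \<and> pos js l = 0"] that i1(2) unfolding i1_def[symmetric] by auto
  have neg: "pos js l \<le> 0" if "i < l" "l \<le> i1" for l
  proof (rule ccontr)
    assume "\<not> pos js l \<le> 0"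
    then have pl: "0 \<le> pos js l" "pos js l \<noteq> 0" by auto
    show False
    proof (cases "l \<le> k")
      case True
      then obtain l' where "l \<le> l'" "l' \<le> k" "pos js l' = 0"
        using pos_ivt_down[OF pm True, of 0] pl visit by auto
      then show False using i_max[of l'] that by auto
    next
      case False
      then obtain l' where l': "k \<le> l'" "l' \<le> l" "pos js l' = 0"
        using pos_ivt[OF pm, of k l 0] pl visit by auto
      then have "l' \<noteq> l" using pl by auto
      then show False using i1_min[of l'] l' that by auto
    qed
  qed
  have low: "xi (pos js l) \<le> m / 2" if l: "i < l" "l \<le> i1" for l
  proof (rule m(3))
    have "- int d \<le> pos js l"
    proof (rule ccontr)
      assume "\<not> - int d \<le> pos js l"
      then obtain l' where "l' \<le> l" "pos js l' = - int d"
        using pos_ivt_down[OF pm, of 0 l "- int d"] d by auto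
      then show False using nd[of l'] l i1 by auto
    qed
    then show "\<bar>pos js l\<bar> \<le> int d" using neg[OF l] by simp
  qed
  define A where "A = take i js"
  define e where "e = take (i1 - i) (drop i js)"
  define B where "B = drop i1 js"
  have ii1: "i \<le> i1" using i i1 by simp
  have js_eq: "js = A @ e @ B"
  proof -
    have "drop i js = e @ B" unfolding e_def B_def using ii1
      by (metis append_take_drop_id drop_drop le_add_diff_inverse2)
    then show ?thesis unfolding A_def by (metis append_take_drop_id)
  qed
  have lA: "length A = i" and le: "length e = i1 - i" using i1 ii1 by (auto simp: A_def e_def)
  have sA: "sum_list A = 0" using i by (simp add: A_def pos_def)
  have "pos js i1 = sum_list A + sum_list e"
  proof -
    have "take i1 js = A @ e" unfolding js_eq using lA le ii1 by simp
    then show ?thesis by (simp add: pos_def)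
  qed
  then have se: "sum_list e = 0" using i1 sA by simp
  have i1k: "int y \<le> int i1 - int k" and ki: "int y \<le> int k - int i"
    using pos_dist'[OF pm, of k i1] pos_dist'[OF pm, of k i] i i1 visit by auto
  define js' where "js' = A @ B"
  have js': "js' \<in> paths_to (int z)"
    using js se unfolding js_eq js'_def paths_to_def by auto
  have sites: "0 # psites 0 js = (0 # psites 0 A) @ psites 0 e @ psites 0 B"
    unfolding js_eq by (simp add: psites_append sA se)
  have sites': "0 # psites 0 js' = (0 # psites 0 A) @ psites 0 B"
    unfolding js'_def by (simp add: psites_append sA)
  have "path_weight xi t js \<le> ennreal ((2 / m) ^ length (map xi (psites 0 e))) * path_weight xi t js'"
    unfolding path_weight_def sites sites' map_append
  proof (rule path_int_remove)
    have "pos js' (length js') = int z" using js' by (simp add: paths_to_def)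
    then have "int z \<in> set (0 # psites 0 js')"
      unfolding set_sites by force
    then have "int z \<in> set ((0 # psites 0 A) @ psites 0 B)" by (simp only: sites')
    then have "xi (int z) \<in> set (map xi ((0 # psites 0 A) @ psites 0 B))" by (metis image_eqI list.set_map)
    then show "m \<in> set (map xi (0 # psites 0 A) @ map xi (psites 0 B))" using m by simp
  next
    fix b assume "b \<in> set (map xi (psites 0 e))"
    then obtain l where l: "1 \<le> l" "l \<le> length e" "b = xi (pos e l)"
      by (auto simp: set_psites)
    have "pos js (i + l) = pos e l"
      unfolding pos_def js_eq using l lA sA by simp
    then show "b \<le> m / 2" using low[of "i + l"] l le by auto
  qed (use m in auto)
  then have "path_weight xi t js \<le> ennreal ((2 / m) ^ length e) * path_weight xi t js'" by simp
  moreover have "js = take i js' @ e @ drop i js'" "i \<le> length js'"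
    unfolding js'_def using js_eq lA by auto
  moreover have "2 * y \<le> length e" using i1k ki le by linarith
  moreover have "set e \<subseteq> {-1, 1}" using pm js_eq by auto
  ultimately show ?thesis using js' that by blast
qed

text \<open>For a fixed position and a fixed excursion, insertion is injective, so the bounds for
  single paths add up to at most \<open>c\<close> times the whole sum.\<close>

lemma weight_sum_insert_excursion:
  fixes e :: "int list" and z :: int
  defines "g \<equiv> \<lambda>i js'. take i js' @ e @ drop i js'"
  shows "weight_sum xi t (g i ` {js' \<in> paths_to z. i \<le> length js' \<and> path_weight xi t (g i js') \<le> c * path_weight xi t js'})
     \<le> c * weight_sum xi t (paths_to z)" (is "weight_sum xi t (g i ` ?S) \<le> _")
proof -
  have inj: "inj_on (g i) ?S"
  proof (rule inj_onI)
    fix u v assume uv: "u \<in> ?S" "v \<in> ?S" "g i u = g i v"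
    have "take i u = take i v" "e @ drop i u = e @ drop i v"
      using uv by (auto simp: g_def append_eq_append_conv)
    then show "u = v" by (metis append_take_drop_id same_append_eq)
  qed
  have "weight_sum xi t (g i ` ?S) = (\<integral>\<^sup>+js. path_weight xi t js \<partial>count_space (g i ` ?S))"
    unfolding weight_sum_def by (simp add: nn_integral_count_space_indicator)
  also have "\<dots> = (\<integral>\<^sup>+js. path_weight xi t (g i js) \<partial>count_space ?S)"
    by (rule nn_integral_bij_count_space[symmetric]) (use inj in \<open>simp add: bij_betw_def\<close>)
  also have "\<dots> \<le> (\<integral>\<^sup>+js. c * path_weight xi t js \<partial>count_space ?S)"
    by (intro nn_integral_mono) auto
  also have "\<dots> = c * weight_sum xi t ?S"
    by (simp add: nn_integral_cmult weight_sum_def nn_integral_count_space_indicator)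
  also have "\<dots> \<le> c * weight_sum xi t (paths_to z)"
    by (intro mult_left_mono weight_sum_mono) auto
  finally show ?thesis .
qed

lemma sum_geometric_tail_le:
  assumes "0 \<le> x" "x \<le> 1 / (2::real)"
  shows "(\<Sum>l=k..<N. x ^ l) \<le> 2 * x ^ k"
proof -
  have "(\<Sum>l=k..<N. x ^ l) \<le> 2 * x ^ k - 2 * x ^ N" if "k \<le> N"
    using that
  proof (induction N rule: dec_induct)
    case (step n)
    have "2 * x ^ Suc n \<le> x ^ n" using mult_right_mono[of "2 * x" 1 "x ^ n"] assms by simp
    then show ?case using step by simp
  qed simp
  moreover have "0 \<le> x ^ N" "0 \<le> x ^ k" using assms by auto
  ultimately show ?thesis by (cases "k \<le> N") auto
qed

text \<open>The removal cost \<open>(2 / m) ^ l\<close> is summed over at most \<open>N\<close>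
  positions of the excursion, its length \<open>l \<ge> 2 * y\<close> and its \<open>2 ^ l\<close>
  shapes; \<open>8 \<le> m\<close> makes the geometric ratio \<open>4 / m\<close> at most
  1/2.\<close>

lemma weight_sum_near:
  assumes "0 < z" "0 < y" "0 < d" "8 \<le> m" "xi (int z) = m" "\<And>w. \<bar>w\<bar> \<le> int d \<Longrightarrow> xi w \<le> m / 2"
  shows "weight_sum xi t {js \<in> paths_to (int z). length js < N \<and> (\<exists>k\<le>length js. pos js k = - int y)
      \<and> (\<forall>k\<le>length js. pos js k \<noteq> - int d)}
    \<le> ennreal (2 * real N * (4 / m) ^ (2 * y)) * weight_sum xi t (paths_to (int z))" (is "weight_sum xi t ?P \<le> _ * ?U")
proof -
  define Q where "Q = (\<lambda>(i, l::nat, e). (\<lambda>js'. take i js' @ e @ drop i js') `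
    {js' \<in> paths_to (int z). i \<le> length js' \<and>
      path_weight xi t (take i js' @ e @ drop i js') \<le> ennreal ((2 / m) ^ length e) * path_weight xi t js'})"
  let ?I = "{..<N} \<times> (SIGMA l:{2 * y..<N}. steps l)"
  have sub: "?P \<subseteq> (\<Union>q\<in>?I. Q q)"
  proof
    fix js assume js: "js \<in> ?P"
    then obtain k where k: "k \<le> length js" "pos js k = - int y" by auto
    have jp: "js \<in> paths_to (int z)" and nd: "\<And>k. k \<le> length js \<Longrightarrow> pos js k \<noteq> - int d"
      using js by auto
    have m0: "0 < m" using assms by simp
    obtain i e js' where ie: "i \<le> length js'" "js = take i js' @ e @ drop i js'" "js' \<in> paths_to (int z)"
      "2 * y \<le> length e" "set e \<subseteq> {-1, 1}"
      "path_weight xi t js \<le> ennreal ((2 / m) ^ length e) * path_weight xi t js'"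
      by (rule excursion_decomposition[where xi = xi and t = t and d = d, OF jp assms(1,2) k nd assms(3) m0 assms(5,6)]) auto
    have "length js = length js' + length e" using ie(1,2) by simp
    then have "i < N" "length e < N" using js ie by auto
    then have "(i, length e, e) \<in> ?I" using ie by (auto simp: steps_def)
    moreover have "js \<in> Q (i, length e, e)" unfolding Q_def using ie by auto
    ultimately show "js \<in> (\<Union>q\<in>?I. Q q)" by blast
  qed
  have "weight_sum xi t ?P \<le> (\<Sum>q\<in>?I. weight_sum xi t (Q q))"
    by (rule weight_sum_UN[OF _ sub]) auto
  also have "\<dots> \<le> (\<Sum>q\<in>?I. ennreal ((2 / m) ^ fst (snd q)) * ?U)"
  proof (intro sum_mono)
    fix q assume "q \<in> ?I"
    then obtain i e where q: "q = (i, length e, e)" by (auto simp: steps_def)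
    show "weight_sum xi t (Q q) \<le> ennreal ((2 / m) ^ fst (snd q)) * ?U"
      unfolding q Q_def using weight_sum_insert_excursion[of xi t i e "int z" "ennreal ((2 / m) ^ length e)"] by simp
  qed
  also have "\<dots> = (\<Sum>q\<in>?I. ennreal ((2 / m) ^ fst (snd q))) * ?U"
    by (rule sum_distrib_right[symmetric])
  also have "(\<Sum>q\<in>?I. ennreal ((2 / m) ^ fst (snd q))) = ennreal (\<Sum>q\<in>?I. (2 / m) ^ fst (snd q))"
    using assms by simp
  also have "(\<Sum>q\<in>?I. (2 / m) ^ fst (snd q)) = real N * (\<Sum>l=2*y..<N. (4 / m) ^ l)"
  proof -
    have "(\<Sum>q\<in>?I. (2 / m) ^ fst (snd q)) = (\<Sum>i<N. \<Sum>q\<in>(SIGMA l:{2 * y..<N}. steps l). (2 / m) ^ fst q)"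
      by (subst sum.cartesian_product) (simp add: split_beta')
    also have "(\<Sum>q\<in>(SIGMA l:{2 * y..<N}. steps l). (2 / m) ^ fst q) = (\<Sum>l=2*y..<N. \<Sum>e\<in>steps l. (2 / m) ^ l)"
      by (subst sum.Sigma) (auto simp: split_beta')
    also have "\<dots> = (\<Sum>l=2*y..<N. (4 / m) ^ l)"
      by (intro sum.cong refl) (simp add: card_steps power_mult_distrib[symmetric])
    finally show ?thesis by simp
  qed
  also have "ennreal (real N * (\<Sum>l=2*y..<N. (4 / m) ^ l)) * ?U \<le> ennreal (2 * real N * (4 / m) ^ (2 * y)) * ?U"
  proof (intro mult_right_mono ennreal_leI)
    have "(\<Sum>l=2*y..<N. (4 / m) ^ l) \<le> 2 * (4 / m) ^ (2 * y)"
      using assms by (intro sum_geometric_tail_le) (auto simp: field_simps)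
    then have "real N * (\<Sum>l=2*y..<N. (4 / m) ^ l) \<le> real N * (2 * (4 / m) ^ (2 * y))"
      by (intro mult_left_mono) auto
    then show "real N * (\<Sum>l=2*y..<N. (4 / m) ^ l) \<le> 2 * real N * (4 / m) ^ (2 * y)" by simp
  qed auto
  finally show ?thesis .
qed

section \<open>The effect of exchanging the values at \<open>y\<close> and \<open>-y\<close>\<close>

definition swap_sites :: "(int \<Rightarrow> 'b) \<Rightarrow> nat \<Rightarrow> int \<Rightarrow> 'b" where
  "swap_sites xi y w = (if w = int y then xi (- int y) else if w = - int y then xi (int y) else xi w)"

text \<open>The path meets \<open>y\<close> on its way to \<open>z\<close> and never meets
  \<open>-y\<close>. One visit to \<open>y\<close> supplies the quantitative gain; at all other
  visited sites the exchange does not lower the potential.\<close>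

lemma path_weight_swap:
  assumes js: "js \<in> paths_to (int z)" and y: "0 < y" "y < z"
    and avoid: "\<And>k. k \<le> length js \<Longrightarrow> pos js k \<noteq> - int y"
    and M: "0 < M" "\<And>k. k \<le> length js \<Longrightarrow> xi (pos js k) \<le> M" "2 * real (length js) \<le> M * t" "0 < t"
    and b: "0 \<le> xi (int y)" "xi (int y) \<le> xi (- int y)"
  shows "ennreal (1 + (xi (- int y) - xi (int y)) / (2 * exp 1 * M)) * path_weight xi t js
    \<le> path_weight (swap_sites xi y) t js"
proof -
  let ?xs = "0 # psites 0 js" and ?xi = "swap_sites xi y" and ?D = "xi (- int y) - xi (int y)"
  have pm: "set js \<subseteq> {-1, 1}" and pn: "pos js (length js) = int z" using js by (auto simp: paths_to_def)
  have set_xs: "set ?xs = pos js ` {..length js}" using set_sites[of 0 js] by simp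
  have "\<exists>l. 0 \<le> l \<and> l \<le> length js \<and> pos js l = int y"
    using y pn by (intro pos_ivt pm) auto
  then have "int y \<in> set ?xs" unfolding set_xs by force
  then obtain S1 S2 where S: "?xs = S1 @ int y # S2" by (meson split_list)
  have len: "length js = length S1 + length S2" using arg_cong[OF S, of length] by simp
  have "length js \<noteq> 0" using pn y by (auto simp: paths_to_def)
  then have ne: "map xi (S1 @ S2) \<noteq> []" "1 \<le> length (map xi (S1 @ S2))" using len by (auto simp: Suc_le_eq)
  have "ennreal (1 + ?D / (2 * exp 1 * M)) * path_weight xi t js
      = ennreal (1 + ?D / (2 * exp 1 * M)) * path_int (xi (int y) # map xi (S1 @ S2)) t"
    unfolding path_weight_def S by (simp add: path_int_move)
  also have "\<dots> \<le> path_int ((xi (int y) + ?D) # map xi (S1 @ S2)) t"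
  proof (rule path_int_bump[OF ne(1) _ _ _ _ _ ne(2)])
    fix a assume "a \<in> set (xi (int y) # map xi (S1 @ S2))"
    then have "a \<in> xi ` set ?xs" unfolding S by auto
    then show "a \<le> M" unfolding set_xs using M by auto
  qed (use b M len in auto)
  also have "\<dots> = path_int (map (\<lambda>w. xi w) S1 @ (xi (- int y)) # map xi S2) t"
    by (simp add: path_int_move)
  also have "\<dots> \<le> path_int (map ?xi S1 @ ?xi (int y) # map ?xi S2) t"
  proof (rule path_int_mono)
    have *: "xi w \<le> ?xi w" if "w \<in> set ?xs" for w
    proof -
      have "w \<noteq> - int y" using that avoid unfolding set_xs by auto
      then show ?thesis using b by (auto simp: swap_sites_def)
    qed
    have "list_all2 (\<le>) (map xi S1) (map ?xi S1)" "list_all2 (\<le>) (map xi S2) (map ?xi S2)"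
      using * unfolding S by (auto simp: list_all2_conv_all_nth)
    then show "list_all2 (\<le>) (map xi S1 @ xi (- int y) # map xi S2) (map ?xi S1 @ ?xi (int y) # map ?xi S2)"
      by (auto simp: list_all2_appendI swap_sites_def)
  qed
  also have "\<dots> = path_weight ?xi t js"
    unfolding path_weight_def S by simp
  finally show ?thesis .
qed

text \<open>Paths to \<open>z\<close> with at least \<open>N\<close> jumps are negligible by \<open>env\<close> and \<open>long\<close>, those reaching \<open>-d\<close> by
  \<open>far\<close> and \<open>L\<close>, and those visiting \<open>-y\<close> but not \<open>-d\<close> by \<open>low\<close> and \<open>near\<close>; the relative error is
  \<open>\<theta>\<close> each time. The hypothesis \<open>far\<close> is the maximality of \<open>z\<close>: outside \<open>D\<close> the potential is at most \<open>m\<close>.\<close>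

locale good_potential =
  fixes xi :: "int \<Rightarrow> real" and t m M \<theta> \<beta> L :: real and z d N y0 :: nat and env :: "nat \<Rightarrow> real"
  assumes nonneg: "\<And>w. 0 \<le> xi w" and t: "0 < t"
    and d: "0 < d" "d < z" and zN: "z \<le> N"
    and m: "xi (int z) = m" "8 \<le> m" and zt: "real z \<le> m * t"
    and box: "\<And>w. \<bar>w\<bar> \<le> int N \<Longrightarrow> xi w \<le> M"
    and low: "\<And>w. \<bar>w\<bar> \<le> int d \<Longrightarrow> xi w \<le> m / 2"
    and far: "\<And>w. \<bar>w\<bar> \<le> int N \<Longrightarrow> m < xi w \<Longrightarrow> t * xi w \<le> t * m - z * ln m + real_of_int \<bar>w\<bar> * ln M"
    and env: "\<And>n w. N \<le> n \<Longrightarrow> \<bar>w\<bar> \<le> int n \<Longrightarrow> xi w \<le> env n"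
    and long: "\<And>n. N \<le> n \<Longrightarrow> 2 ^ n * (exp (env n * t) * (t ^ n / fact n)) \<le> \<beta> * (1 / 2) ^ n"
    and \<beta>: "0 \<le> \<beta>" "2 * \<beta> \<le> \<theta> * exp (t * m - z - z * ln m)"
    and L: "1 \<le> L" "exp (- real d * ln M) * (L ^ N * exp (2 * t * M / L)) \<le> \<theta> * exp (- real z)"
    and near: "2 * real N * (4 / m) ^ (2 * y0) \<le> \<theta>"
    and NM: "2 * real N \<le> M * t"
begin

lemma z_pos: "0 < z" using d by simp

lemma m_le_M: "m \<le> M" using box[of "int z"] m zN by simp

lemma M_pos: "0 < M" using m_le_M m by simp

lemma weight_sum_ge: "ennreal (exp (t * m - z - z * ln m)) \<le> weight_sum xi t (paths_to z)"
  using weight_sum_lower[of xi z m t] nonneg m z_pos zt by (simp add: mult.commute)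

lemma weight_sum_long_le: "weight_sum xi t {js \<in> paths_to z. N \<le> length js} \<le> ennreal \<theta> * weight_sum xi t (paths_to z)"
proof -
  have "weight_sum xi t {js \<in> paths_to z. N \<le> length js} \<le> ennreal (2 * \<beta>)"
    by (rule weight_sum_long[OF _ \<beta>(1) env long]) (use t in auto)
  also have "\<dots> \<le> ennreal (\<theta> * exp (t * m - z - z * ln m))" by (intro ennreal_leI \<beta>)
  also have "\<dots> = ennreal \<theta> * ennreal (exp (t * m - z - z * ln m))" by (rule ennreal_mult'') simp
  also have "\<dots> \<le> ennreal \<theta> * weight_sum xi t (paths_to z)"
    by (intro mult_left_mono weight_sum_ge) auto
  finally show ?thesis .
qed

lemma weight_sum_far_le:
  "weight_sum xi t {js \<in> paths_to z. length js < N \<and> (\<exists>k\<le>length js. pos js k = - int d)}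
    \<le> ennreal \<theta> * weight_sum xi t (paths_to z)" (is "?l \<le> _")
proof -
  have 1: "?l \<le> ennreal (exp (t * m - z * ln m - real d * ln M) * (L ^ N * exp (2 * t * M / L)))"
    by (rule weight_sum_far[OF t _ m_le_M _ L(1) far]) (use m d in auto)
  have "exp (t * m - z * ln m - real d * ln M) * (L ^ N * exp (2 * t * M / L))
      = exp (t * m - z * ln m) * (exp (- real d * ln M) * (L ^ N * exp (2 * t * M / L)))"
    by (simp add: mult_exp_exp mult.assoc[symmetric])
  also have "\<dots> \<le> exp (t * m - z * ln m) * (\<theta> * exp (- real z))"
    by (intro mult_left_mono L) auto
  also have "\<dots> = \<theta> * (exp (t * m - z * ln m) * exp (- real z))"
    by simp
  also have "exp (t * m - z * ln m) * exp (- real z) = exp (t * m - z - z * ln m)"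
    by (simp add: mult_exp_exp)
  finally have "?l \<le> ennreal (\<theta> * exp (t * m - z - z * ln m))"
    by (rule order_trans[OF 1 ennreal_leI])
  also have "\<dots> = ennreal \<theta> * ennreal (exp (t * m - z - z * ln m))"
    by (rule ennreal_mult'') simp
  also have "\<dots> \<le> ennreal \<theta> * weight_sum xi t (paths_to z)"
    by (intro mult_left_mono weight_sum_ge) auto
  finally show ?thesis .
qed

lemma weight_sum_near_le:
  assumes "y0 \<le> y" "0 < y"
  shows "weight_sum xi t {js \<in> paths_to z. length js < N \<and> (\<exists>k\<le>length js. pos js k = - int y)
      \<and> (\<forall>k\<le>length js. pos js k \<noteq> - int d)}
    \<le> ennreal \<theta> * weight_sum xi t (paths_to z)" (is "?l \<le> _")
proof -
  have 1: "?l \<le> ennreal (2 * real N * (4 / m) ^ (2 * y)) * weight_sum xi t (paths_to z)"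
    by (rule weight_sum_near[where xi = xi and d = d, OF z_pos assms(2) d(1) m(2,1) low])
  have "2 * real N * (4 / m) ^ (2 * y) \<le> 2 * real N * (4 / m) ^ (2 * y0)"
    using assms m by (intro mult_left_mono power_decreasing) (auto simp: field_simps)
  also have "\<dots> \<le> \<theta>" by (rule near)
  finally show ?thesis by (rule order_trans[OF 1 mult_right_mono[OF ennreal_leI]]) simp
qed

text \<open>Finiteness allows the discarded mass to be subtracted from the total and ratios to be
  formed in \<open>real\<close>. There are finitely many short paths, and the long ones are
  controlled by \<open>long\<close>.\<close>

lemma weight_sum_finite: "weight_sum xi t (paths_to z) < \<infinity>"
proof -
  let ?S = "{js \<in> paths_to z. length js < N}" and ?Lg = "{js \<in> paths_to z. N \<le> length js}"
  have "weight_sum xi t (paths_to z) \<le> weight_sum xi t (?S \<union> ?Lg)"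
    by (rule weight_sum_mono) auto
  also have "\<dots> \<le> weight_sum xi t ?S + weight_sum xi t ?Lg" by (rule weight_sum_Un)
  finally have split: "weight_sum xi t (paths_to z) \<le> weight_sum xi t ?S + weight_sum xi t ?Lg" .
  have "weight_sum xi t ?S \<le> (\<Sum>n. ennreal (2 ^ n * (exp (M * t) * (t ^ n / fact n))) * indicator {..<N} n)"
  proof (rule weight_sum_le_suminf)
    fix n js assume js: "js \<in> steps n" "js \<in> ?S"
    then have pm: "set js \<subseteq> {-1, 1}" and n: "n < N" by (auto simp: steps_def)
    show "path_weight xi t js \<le> ennreal (exp (M * t) * (t ^ n / fact n))"
    proof (rule path_weight_upper[OF js(1)])
      fix k assume "k \<le> n"
      then have "\<bar>pos js k\<bar> \<le> int N" using pos_abs_le[OF pm, of k] n by simp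
      then show "xi (pos js k) \<le> M" by (rule box)
    qed (use t in simp)
  qed (use t in \<open>auto simp: paths_to_def steps_def\<close>)
  also have "\<dots> = (\<Sum>n\<in>{..<N}. ennreal (2 ^ n * (exp (M * t) * (t ^ n / fact n))) * indicator {..<N} n)"
    by (rule suminf_finite) auto
  also have "\<dots> < \<infinity>" by (auto simp: indicator_def ennreal_mult_less_top)
  finally have S: "weight_sum xi t ?S < \<infinity>" .
  have "weight_sum xi t ?Lg \<le> ennreal (2 * \<beta>)"
    by (rule weight_sum_long[OF _ \<beta>(1) env long]) (use t in auto)
  then have "weight_sum xi t ?Lg < \<infinity>" by (rule le_less_trans) simp
  with S have "weight_sum xi t ?S + weight_sum xi t ?Lg < \<infinity>" by simp
  with split show ?thesis by (rule le_less_trans)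
qed

text \<open>Paths with fewer than \<open>N\<close> jumps that avoid \<open>-y\<close> carry all but
  a fraction \<open>3 * \<theta>\<close> of the mass, and each of them gains. For the exchanged
  potential only these paths are kept, which gives a lower bound.\<close>

lemma weight_sum_swap_gain:
  assumes y: "0 < y" "y0 \<le> y" "y \<le> d" and D: "xi (int y) \<le> xi (- int y)" and \<theta>: "3 * \<theta> \<le> 1"
  shows "ennreal ((1 + (xi (- int y) - xi (int y)) / (2 * exp 1 * M)) * (1 - 3 * \<theta>)) * weight_sum xi t (paths_to z)
    \<le> weight_sum (swap_sites xi y) t (paths_to z)"
proof -
  define U where "U = enn2real (weight_sum xi t (paths_to z))"
  have U: "weight_sum xi t (paths_to z) = ennreal U" using weight_sum_finite by (simp add: U_def)
  have U0: "0 \<le> U" by (simp add: U_def)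
  have \<theta>0: "0 \<le> \<theta>" using near m by (intro order_trans[OF _ near]) auto
  let ?B1 = "{js \<in> paths_to z. N \<le> length js}"
  let ?B2 = "{js \<in> paths_to z. length js < N \<and> (\<exists>k\<le>length js. pos js k = - int d)}"
  let ?B3 = "{js \<in> paths_to z. length js < N \<and> (\<exists>k\<le>length js. pos js k = - int y) \<and> (\<forall>k\<le>length js. pos js k \<noteq> - int d)}"
  let ?G = "{js \<in> paths_to z. length js < N \<and> (\<forall>k\<le>length js. pos js k \<noteq> - int y)}"
  let ?c = "1 + (xi (- int y) - xi (int y)) / (2 * exp 1 * M)"
  have "weight_sum xi t (paths_to z) \<le> weight_sum xi t (?G \<union> (?B1 \<union> (?B2 \<union> ?B3)))"
    by (rule weight_sum_mono) auto
  also have "\<dots> \<le> weight_sum xi t ?G + (weight_sum xi t ?B1 + (weight_sum xi t ?B2 + weight_sum xi t ?B3))"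
    by (rule order_trans[OF weight_sum_Un add_left_mono[OF order_trans[OF weight_sum_Un add_left_mono[OF weight_sum_Un]]]])
  also have "\<dots> \<le> weight_sum xi t ?G + (ennreal \<theta> * ennreal U + (ennreal \<theta> * ennreal U + ennreal \<theta> * ennreal U))"
    unfolding U[symmetric]
    by (rule add_mono[OF order.refl add_mono[OF weight_sum_long_le add_mono[OF weight_sum_far_le weight_sum_near_le[OF y(2,1)]]]])
  also have "ennreal \<theta> * ennreal U + (ennreal \<theta> * ennreal U + ennreal \<theta> * ennreal U) = ennreal (3 * \<theta> * U)"
    using \<theta>0 U0 by (simp add: ennreal_mult'[symmetric] ennreal_plus[symmetric] del: ennreal_plus)
  finally have "ennreal U \<le> weight_sum xi t ?G + ennreal (3 * \<theta> * U)" unfolding U .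
  then have "ennreal U - ennreal (3 * \<theta> * U) \<le> weight_sum xi t ?G"
    by (simp add: ennreal_minus_le_iff add.commute)
  then have G: "ennreal ((1 - 3 * \<theta>) * U) \<le> weight_sum xi t ?G"
    using \<theta>0 U0 by (simp add: ennreal_minus left_diff_distrib)
  have c0: "0 \<le> ?c" using D M_pos by simp
  have "ennreal (?c * (1 - 3 * \<theta>)) * weight_sum xi t (paths_to z) = ennreal ?c * ennreal ((1 - 3 * \<theta>) * U)"
    using c0 U0 \<theta> by (simp add: U ennreal_mult'[symmetric] mult.assoc)
  also have "\<dots> \<le> ennreal ?c * weight_sum xi t ?G"
    by (intro mult_left_mono G) auto
  also have "\<dots> = (\<integral>\<^sup>+js. ennreal ?c * (path_weight xi t js * indicator ?G js) \<partial>count_space UNIV)"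
    unfolding weight_sum_def by (rule nn_integral_cmult[symmetric]) simp
  also have "\<dots> \<le> weight_sum (swap_sites xi y) t ?G"
    unfolding weight_sum_def
  proof (intro nn_integral_mono)
    fix js
    show "ennreal ?c * (path_weight xi t js * indicator ?G js) \<le> path_weight (swap_sites xi y) t js * indicator ?G js"
    proof (cases "js \<in> ?G")
      case True
      then have pm: "set js \<subseteq> {-1, 1}" by (auto simp: paths_to_def)
      have "ennreal ?c * path_weight xi t js \<le> path_weight (swap_sites xi y) t js"
      proof (rule path_weight_swap)
        fix k assume "k \<le> length js"
        then have "\<bar>pos js k\<bar> \<le> int N" using pos_abs_le[OF pm, of k] True by auto
        then show "xi (pos js k) \<le> M" by (rule box)
      next
        have "2 * real (length js) \<le> 2 * real N" using True by auto
        then show "2 * real (length js) \<le> M * t" using NM by linarith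
      qed (use True y d nonneg D t M_pos in auto)
      then show ?thesis using True by simp
    qed auto
  qed
  also have "\<dots> \<le> weight_sum (swap_sites xi y) t (paths_to z)"
    by (rule weight_sum_mono) auto
  finally show ?thesis .
qed

end

section \<open>Reflection, and the action of exchanges on potentials\<close>

lemma psites_uminus: "psites (- x) (map uminus js) = map uminus (psites x js)"
proof (induction js arbitrary: x)
  case (Cons j js)
  then show ?case using Cons.IH[of "x + j"] by simp
qed simp

lemma path_weight_reflect: "path_weight xi t (map uminus js) = path_weight (\<lambda>w. xi (- w)) t js"
  using psites_uminus[of 0 js] by (simp add: path_weight_def o_def)

text \<open>Turns \<open>u(t, -z)\<close> into a sum over paths to \<open>z\<close>, so that one set
  of estimates serves both numerator and denominator.\<close>

lemma weight_sum_reflect: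
  "weight_sum xi t (paths_to (- z)) = weight_sum (\<lambda>w. xi (- w)) t (paths_to z)"
proof -
  have neg: "map uminus js \<in> paths_to (- z)" if "js \<in> paths_to z" for js z
  proof -
    have "sum_list (map uminus js) = - sum_list js" by (induction js) auto
    moreover have "set (map uminus js) \<subseteq> {-1, 1}" using that by (auto simp: paths_to_def)
    ultimately show ?thesis using that by (simp add: paths_to_def)
  qed
  have bij: "bij_betw (map uminus) (paths_to z) (paths_to (- z))"
    by (rule bij_betwI[where g = "map uminus"]) (use neg[of _ z] neg[of _ "- z"] in \<open>auto simp: o_def\<close>)
  have "weight_sum xi t (paths_to (- z)) = (\<integral>\<^sup>+js. path_weight xi t js \<partial>count_space (paths_to (- z)))"
    by (simp add: weight_sum_def nn_integral_count_space_indicator)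
  also have "\<dots> = (\<integral>\<^sup>+js. path_weight xi t (map uminus js) \<partial>count_space (paths_to z))"
    by (rule nn_integral_bij_count_space[OF bij, symmetric])
  also have "\<dots> = weight_sum (\<lambda>w. xi (- w)) t (paths_to z)"
    by (simp add: weight_sum_def nn_integral_count_space_indicator path_weight_reflect)
  finally show ?thesis .
qed

lemma swap_sites_swap [simp]: "swap_sites (swap_sites xi y) y = xi"
  by (auto simp: swap_sites_def fun_eq_iff)

lemma swap_sites_sym_iff: "swap_sites xi y w = swap_sites xi y (- w) \<longleftrightarrow> xi w = xi (- w)"
proof -
  consider "w = int y" | "w = - int y" | "w \<noteq> int y" "w \<noteq> - int y" by blast
  then show ?thesis by cases (auto simp: swap_sites_def)
qed

lemma swap_sites_sym: "xi w = xi (- w) \<Longrightarrow> swap_sites xi y w = xi w"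
  by (auto simp: swap_sites_def)

lemma swap_sites_reflect: "swap_sites (\<lambda>w. xi (- w)) y = (\<lambda>w. swap_sites xi y (- w))"
  by (auto simp: swap_sites_def fun_eq_iff)

lemma swap_sites_cases: "swap_sites xi y w = xi w \<or> swap_sites xi y w = xi (- w)"
  by (auto simp: swap_sites_def)

definition log_ratio :: "real \<Rightarrow> nat \<Rightarrow> (int \<Rightarrow> real) \<Rightarrow> real" where
  "log_ratio t z xi = ln (pam_u xi t (int z) / pam_u xi t (- int z))"

text \<open>The numerical conditions at one time, free of \<open>xi\<close> and \<open>z\<close>, so
  that they serve a potential, its exchanges and its reflection alike. The exponent 3/4 in
  \<open>env\<close> lies above 1/2, hence above \<open>1 / \<alpha>\<close> with enough room for
  the exceedance probabilities to be summable, and below 1, so that the linear cost of distance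
  eventually wins.\<close>

locale scales =
  fixes t a m0 M \<theta> L B r :: real and N d y0 :: nat
  fixes env :: "real \<Rightarrow> real"
  defines "env \<equiv> \<lambda>x. B * a * (1 + x / r) powr (3 / 4)"
  assumes t: "0 < t" and a: "0 < a" and B: "0 < B" and r: "0 < r" and m0: "8 \<le> m0"
    and env_lt: "\<And>n. N \<le> n \<Longrightarrow> t * env (real n) < n * ln m0"
    and long: "\<And>n. N \<le> n \<Longrightarrow> 2 ^ n * (exp (env (real n) * t) * (t ^ n / fact n)) \<le> (\<theta> * exp (- real N) / 2) * (1 / 2) ^ n"
    and env_M: "env (real N) \<le> M"
    and L: "1 \<le> L" "exp (- real d * ln M) * (L ^ N * exp (2 * t * M / L)) \<le> \<theta> * exp (- real N)"
    and near: "2 * real N * (4 / m0) ^ (2 * y0) \<le> \<theta>"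
    and NM: "2 * real N \<le> M * t"
    and \<theta>: "0 < \<theta>" "\<theta> * (24 * exp 1 * M) \<le> 1"
    and d: "0 < d" "d \<le> N" and M: "1 \<le> M"
begin

text \<open>Every clause survives reflection and exchanges. The number \<open>m0\<close> is a fixed
  lower bound for \<open>xi (int z)\<close>; it lets the bounds near 0 and off \<open>D\<close> be
  stated without reference to \<open>z\<close>.\<close>

definition good_at :: "nat \<Rightarrow> (int \<Rightarrow> real) \<Rightarrow> bool" where
  "good_at z xi \<longleftrightarrow> (\<forall>w. 1 \<le> xi w) \<and> (\<forall>w. xi w \<le> env (real_of_int \<bar>w\<bar>)) \<and>
     xi (int z) = xi (- int z) \<and> (\<forall>w. xi w = xi (- w) \<longrightarrow> Psi xi t w \<le> Psi xi t (int z)) \<and>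
     m0 \<le> xi (int z) \<and> (\<forall>w. \<bar>w\<bar> \<le> int d \<longrightarrow> xi w \<le> m0 / 2) \<and>
     (\<forall>w. \<bar>w\<bar> \<le> int N \<longrightarrow> xi w \<noteq> xi (- w) \<longrightarrow> xi w \<le> m0)"

lemma good_at_ge_1: "good_at z xi \<Longrightarrow> 1 \<le> xi w"
  unfolding good_at_def by (erule conjunct1[THEN spec])

lemma good_at_env: "good_at z xi \<Longrightarrow> xi w \<le> env (real_of_int \<bar>w\<bar>)"
  unfolding good_at_def by (drule conjunct2, erule conjunct1[THEN spec])

lemma good_at_sym: "good_at z xi \<Longrightarrow> xi (int z) = xi (- int z)"
  unfolding good_at_def by (drule conjunct2, drule conjunct2, erule conjunct1)

lemma good_at_Psi: "xi w = xi (- w) \<Longrightarrow> good_at z xi \<Longrightarrow> Psi xi t w \<le> Psi xi t (int z)"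
  unfolding good_at_def by (drule conjunct2, drule conjunct2, drule conjunct2, drule conjunct1, drule spec, erule mp)

lemma good_at_m0: "good_at z xi \<Longrightarrow> m0 \<le> xi (int z)"
  unfolding good_at_def by (drule conjunct2, drule conjunct2, drule conjunct2, drule conjunct2, erule conjunct1)

lemma good_at_low: "\<bar>w\<bar> \<le> int d \<Longrightarrow> good_at z xi \<Longrightarrow> xi w \<le> m0 / 2"
  unfolding good_at_def
  by (drule conjunct2, drule conjunct2, drule conjunct2, drule conjunct2, drule conjunct2, drule conjunct1, drule spec, erule mp)

lemma good_at_asym: "\<bar>w\<bar> \<le> int N \<Longrightarrow> xi w \<noteq> xi (- w) \<Longrightarrow> good_at z xi \<Longrightarrow> xi w \<le> m0"
  unfolding good_at_def
  by (drule conjunct2, drule conjunct2, drule conjunct2, drule conjunct2, drule conjunct2, drule conjunct2, drule spec, drule mp, assumption, erule mp)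

text \<open>An exchange only moves values between some \<open>w\<close> and \<open>-w\<close>, and
  it fixes the sites with equal values, which are the only ones at which \<open>Psi\<close> is
  compared.\<close>

lemma good_at_swap:
  assumes g: "good_at z xi"
  shows "good_at z (swap_sites xi y)"
proof -
  let ?xi = "swap_sites xi y"
  note D = good_at_ge_1[OF g] good_at_env[OF g] good_at_sym[OF g] good_at_Psi[where xi = xi, OF _ g] good_at_m0[OF g] good_at_low[OF _ g] good_at_asym[where xi = xi, OF _ _ g]
  have Psi_eq: "Psi ?xi t w = Psi xi t w" if "xi w = xi (- w)" for w
    using swap_sites_sym[of xi w y, OF that] by (simp add: Psi_def)
  have z': "?xi (int z) = xi (int z)" "?xi (- int z) = xi (int z)"
  proof -
    show "?xi (int z) = xi (int z)" by (rule swap_sites_sym[of xi "int z" y, OF D(3)])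
    have "xi (- int z) = xi (- (- int z))" using D(3) by simp
    from swap_sites_sym[of xi "- int z" y, OF this] D(3) show "?xi (- int z) = xi (int z)" by simp
  qed
  show ?thesis
    unfolding good_at_def swap_sites_sym_iff z'
  proof (intro conjI allI impI)
    fix w
    have c: "?xi w = xi w \<or> ?xi w = xi (- w)" by (rule swap_sites_cases)
    show "1 \<le> ?xi w" using D(1)[of w] D(1)[of "- w"] c by (elim disjE) simp_all
    show "?xi w \<le> env (real_of_int \<bar>w\<bar>)" using D(2)[of w] D(2)[of "- w"] c by (elim disjE) simp_all
    show "Psi ?xi t w \<le> Psi ?xi t (int z)" if "xi w = xi (- w)"
      unfolding Psi_eq[OF that] Psi_eq[OF D(3)] by (rule D(4)[OF that])
    show "?xi w \<le> m0 / 2" if "\<bar>w\<bar> \<le> int d"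
      using D(6)[of w] D(6)[of "- w"] that c by (elim disjE) simp_all
    show "?xi w \<le> m0" if "\<bar>w\<bar> \<le> int N" "xi w \<noteq> xi (- w)"
    proof -
      have "xi (- w) \<noteq> xi (- (- w))" using that(2) by simp
      then show ?thesis using D(7)[OF that] D(7)[of "- w"] that(1) c by (elim disjE) simp_all
    qed
  qed (rule refl D(5))+
qed

lemma good_at_reflect:
  assumes g: "good_at z xi"
  shows "good_at z (\<lambda>w. xi (- w))"
  unfolding good_at_def
proof (intro conjI allI impI)
  note D = good_at_ge_1[OF g] good_at_env[OF g] good_at_sym[OF g] good_at_Psi[where xi = xi, OF _ g] good_at_m0[OF g] good_at_low[OF _ g] good_at_asym[where xi = xi, OF _ _ g]
  fix w
  show "1 \<le> xi (- w)" by (rule D(1))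
  show "xi (- w) \<le> env (real_of_int \<bar>w\<bar>)" using D(2)[of "- w"] by simp
  show "Psi (\<lambda>w. xi (- w)) t w \<le> Psi (\<lambda>w. xi (- w)) t (int z)" if "xi (- w) = xi (- (- w))"
  proof -
    have eq: "Psi (\<lambda>w. xi (- w)) t v = Psi xi t v" if "xi v = xi (- v)" for v
      by (simp add: Psi_def that)
    have w: "xi w = xi (- w)" using that by simp
    show ?thesis unfolding eq[OF w] eq[OF D(3)] by (rule D(4)[OF w])
  qed
  show "xi (- w) \<le> m0 / 2" if "\<bar>w\<bar> \<le> int d"
    using D(6)[of "- w"] that by simp
  show "xi (- w) \<le> m0" if "\<bar>w\<bar> \<le> int N" "xi (- w) \<noteq> xi (- (- w))"
    using D(7)[of "- w"] that by simp
next
  note D = good_at_ge_1[OF g] good_at_env[OF g] good_at_sym[OF g] good_at_Psi[where xi = xi, OF _ g] good_at_m0[OF g] good_at_low[OF _ g] good_at_asym[where xi = xi, OF _ _ g]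
  show "xi (- int z) = xi (- (- int z))" using D(3) by simp
  show "m0 \<le> xi (- int z)" using D(5) D(3) by simp
qed

lemma env_mono: "0 \<le> x \<Longrightarrow> x \<le> y \<Longrightarrow> env x \<le> env y"
  unfolding env_def using a B r
  by (intro mult_left_mono powr_mono2) (auto simp: divide_right_mono)

text \<open>The site 0 lies in \<open>D\<close>, so maximality yields
  \<open>z * ln m \<le> t * m\<close>. With the envelope this forces \<open>z \<le> N\<close>, and
  the small values on \<open>[-d, d]\<close> force \<open>d < z\<close>. The hypothesis
  \<open>far\<close> is maximality at a site with value above \<open>m \<ge> m0\<close>, which must
  be symmetric.\<close>

lemma good_potential:
  assumes g: "good_at z xi"
  shows "good_potential xi t (xi (int z)) M \<theta> (\<theta> * exp (- real N) / 2) L z d N y0 (\<lambda>n. env (real n))"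
proof -
  define m where "m = xi (int z)"
  note D = good_at_ge_1[OF g] good_at_env[OF g] good_at_sym[OF g] good_at_Psi[where xi = xi, OF _ g] good_at_m0[OF g] good_at_low[OF _ g] good_at_asym[where xi = xi, OF _ _ g]
  note g0 = D(1) and g1 = D(2) and g2 = D(4) and g4 = D(6) and g5 = D(7)
  have g3: "m0 \<le> m" using D(5) by (simp add: m_def)
  have "Psi xi t 0 \<le> Psi xi t (int z)" by (rule g2) simp
  then have "0 \<le> m - z / t * ln m" using g0[of 0] by (simp add: Psi_def m_def)
  then have Psi0: "z * ln m \<le> t * m" using t by (simp add: field_simps)
  have lnm0: "1 \<le> ln m0" using m0 exp_le ln_ge_iff[of m0 1] by linarith
  have lnm: "ln m0 \<le> ln m" using g3 m0 by simp
  have zN: "z \<le> N"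
  proof (rule ccontr)
    assume "\<not> z \<le> N"
    then have "t * env (real z) < z * ln m0" by (intro env_lt) simp
    moreover have "t * m \<le> t * env (real z)" using g1[of "int z"] t by (simp add: m_def)
    moreover have "z * ln m0 \<le> z * ln m" using lnm by (intro mult_left_mono) auto
    ultimately show False using Psi0 by linarith
  qed
  have dz: "d < z"
  proof (rule ccontr)
    assume "\<not> d < z"
    then have "m \<le> m0 / 2" unfolding m_def by (intro g4) simp
    then show False using g3 m0 by simp
  qed
  have box: "xi w \<le> M" if "\<bar>w\<bar> \<le> int N" for w
  proof -
    have "real_of_int \<bar>w\<bar> \<le> real N" using that by linarith
    then have "env (real_of_int \<bar>w\<bar>) \<le> env (real N)" by (intro env_mono) auto
    then show ?thesis using g1[of w] env_M by linarith
  qed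
  have zm: "z \<le> m * t"
  proof -
    have "real z * 1 \<le> z * ln m" using lnm lnm0 by (intro mult_left_mono) auto
    then show ?thesis using Psi0 by (simp add: mult.commute)
  qed
  show ?thesis
    unfolding m_def[symmetric]
  proof
    fix w assume w: "\<bar>w\<bar> \<le> int N" "m < xi w"
    have "xi w = xi (- w)" using g5[OF w(1)] w(2) g3 by force
    then have "Psi xi t w \<le> Psi xi t (int z)" by (rule g2)
    then have "t * Psi xi t w \<le> t * Psi xi t (int z)" using t by simp
    then have "t * xi w - real_of_int \<bar>w\<bar> * ln (xi w) \<le> t * m - z * ln m"
      using t by (simp add: Psi_def m_def right_diff_distrib)
    moreover have "real_of_int \<bar>w\<bar> * ln (xi w) \<le> real_of_int \<bar>w\<bar> * ln M"
      using box[OF w(1)] g0[of w] by (intro mult_left_mono) auto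
    ultimately show "t * xi w \<le> t * m - z * ln m + real_of_int \<bar>w\<bar> * ln M" by linarith
  next
    fix n :: nat and w assume "N \<le> n" "\<bar>w\<bar> \<le> int n"
    then have "real_of_int \<bar>w\<bar> \<le> real n" by linarith
    then have "env (real_of_int \<bar>w\<bar>) \<le> env (real n)" by (intro env_mono) auto
    then show "xi w \<le> env (real n)" using g1[of w] by linarith
  next
    \<comment> \<open>The exponent of the lower bound for the path sum is at least
      \<open>- N\<close>, so an error measured against \<open>exp (- N)\<close> is uniform in
      \<open>z\<close>.\<close>
    have "exp (- real N) \<le> exp (t * m - z - z * ln m)" using Psi0 zN by simp
    then show "2 * (\<theta> * exp (- real N) / 2) \<le> \<theta> * exp (t * m - z - z * ln m)" using \<theta> by simp
  next
    have "\<theta> * exp (- real N) \<le> \<theta> * exp (- real z)" using zN \<theta> by simp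
    then show "exp (- real d * ln M) * (L ^ N * exp (2 * t * M / L)) \<le> \<theta> * exp (- real z)" using L by linarith
  next
    have "2 * real N * (4 / m) ^ (2 * y0) \<le> 2 * real N * (4 / m0) ^ (2 * y0)"
      using g3 m0 by (intro mult_left_mono power_mono divide_left_mono) auto
    then show "2 * real N * (4 / m) ^ (2 * y0) \<le> \<theta>" using near by linarith
  next
    fix w assume "\<bar>w\<bar> \<le> int d"
    from g4[OF this] g3 show "xi w \<le> m / 2" by simp
  next
    fix w show "0 \<le> xi w" using g0[of w] by simp
  next
    show "8 \<le> m" using g3 m0 by simp
    show "0 \<le> \<theta> * exp (- real N) / 2" using \<theta> by simp
    show "xi (int z) = m" by (rule m_def[symmetric])
    show "0 < t" by (rule t)
    show "0 < d" by (rule d)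
    show "d < z" by (rule dz)
    show "z \<le> N" by (rule zN)
    show "real z \<le> m * t" by (rule zm)
    show "1 \<le> L" by (rule L)
    show "2 * real N \<le> M * t" by (rule NM)
    show "\<And>w. \<bar>w\<bar> \<le> int N \<Longrightarrow> xi w \<le> M" by (rule box)
    show "\<And>n. N \<le> n \<Longrightarrow> 2 ^ n * (exp (env (real n) * t) * (t ^ n / fact n)) \<le> \<theta> * exp (- real N) / 2 * (1 / 2) ^ n"
      by (rule long)
  qed
qed

definition U :: "nat \<Rightarrow> (int \<Rightarrow> real) \<Rightarrow> real" where
  "U z xi = enn2real (weight_sum xi t (paths_to (int z)))"

lemma U_pos:
  assumes g: "good_at z xi"
  shows "0 < U z xi"
proof -
  interpret good_potential xi t "xi (int z)" M \<theta> "\<theta> * exp (- real N) / 2" L z d N y0 "\<lambda>n. env (real n)"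
    by (rule good_potential[OF g])
  have "0 < ennreal (exp (t * xi (int z) - z - z * ln (xi (int z))))" by simp
  also have "\<dots> \<le> weight_sum xi t (paths_to (int z))" by (rule weight_sum_ge)
  finally have "0 < weight_sum xi t (paths_to (int z))" .
  with weight_sum_finite have "0 < weight_sum xi t (paths_to (int z)) \<and> weight_sum xi t (paths_to (int z)) < top"
    unfolding infinity_ennreal_def by (intro conjI)
  then show ?thesis unfolding U_def enn2real_positive_iff .
qed

text \<open>For a gap of at least 1 the relative gain \<open>q\<close> dominates the lost mass:
  \<open>3 * \<theta> \<le> q / 4\<close>. Since \<open>q \<le> 1\<close>, at least
  \<open>q / 4\<close> survives the passage to logarithms.\<close>

lemma U_swap_gain:
  assumes g: "good_at z xi" and y: "0 < y" "y0 \<le> y" "y \<le> d" and D: "1 \<le> xi (- int y) - xi (int y)"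
  shows "ln (U z xi) + (xi (- int y) - xi (int y)) / (8 * exp 1 * M) \<le> ln (U z (swap_sites xi y))"
proof -
  interpret gp: good_potential xi t "xi (int z)" M \<theta> "\<theta> * exp (- real N) / 2" L z d N y0 "\<lambda>n. env (real n)"
    by (rule good_potential[OF g])
  interpret sw: good_potential "swap_sites xi y" t "swap_sites xi y (int z)" M \<theta> "\<theta> * exp (- real N) / 2" L z d N y0 "\<lambda>n. env (real n)"
    by (rule good_potential[OF good_at_swap[OF g]])
  define D where "D = xi (- int y) - xi (int y)"
  define q where "q = D / (2 * exp 1 * M)"
  have M0: "0 < M" using M by simp
  have D1: "1 \<le> D" using D by (simp add: D_def)
  have DM: "D \<le> M"
    using gp.box[of "- int y"] y d gp.nonneg[of "int y"] by (simp add: D_def)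
  have "1 \<le> 2 * exp (1::real)" using exp_ge_add_one_self[of "1::real"] by linarith
  then have "M * 1 \<le> M * (2 * exp 1)" using M0 by (intro mult_left_mono) auto
  then have "M * 1 \<le> 2 * exp 1 * M" by (simp add: mult_ac)
  then have "D \<le> 2 * exp 1 * M" using DM by linarith
  then have q1: "q \<le> 1" unfolding q_def using M0 by (subst divide_le_eq_1_pos) auto
  have q0: "0 < q" using D1 M0 by (simp add: q_def)
  have "12 * \<theta> * (2 * exp 1 * M) \<le> 1" using \<theta> by (simp add: mult_ac)
  also have "\<dots> \<le> D" by (rule D1)
  finally have "12 * \<theta> \<le> q" using M0 by (simp add: q_def field_simps)
  then have th: "3 * \<theta> \<le> q / 4" by simp
  have "q * q \<le> q * 1" using q0 q1 by (intro mult_left_mono) auto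
  moreover have "(1 + q) * (1 - q / 4) = 1 + 3 / 4 * q - q * q / 4" by (simp add: field_simps)
  ultimately have "1 + q / 2 \<le> (1 + q) * (1 - q / 4)" by linarith
  also have "\<dots> \<le> (1 + q) * (1 - 3 * \<theta>)" using th q0 by (intro mult_left_mono) auto
  finally have qq: "1 + q / 2 \<le> (1 + q) * (1 - 3 * \<theta>)" .
  have "ennreal ((1 + q) * (1 - 3 * \<theta>)) * weight_sum xi t (paths_to z) \<le> weight_sum (swap_sites xi y) t (paths_to z)"
    unfolding q_def D_def by (rule gp.weight_sum_swap_gain) (use y D th q1 in \<open>auto simp: D_def\<close>)
  then have "enn2real (ennreal ((1 + q) * (1 - 3 * \<theta>)) * weight_sum xi t (paths_to z)) \<le> enn2real (weight_sum (swap_sites xi y) t (paths_to z))"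
    using sw.weight_sum_finite by (intro enn2real_mono) auto
  then have "(1 + q) * (1 - 3 * \<theta>) * U z xi \<le> U z (swap_sites xi y)"
    using qq q0 by (simp add: U_def enn2real_mult)
  moreover have "(1 + q / 2) * U z xi \<le> (1 + q) * (1 - 3 * \<theta>) * U z xi"
    using qq U_pos[OF g] by (intro mult_right_mono) auto
  ultimately have "(1 + q / 2) * U z xi \<le> U z (swap_sites xi y)" by linarith
  then have "ln ((1 + q / 2) * U z xi) \<le> ln (U z (swap_sites xi y))"
    by (intro ln_mono mult_pos_pos U_pos g) (use q0 in auto)
  moreover have "ln ((1 + q / 2) * U z xi) = ln (1 + q / 2) + ln (U z xi)"
    using U_pos[OF g] q0 by (intro ln_mult_pos) auto
  moreover have "q / 2 - (q / 2)\<^sup>2 \<le> ln (1 + q / 2)"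
    using q0 q1 by (intro ln_one_plus_pos_lower_bound) auto
  moreover have "q / 4 \<le> q / 2 - (q / 2)\<^sup>2"
    using \<open>q * q \<le> q * 1\<close> by (simp add: power2_eq_square)
  moreover have "q / 4 = D / (8 * exp 1 * M)" by (simp add: q_def)
  ultimately show ?thesis unfolding D_def by linarith
qed

lemma log_ratio_eq:
  assumes g: "good_at z xi"
  shows "log_ratio t z xi = ln (U z xi) - ln (U z (\<lambda>w. xi (- w)))"
proof -
  have "pam_u xi t (int z) = exp (- 2 * t) * U z xi"
    unfolding U_def by (rule pam_u_eq_weight_sum) (use t in simp)
  moreover have "pam_u xi t (- int z) = exp (- 2 * t) * U z (\<lambda>w. xi (- w))"
    unfolding U_def weight_sum_reflect[symmetric] by (rule pam_u_eq_weight_sum) (use t in simp)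
  ultimately have "log_ratio t z xi = ln (U z xi / U z (\<lambda>w. xi (- w)))"
    unfolding log_ratio_def by simp
  then show ?thesis
    using U_pos[OF g] U_pos[OF good_at_reflect[OF g]] by (simp add: ln_divide_pos)
qed

text \<open>The exchange lowers the numerator and raises the denominator. The second effect is the
  first one for the reflected potential, and the two gains add.\<close>

lemma log_ratio_swap_gain:
  assumes g: "good_at z xi" and y: "0 < y" "y0 \<le> y" "y \<le> d" and D: "1 \<le> xi (int y) - xi (- int y)"
  shows "log_ratio t z (swap_sites xi y) + (xi (int y) - xi (- int y)) / (4 * exp 1 * M) \<le> log_ratio t z xi"
proof -
  let ?s = "swap_sites xi y" and ?D = "xi (int y) - xi (- int y)"
  have s: "?s (int y) = xi (- int y)" "?s (- int y) = xi (int y)" by (auto simp: swap_sites_def)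
  have gs: "good_at z ?s" by (rule good_at_swap[OF g])
  have "ln (U z ?s) + ?D / (8 * exp 1 * M) \<le> ln (U z (swap_sites ?s y))"
    using U_swap_gain[OF gs y] D by (simp add: s)
  then have 1: "ln (U z ?s) + ?D / (8 * exp 1 * M) \<le> ln (U z xi)" by simp
  have "ln (U z (\<lambda>w. xi (- w))) + ?D / (8 * exp 1 * M) \<le> ln (U z (swap_sites (\<lambda>w. xi (- w)) y))"
    using U_swap_gain[OF good_at_reflect[OF g] y] D by simp
  then have 2: "ln (U z (\<lambda>w. xi (- w))) + ?D / (8 * exp 1 * M) \<le> ln (U z (\<lambda>w. ?s (- w)))"
    by (simp only: swap_sites_reflect)
  have "?D / (4 * exp 1 * M) = ?D / (8 * exp 1 * M) + ?D / (8 * exp 1 * M)" by simp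
  then show ?thesis using 1 2 by (simp add: log_ratio_eq g gs)
qed

end

section \<open>Anticoncentration under exchanges\<close>

text \<open>The discrete analogue of bounding a density by integrating along a direction: with
  \<open>h\<close> the truncation of \<open>F / (2K)\<close> to \<open>[-1, 1]\<close>, the correlation of \<open>h\<close> with the normalised
  Rademacher sum \<open>\<Sum> c\<^sub>y \<sigma>\<^sub>y / \<surd>V\<close> is at most 1, while every configuration with \<open>\<bar>F\<bar> \<le> K\<close>
  contributes at least \<open>\<surd>V / (4K)\<close> to it.\<close>

lemma (in prob_space) swap_anticoncentration:
  fixes Y :: "'i set" and \<tau> :: "'i \<Rightarrow> 'a \<Rightarrow> 'a" and F :: "'a \<Rightarrow> real" and c \<sigma> :: "'i \<Rightarrow> 'a \<Rightarrow> real"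
  assumes Y: "finite Y"
    and \<tau>_meas: "\<And>y. y \<in> Y \<Longrightarrow> \<tau> y \<in> measurable M M"
    and \<tau>_distr: "\<And>y. y \<in> Y \<Longrightarrow> distr M M (\<tau> y) = M"
    and G [measurable]: "G \<in> sets M"
    and \<tau>_G: "\<And>x y. y \<in> Y \<Longrightarrow> x \<in> space M \<Longrightarrow> \<tau> y x \<in> G \<longleftrightarrow> x \<in> G"
    and F_meas [measurable]: "F \<in> borel_measurable M"
    and c_meas [measurable]: "\<And>y. c y \<in> borel_measurable M"
    and \<sigma>_meas [measurable]: "\<And>y. \<sigma> y \<in> borel_measurable M"
    and c_inv: "\<And>x y y'. y \<in> Y \<Longrightarrow> y' \<in> Y \<Longrightarrow> c y (\<tau> y' x) = c y x"
    and \<sigma>_inv: "\<And>x y y'. y \<in> Y \<Longrightarrow> y' \<in> Y \<Longrightarrow> \<sigma> y (\<tau> y' x) = (if y = y' then - \<sigma> y x else \<sigma> y x)"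
    and \<sigma>_le: "\<And>x y. \<bar>\<sigma> y x\<bar> \<le> 1"
    and c_bound: "\<And>x y. y \<in> Y \<Longrightarrow> x \<in> G \<Longrightarrow> 0 \<le> c y x \<and> c y x \<le> K"
    and \<sigma>_cases: "\<And>x y. y \<in> Y \<Longrightarrow> x \<in> G \<Longrightarrow> 0 < c y x \<Longrightarrow> \<sigma> y x = 1 \<or> \<sigma> y x = -1"
    and gain: "\<And>x y. y \<in> Y \<Longrightarrow> x \<in> G \<Longrightarrow> 0 < c y x \<Longrightarrow> \<sigma> y x = 1 \<Longrightarrow> F (\<tau> y x) + c y x \<le> F x"
    and \<tau>_invol: "\<And>x y. y \<in> Y \<Longrightarrow> \<tau> y (\<tau> y x) = x"
    and K: "0 < K" and v: "0 < v"
  shows "measure M {x \<in> space M. x \<in> G \<and> \<bar>F x\<bar> \<le> K \<and> v\<^sup>2 \<le> (\<Sum>y\<in>Y. (c y x)\<^sup>2)} \<le> 4 * K / v"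
proof -
  define V where "V x = (\<Sum>y\<in>Y. (c y x)\<^sup>2)" for x
  define G' where "G' = {x \<in> space M. x \<in> G \<and> v\<^sup>2 \<le> V x}"
  define W where "W = {x \<in> space M. x \<in> G \<and> \<bar>F x\<bar> \<le> K \<and> v\<^sup>2 \<le> V x}"
  \<comment> \<open>Truncation at \<open>2 * K\<close> rather than \<open>K\<close>: a step of size
    at most \<open>K\<close> from a point of \<open>[-K, K]\<close> stays in the linear
    range.\<close>
  define \<phi> where "\<phi> u = max (-1) (min 1 (u / (2 * K)))" for u :: real
  define h where "h x = \<phi> (F x)" for x
  \<comment> \<open>\<open>V\<close> is invariant under all exchanges, so dividing by
    \<open>sqrt (V x)\<close> keeps \<open>g y\<close> odd under \<open>\<tau> y\<close> and even
    under the other exchanges.\<close>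
  define g where "g y x = indicator G' x * (c y x * \<sigma> y x / sqrt (V x))" for y x
  have [measurable]: "V \<in> borel_measurable M" unfolding V_def by measurable
  have [measurable]: "h \<in> borel_measurable M" unfolding h_def \<phi>_def by measurable
  have [measurable]: "G' \<in> sets M" "W \<in> sets M" unfolding G'_def W_def by measurable
  have [measurable]: "g y \<in> borel_measurable M" for y unfolding g_def by measurable
  have \<tau>_space: "\<tau> y x \<in> space M" if "y \<in> Y" "x \<in> space M" for y x
    using measurable_space[OF \<tau>_meas[OF that(1)] that(2)] .
  have V_inv: "V (\<tau> y x) = V x" if "y \<in> Y" for y x
    unfolding V_def using c_inv[OF _ that] by (intro sum.cong) auto
  have G'_inv: "\<tau> y x \<in> G' \<longleftrightarrow> x \<in> G'" if "y \<in> Y" "x \<in> space M" for y x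
    using \<tau>_G[OF that] \<tau>_space[OF that] that V_inv[OF that(1)] by (simp add: G'_def)
  have g_inv: "g y (\<tau> y' x) = (if y = y' then - g y x else g y x)" if "y \<in> Y" "y' \<in> Y" "x \<in> space M" for y y' x
    using that by (simp add: g_def G'_inv c_inv \<sigma>_inv V_inv indicator_def)
  have h1: "\<bar>h x\<bar> \<le> 1" for x by (auto simp: h_def \<phi>_def)
  have V_pos: "0 < V x" if "x \<in> G'" for x
  proof -
    have "v\<^sup>2 \<le> V x" using that by (simp add: G'_def)
    then show ?thesis using zero_less_power[OF v, of 2] by linarith
  qed
  have c_le: "(c y x)\<^sup>2 \<le> V x" if "y \<in> Y" for y x
    unfolding V_def by (intro member_le_sum) (use that Y in auto)
  have g_le: "\<bar>g y x\<bar> \<le> 1" if "y \<in> Y" for y x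
  proof (cases "x \<in> G'")
    case True
    have "\<bar>c y x\<bar> \<le> sqrt (V x)" using c_le[OF that, of x] by (intro real_le_rsqrt) simp
    then have "\<bar>c y x\<bar> * \<bar>\<sigma> y x\<bar> \<le> sqrt (V x) * 1" using \<sigma>_le V_pos[OF True] by (intro mult_mono) auto
    then show ?thesis using True V_pos[OF True] by (simp add: g_def abs_mult divide_le_eq)
  qed (simp add: g_def)
  have integrable_bdd: "integrable M f" if "f \<in> borel_measurable M" "\<And>x. \<bar>f x\<bar> \<le> B" for f :: "'a \<Rightarrow> real" and B
    by (rule integrable_const_bound[of _ B]) (use that in auto)
  have change: "(\<integral>x. f (\<tau> y x) \<partial>M) = (\<integral>x. f x \<partial>M)" if "y \<in> Y" "f \<in> borel_measurable M" for f :: "'a \<Rightarrow> real" and y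
    using integral_distr[OF \<tau>_meas[OF that(1)] that(2)] \<tau>_distr[OF that(1)] by simp
  have gg_le: "\<bar>g y x * g y' x\<bar> \<le> 1" if "y \<in> Y" "y' \<in> Y" for y y' x
    using mult_mono[OF g_le[OF that(1)] g_le[OF that(2)], of x x] by (simp add: abs_mult)
  have gg_le': "g y x * g y x \<le> 1" if "y \<in> Y" for y x
    using gg_le[OF that that, of x] by (rule order_trans[OF abs_ge_self])
  \<comment> \<open>\<open>\<tau> y\<close> preserves the measure and changes the sign of
    \<open>g y\<close> only. This symmetry plays the part of independent signs.\<close>
  have ortho: "(\<integral>x. g y x * g y' x \<partial>M) = 0" if "y \<in> Y" "y' \<in> Y" "y \<noteq> y'" for y y'
  proof -
    have "(\<integral>x. g y x * g y' x \<partial>M) = (\<integral>x. g y (\<tau> y x) * g y' (\<tau> y x) \<partial>M)"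
      by (rule change[OF that(1), symmetric]) measurable
    also have "\<dots> = (\<integral>x. - (g y x * g y' x) \<partial>M)"
      using that by (intro Bochner_Integration.integral_cong refl) (simp add: g_inv)
    finally show ?thesis by simp
  qed
  have sum_sq: "(\<integral>x. (\<Sum>y\<in>Y. g y x)\<^sup>2 \<partial>M) \<le> 1"
  proof -
    have "(\<integral>x. (\<Sum>y\<in>Y. g y x)\<^sup>2 \<partial>M) = (\<integral>x. (\<Sum>y\<in>Y. \<Sum>y'\<in>Y. g y x * g y' x) \<partial>M)"
      by (simp add: power2_eq_square sum_product)
    also have "\<dots> = (\<Sum>y\<in>Y. \<Sum>y'\<in>Y. \<integral>x. g y x * g y' x \<partial>M)"
      using gg_le by (subst Bochner_Integration.integral_sum; (intro Bochner_Integration.integrable_sum sum.cong refl Bochner_Integration.integral_sum integrable_bdd[of _ 1])?) auto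
    also have "\<dots> = (\<Sum>y\<in>Y. \<integral>x. g y x * g y x \<partial>M)"
    proof (intro sum.cong refl)
      fix y assume y: "y \<in> Y"
      have "(\<Sum>y'\<in>Y. \<integral>x. g y x * g y' x \<partial>M) = (\<Sum>y'\<in>{y}. \<integral>x. g y x * g y' x \<partial>M)"
        using Y y ortho[OF y] by (intro sum.mono_neutral_right) auto
      then show "(\<Sum>y'\<in>Y. \<integral>x. g y x * g y' x \<partial>M) = (\<integral>x. g y x * g y x \<partial>M)" by simp
    qed
    also have "\<dots> = (\<integral>x. (\<Sum>y\<in>Y. g y x * g y x) \<partial>M)"
      using gg_le' by (intro Bochner_Integration.integral_sum[symmetric] integrable_bdd[of _ 1]) auto
    also have "\<dots> \<le> (\<integral>x. 1 \<partial>M)"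
    proof (intro integral_mono)
      show "integrable M (\<lambda>x. \<Sum>y\<in>Y. g y x * g y x)"
        using gg_le' by (intro Bochner_Integration.integrable_sum integrable_bdd[of _ 1]) auto
      fix x assume "x \<in> space M"
      show "(\<Sum>y\<in>Y. g y x * g y x) \<le> 1"
      proof (cases "x \<in> G'")
        case True
        have "(\<Sum>y\<in>Y. g y x * g y x) \<le> (\<Sum>y\<in>Y. (c y x)\<^sup>2 / V x)"
        proof (intro sum_mono)
          fix y assume "y \<in> Y"
          have "(\<sigma> y x)\<^sup>2 \<le> 1" using \<sigma>_le[of y x] by (simp add: abs_square_le_1)
          then have "(c y x)\<^sup>2 * (\<sigma> y x)\<^sup>2 \<le> (c y x)\<^sup>2 * 1" by (intro mult_left_mono) auto
          then show "g y x * g y x \<le> (c y x)\<^sup>2 / V x"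
            using True V_pos[OF True] by (simp add: g_def power2_eq_square divide_right_mono mult_ac)
        qed
        also have "\<dots> = V x / V x" by (simp add: sum_divide_distrib[symmetric] V_def)
        finally show ?thesis using V_pos[OF True] by simp
      qed (simp add: g_def)
    qed simp
    finally show ?thesis by (simp add: prob_space)
  qed
  have card_le: "\<bar>\<Sum>y\<in>Y. g y x\<bar> \<le> card Y" for x
  proof -
    have "\<bar>\<Sum>y\<in>Y. g y x\<bar> \<le> (\<Sum>y\<in>Y. \<bar>g y x\<bar>)" by (rule sum_abs)
    also have "\<dots> \<le> (\<Sum>y\<in>Y. 1)" by (intro sum_mono g_le)
    finally show ?thesis by simp
  qed
  have int_sq: "integrable M (\<lambda>x. (\<Sum>y\<in>Y. g y x)\<^sup>2)"
  proof (rule integrable_bdd[of _ "(real (card Y))\<^sup>2"])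
    show "\<bar>(\<Sum>y\<in>Y. g y x)\<^sup>2\<bar> \<le> (real (card Y))\<^sup>2" for x
      using power_mono[OF card_le[of x] abs_ge_zero, of 2] by simp
  qed measurable
  have upper: "(\<integral>x. h x * (\<Sum>y\<in>Y. g y x) \<partial>M) \<le> 1"
  proof -
    have "(\<integral>x. h x * (\<Sum>y\<in>Y. g y x) \<partial>M) \<le> (\<integral>x. (1 + (\<Sum>y\<in>Y. g y x)\<^sup>2) / 2 \<partial>M)"
    proof (intro integral_mono)
      show "integrable M (\<lambda>x. h x * (\<Sum>y\<in>Y. g y x))"
      proof (rule integrable_bdd[of _ "real (card Y)"])
        show "\<bar>h x * (\<Sum>y\<in>Y. g y x)\<bar> \<le> real (card Y)" for x
          using mult_mono[OF h1[of x] card_le[of x]] by (simp add: abs_mult)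
      qed measurable
      show "integrable M (\<lambda>x. (1 + (\<Sum>y\<in>Y. g y x)\<^sup>2) / 2)" using int_sq by simp
      fix x
      let ?s = "\<Sum>y\<in>Y. g y x"
      have "h x * ?s \<le> \<bar>h x\<bar> * \<bar>?s\<bar>" by (metis abs_ge_self abs_mult)
      also have "\<dots> \<le> 1 * \<bar>?s\<bar>" by (intro mult_right_mono h1) auto
      also have "1 * \<bar>?s\<bar> \<le> (1 + ?s\<^sup>2) / 2"
        using sum_squares_bound[of 1 "\<bar>?s\<bar>"] by simp
      finally show "h x * ?s \<le> (1 + ?s\<^sup>2) / 2" .
    qed
    also have "\<dots> = (1 + (\<integral>x. (\<Sum>y\<in>Y. g y x)\<^sup>2 \<partial>M)) / 2"
      using int_sq by (simp add: prob_space)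
    finally show ?thesis using sum_sq by simp
  qed
  have hg_le: "\<bar>h x * g y x\<bar> \<le> 1" if "y \<in> Y" for x y
    using mult_mono[OF h1[of x] g_le[OF that, of x]] by (simp add: abs_mult)
  have hg_le': "\<bar>h (\<tau> y x) * g y x\<bar> \<le> 1" if "y \<in> Y" for x y
    using mult_mono[OF h1[of "\<tau> y x"] g_le[OF that, of x]] by (simp add: abs_mult)
  have \<phi>_mono: "\<phi> u \<le> \<phi> w" if "u \<le> w" for u w
    unfolding \<phi>_def by (intro max.mono min.mono order.refl divide_right_mono) (use that K in auto)
  have \<phi>_gain: "\<phi> u + k / (2 * K) \<le> \<phi> w" if "u + k \<le> w" "0 \<le> k" "k \<le> K" "\<bar>u\<bar> \<le> K \<or> \<bar>w\<bar> \<le> K" for u w k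
  proof (cases "\<bar>u\<bar> \<le> K")
    case True
    have "\<phi> (u + k) = u / (2 * K) + k / (2 * K)"
      using True that K by (simp add: \<phi>_def add_divide_distrib[symmetric] field_simps)
    moreover have "\<phi> u = u / (2 * K)" using True K by (simp add: \<phi>_def field_simps)
    ultimately show ?thesis using \<phi>_mono[OF that(1)] by simp
  next
    case False
    then have w: "\<bar>w\<bar> \<le> K" using that by simp
    have "\<phi> (w - k) = w / (2 * K) - k / (2 * K)"
      using w that K by (simp add: \<phi>_def diff_divide_distrib[symmetric] field_simps)
    moreover have "\<phi> w = w / (2 * K)" using w K by (simp add: \<phi>_def field_simps)
    moreover have "\<phi> u \<le> \<phi> (w - k)" using that by (intro \<phi>_mono) simp
    ultimately show ?thesis by simp
  qed
  \<comment> \<open>The increment of \<open>h\<close> across the exchange has the sign of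
    \<open>\<sigma> y x\<close> for either orientation, and on \<open>W\<close> its size is at least
    \<open>c y x / (2 * K)\<close>.\<close>
  have pw: "indicator W x * ((c y x)\<^sup>2 / (2 * K * sqrt (V x))) \<le> g y x * (h x - h (\<tau> y x))"
    if y: "y \<in> Y" and x: "x \<in> space M" for x y
  proof (cases "x \<in> G' \<and> 0 < c y x")
    case False
    then have "g y x = 0" "indicator W x * (c y x)\<^sup>2 = 0"
      using c_bound[OF y, of x] by (auto simp: g_def G'_def W_def indicator_def)
    then show ?thesis by auto
  next
    case True
    then have xG: "x \<in> G" and c0: "0 < c y x" and V0: "0 < V x" using V_pos by (auto simp: G'_def)
    have ck: "c y x \<le> K" using c_bound[OF y xG] by simp
    have WF: "\<bar>F x\<bar> \<le> K" if "x \<in> W" using that by (simp add: W_def)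
    have key: "indicator W x * (c y x / (2 * K)) \<le> \<sigma> y x * (h x - h (\<tau> y x))"
      using \<sigma>_cases[OF y xG c0]
    proof
      assume s: "\<sigma> y x = 1"
      have "F (\<tau> y x) + c y x \<le> F x" by (rule gain[OF y xG c0 s])
      then show ?thesis
        using \<phi>_gain[of "F (\<tau> y x)" "c y x" "F x"] \<phi>_mono[of "F (\<tau> y x)" "F x"] c0 ck WF
        by (auto simp: s h_def indicator_def)
    next
      assume s: "\<sigma> y x = -1"
      have G2: "\<tau> y x \<in> G" using \<tau>_G[OF y x] xG by simp
      have "F (\<tau> y (\<tau> y x)) + c y (\<tau> y x) \<le> F (\<tau> y x)"
        by (rule gain[OF y G2]) (use c_inv[OF y y] \<sigma>_inv[OF y y] c0 s in auto)
      then have "F x + c y x \<le> F (\<tau> y x)" by (simp add: \<tau>_invol[OF y] c_inv[OF y y])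
      then show ?thesis
        using \<phi>_gain[of "F x" "c y x" "F (\<tau> y x)"] \<phi>_mono[of "F x" "F (\<tau> y x)"] c0 ck WF
        by (auto simp: s h_def indicator_def)
    qed
    have "(indicator W x * (c y x / (2 * K))) * (c y x / sqrt (V x)) \<le> (\<sigma> y x * (h x - h (\<tau> y x))) * (c y x / sqrt (V x))"
      using key c0 V0 by (intro mult_right_mono) auto
    then show ?thesis using True by (simp add: g_def power2_eq_square mult_ac)
  qed
  \<comment> \<open>Averaging over \<open>x\<close> and \<open>\<tau> y x\<close> turns the
    correlation of \<open>h\<close> with \<open>g y\<close> into half the mean of \<open>g y\<close>
    times the increment of \<open>h\<close>; this is the 4 in place of the 2.\<close>
  have lower_y: "(\<integral>x. indicator W x * ((c y x)\<^sup>2 / (4 * K * sqrt (V x))) \<partial>M) \<le> (\<integral>x. h x * g y x \<partial>M)"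
    if y: "y \<in> Y" for y
  proof -
    have i1: "integrable M (\<lambda>x. h x * g y x)"
      by (rule integrable_bdd[OF _ hg_le[OF y]]) measurable
    have [measurable]: "(\<lambda>x. h (\<tau> y x)) \<in> borel_measurable M"
      by (rule measurable_compose[OF \<tau>_meas[OF y]]) measurable
    have i2: "integrable M (\<lambda>x. h (\<tau> y x) * g y x)"
      by (rule integrable_bdd[OF _ hg_le'[OF y]]) measurable
    have "(\<integral>x. h x * g y x \<partial>M) = (\<integral>x. h (\<tau> y x) * g y (\<tau> y x) \<partial>M)"
      by (rule change[OF y, symmetric]) measurable
    also have "\<dots> = (\<integral>x. - (h (\<tau> y x) * g y x) \<partial>M)"
      using y by (intro Bochner_Integration.integral_cong refl) (simp add: g_inv)
    finally have "2 * (\<integral>x. h x * g y x \<partial>M) = (\<integral>x. h x * g y x \<partial>M) - (\<integral>x. h (\<tau> y x) * g y x \<partial>M)" by simp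
    also have "\<dots> = (\<integral>x. g y x * (h x - h (\<tau> y x)) \<partial>M)"
      using i1 i2 by (subst Bochner_Integration.integral_diff[symmetric]) (auto simp: algebra_simps)
    finally have e: "2 * (\<integral>x. h x * g y x \<partial>M) = (\<integral>x. g y x * (h x - h (\<tau> y x)) \<partial>M)" .
    have "(\<integral>x. indicator W x * ((c y x)\<^sup>2 / (2 * K * sqrt (V x))) \<partial>M) \<le> (\<integral>x. g y x * (h x - h (\<tau> y x)) \<partial>M)"
    proof (intro integral_mono_AE')
      show "integrable M (\<lambda>x. g y x * (h x - h (\<tau> y x)))"
        using Bochner_Integration.integrable_diff[OF i1 i2] by (simp add: algebra_simps)
      show "AE x in M. indicator W x * ((c y x)\<^sup>2 / (2 * K * sqrt (V x))) \<le> g y x * (h x - h (\<tau> y x))"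
        using pw[OF y] by (intro AE_I2)
      show "AE x in M. 0 \<le> g y x * (h x - h (\<tau> y x))"
      proof (intro AE_I2)
        fix x assume x: "x \<in> space M"
        have "0 \<le> V x" by (auto simp: V_def intro: sum_nonneg)
        then have "0 \<le> indicator W x * ((c y x)\<^sup>2 / (2 * K * sqrt (V x)))" using K by simp
        then show "0 \<le> g y x * (h x - h (\<tau> y x))" using pw[OF y x] by (rule order_trans)
      qed
    qed
    then have le: "(\<integral>x. indicator W x * ((c y x)\<^sup>2 / (2 * K * sqrt (V x))) \<partial>M) / 2 \<le> (\<integral>x. h x * g y x \<partial>M)" using e by simp
    have "(\<integral>x. indicator W x * ((c y x)\<^sup>2 / (4 * K * sqrt (V x))) \<partial>M)
        = (\<integral>x. indicator W x * ((c y x)\<^sup>2 / (2 * K * sqrt (V x))) / 2 \<partial>M)"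
      by (intro Bochner_Integration.integral_cong refl) simp
    also have "\<dots> = (\<integral>x. indicator W x * ((c y x)\<^sup>2 / (2 * K * sqrt (V x))) \<partial>M) / 2"
      by (rule integral_divide_zero)
    finally show ?thesis using le by simp
  qed
  have sq_le: "\<bar>indicator W x * ((c y x)\<^sup>2 / (4 * K * sqrt (V x)))\<bar> \<le> 1" if y: "y \<in> Y" for x y
  proof (cases "x \<in> W")
    case True
    then have xG': "x \<in> G'" and xG: "x \<in> G" by (auto simp: W_def G'_def)
    have c0: "0 \<le> c y x" "c y x \<le> K" using c_bound[OF y xG] by auto
    have "c y x \<le> sqrt (V x)" using c_le[OF y, of x] by (intro real_le_rsqrt)
    then have "c y x * c y x \<le> K * sqrt (V x)" using c0 K by (intro mult_mono) auto
    moreover have "0 < K * sqrt (V x)" using K V_pos[OF xG'] by simp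
    ultimately have "0 \<le> (c y x)\<^sup>2 / (4 * K * sqrt (V x))" "(c y x)\<^sup>2 / (4 * K * sqrt (V x)) \<le> 1"
      by (auto simp: power2_eq_square divide_le_eq_1)
    then show ?thesis using True by simp
  qed simp
  have "v / (4 * K) * measure M W = (\<integral>x. indicator W x * (v / (4 * K)) \<partial>M)"
    by simp
  also have "\<dots> \<le> (\<integral>x. (\<Sum>y\<in>Y. indicator W x * ((c y x)\<^sup>2 / (4 * K * sqrt (V x)))) \<partial>M)"
  proof (intro integral_mono)
    show "integrable M (\<lambda>x. \<Sum>y\<in>Y. indicator W x * ((c y x)\<^sup>2 / (4 * K * sqrt (V x))))"
      by (intro Bochner_Integration.integrable_sum integrable_bdd[OF _ sq_le]) measurable
    show "integrable M (\<lambda>x. indicator W x * (v / (4 * K)))" by (simp add: emeasure_eq_measure)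
    fix x
    show "indicator W x * (v / (4 * K)) \<le> (\<Sum>y\<in>Y. indicator W x * ((c y x)\<^sup>2 / (4 * K * sqrt (V x))))"
    proof (cases "x \<in> W")
      case True
      then have V: "v\<^sup>2 \<le> V x" "0 < V x" using V_pos[of x] by (auto simp: W_def G'_def)
      have "(\<Sum>y\<in>Y. indicator W x * ((c y x)\<^sup>2 / (4 * K * sqrt (V x)))) = V x / (4 * K * sqrt (V x))"
        using True by (simp add: sum_divide_distrib[symmetric] V_def)
      also have "\<dots> = sqrt (V x) / (4 * K)"
        using V K by (simp add: field_simps)
      finally have e: "(\<Sum>y\<in>Y. indicator W x * ((c y x)\<^sup>2 / (4 * K * sqrt (V x)))) = sqrt (V x) / (4 * K)" .
      have "v / (4 * K) \<le> sqrt (V x) / (4 * K)"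
        using V K by (intro divide_right_mono real_le_rsqrt) auto
      then show ?thesis using True unfolding e by simp
    qed simp
  qed
  also have "\<dots> = (\<Sum>y\<in>Y. \<integral>x. indicator W x * ((c y x)\<^sup>2 / (4 * K * sqrt (V x))) \<partial>M)"
    by (intro Bochner_Integration.integral_sum integrable_bdd[OF _ sq_le]) measurable
  also have "\<dots> \<le> (\<Sum>y\<in>Y. \<integral>x. h x * g y x \<partial>M)"
    by (intro sum_mono lower_y)
  also have "\<dots> = (\<integral>x. h x * (\<Sum>y\<in>Y. g y x) \<partial>M)"
    unfolding sum_distrib_left
    by (intro Bochner_Integration.integral_sum[symmetric] integrable_bdd[OF _ hg_le]) measurable
  also have "\<dots> \<le> 1" by (rule upper)
  finally have "measure M W \<le> 4 * K / v" using K v by (simp add: field_simps)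
  then show ?thesis by (simp add: W_def V_def)
qed

section \<open>The duplicated environment\<close>

definition site_swap :: "nat \<Rightarrow> int + nat \<Rightarrow> int + nat" where
  "site_swap y i = (case i of
     Inl z \<Rightarrow> Inl (if z = int y then - int y else if z = - int y then int y else z) | Inr n \<Rightarrow> Inr n)"

lemma site_swap_simps [simp]:
  "site_swap y (Inl z) = Inl (if z = int y then - int y else if z = - int y then int y else z)"
  "site_swap y (Inr n) = Inr n"
  by (simp_all add: site_swap_def)

lemma site_swap_invol [simp]: "site_swap y (site_swap y i) = i"
  by (cases i) auto

text \<open>The environment is a point of \<open>int + nat \<Rightarrow> real\<close>: \<open>Inl\<close> coordinates carry \<open>\<xi>\<^sub>0\<close>, and
  the \<open>Inr n\<close> coordinate is 1 or 0 according to whether \<open>\<xi>(-n)\<close> duplicates \<open>\<xi>(n)\<close>.\<close>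

abbreviation env_space :: "(int + nat \<Rightarrow> real) measure" where
  "env_space \<equiv> (\<Pi>\<^sub>M i\<in>UNIV. borel)"

definition env_potential :: "(int + nat \<Rightarrow> real) \<Rightarrow> int \<Rightarrow> real" where
  "env_potential x = potential (\<lambda>z. x (Inl z)) (\<lambda>n. x (Inr n) = 1)"

text \<open>With the coin on, \<open>\<xi>(y)\<close> and \<open>\<xi>(-y)\<close> both read the
  coordinate \<open>Inl (int y)\<close>, and permuting coordinates would change the potential; such
  points are left alone.\<close>

definition env_swap :: "nat \<Rightarrow> (int + nat \<Rightarrow> real) \<Rightarrow> int + nat \<Rightarrow> real" where
  "env_swap y x = (if x (Inr y) = 1 then x else (\<lambda>i. x (site_swap y i)))"

lemma env_potential_swap:
  assumes "0 < y"
  shows "env_potential (env_swap y x) = swap_sites (env_potential x) y"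
  using assms
  by (auto simp: env_potential_def env_swap_def potential_def swap_sites_def fun_eq_iff)

lemma env_swap_swap [simp]: "env_swap y (env_swap y x) = x"
  by (auto simp: env_swap_def)

lemma measurable_env_potential [measurable (raw)]:
  assumes f [measurable]: "f \<in> measurable N env_space"
  shows "(\<lambda>q. env_potential (f q) w) \<in> borel_measurable N"
  unfolding env_potential_def potential_def by measurable

lemma measurable_env_potential' [measurable]: "(\<lambda>x. env_potential x w) \<in> borel_measurable env_space"
  by (rule measurable_env_potential) simp

lemma measurable_env_fun:
  assumes "\<And>i. (\<lambda>x. f x i) \<in> borel_measurable N"
  shows "f \<in> measurable N env_space"
proof -
  have "(\<lambda>x. \<lambda>i\<in>UNIV. f x i) \<in> measurable N env_space"
    by (rule measurable_restrict) (rule assms)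
  then show ?thesis by (simp add: restrict_def)
qed

lemma measurable_env_swap [measurable]: "env_swap y \<in> measurable env_space env_space"
proof (rule measurable_env_fun)
  fix i
  have "(\<lambda>x. if x (Inr y) = 1 then x i else x (site_swap y i)) \<in> borel_measurable env_space"
    by measurable
  then show "(\<lambda>x. env_swap y x i) \<in> borel_measurable env_space"
    by (simp add: env_swap_def if_distribR)
qed

locale duplicated_env = prob_space M for M :: "'a measure" +
  fixes \<alpha> :: real and p :: "nat \<Rightarrow> real"
    and xi0 :: "'a \<Rightarrow> int \<Rightarrow> real" and coin :: "'a \<Rightarrow> nat \<Rightarrow> bool"
  assumes \<alpha>: "\<alpha> \<ge> 2"
    and p01: "\<And>n. 0 \<le> p n \<and> p n \<le> 1"
    and xi0_meas [measurable]: "\<And>z. (\<lambda>\<omega>. xi0 \<omega> z) \<in> borel_measurable M"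
    and coin_meas [measurable]: "\<And>n. (\<lambda>\<omega>. coin \<omega> n) \<in> measurable M (count_space UNIV)"
    and indep: "indep_vars (\<lambda>_. borel)
           (\<lambda>i \<omega>. case i of Inl z \<Rightarrow> xi0 \<omega> z | Inr n \<Rightarrow> of_bool (coin \<omega> n))
           (UNIV :: (int + nat) set)"
    and tail: "\<And>z x. x \<ge> 1 \<Longrightarrow> measure M {\<omega> \<in> space M. xi0 \<omega> z > x} = x powr (- \<alpha>)"
    and coin_prob: "\<And>n. measure M {\<omega> \<in> space M. coin \<omega> n} = p n"
begin

definition X :: "'a \<Rightarrow> int + nat \<Rightarrow> real" where
  "X \<omega> i = (case i of Inl z \<Rightarrow> xi0 \<omega> z | Inr n \<Rightarrow> of_bool (coin \<omega> n))"

lemma X_simps [simp]: "X \<omega> (Inl z) = xi0 \<omega> z" "X \<omega> (Inr n) = of_bool (coin \<omega> n)"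
  by (auto simp: X_def)

lemma env_potential_X: "env_potential (X \<omega>) = potential (xi0 \<omega>) (coin \<omega>)"
  by (simp add: env_potential_def)

lemma X_component_meas: "(\<lambda>\<omega>. X \<omega> i) \<in> borel_measurable M"
  by (cases i) (simp_all, measurable)

lemma X_meas [measurable]: "X \<in> measurable M env_space"
  by (rule measurable_env_fun) (rule X_component_meas)

text \<open>The exchanges act on the space of environments and not on \<open>M\<close>, so the
  argument is carried out under the law of \<open>X\<close>.\<close>

definition Q :: "(int + nat \<Rightarrow> real) measure" where
  "Q = distr M env_space X"

lemma sets_Q [measurable_cong, simp]: "sets Q = sets env_space"
  by (simp add: Q_def)

lemma space_Q [simp]: "space Q = UNIV"
  by (simp add: Q_def space_PiM)

lemma prob_space_Q: "prob_space Q"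
  unfolding Q_def by (rule prob_space_distr) measurable

lemma Q_eq: "Q = (\<Pi>\<^sub>M i\<in>UNIV. distr M borel (\<lambda>\<omega>. X \<omega> i))"
proof -
  have "distr M (\<Pi>\<^sub>M i\<in>UNIV. borel) (\<lambda>\<omega>. \<lambda>i\<in>UNIV. X \<omega> i) = (\<Pi>\<^sub>M i\<in>UNIV. distr M borel (\<lambda>\<omega>. X \<omega> i))"
    using indep by (subst indep_vars_iff_distr_eq_PiM[symmetric]) (auto simp: X_def[abs_def] intro: X_component_meas[unfolded X_def])
  then show ?thesis by (simp add: Q_def restrict_def)
qed

lemma AE_xi0_gt_1: "AE \<omega> in M. xi0 \<omega> z > 1"
proof -
  have "measure M {\<omega> \<in> space M. xi0 \<omega> z > 1} = 1" using tail[of 1 z] by simp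
  then show ?thesis by (subst prob_Collect_eq_1[symmetric]) auto
qed

lemma xi0_tail_max: "measure M {\<omega> \<in> space M. xi0 \<omega> z > x} = max 1 x powr (- \<alpha>)"
proof (cases "1 \<le> x")
  case False
  have "AE \<omega> in M. xi0 \<omega> z > x" using AE_xi0_gt_1[of z] False by (auto elim: eventually_mono)
  then have "measure M {\<omega> \<in> space M. xi0 \<omega> z > x} = 1" by (subst prob_Collect_eq_1) auto
  then show ?thesis using False by simp
qed (simp add: tail)

lemma cdf_xi0: "cdf (distr M borel (\<lambda>\<omega>. xi0 \<omega> z)) x = 1 - max 1 x powr (- \<alpha>)"
proof -
  have "cdf (distr M borel (\<lambda>\<omega>. xi0 \<omega> z)) x = measure M {\<omega> \<in> space M. \<not> xi0 \<omega> z > x}"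
    by (simp add: cdf_def measure_distr vimage_def Int_def not_less conj_commute)
  also have "\<dots> = 1 - measure M {\<omega> \<in> space M. xi0 \<omega> z > x}"
    by (rule prob_neg) measurable
  finally show ?thesis by (simp add: xi0_tail_max)
qed

lemma real_distribution_xi0: "real_distribution (distr M borel (\<lambda>\<omega>. xi0 \<omega> z))"
  by (rule real_distribution_distr) measurable

lemma distr_xi0_eq: "distr M borel (\<lambda>\<omega>. xi0 \<omega> z) = distr M borel (\<lambda>\<omega>. xi0 \<omega> z')"
  by (rule cdf_unique) (auto simp: real_distribution_xi0 cdf_xi0)

text \<open>The coordinates are independent, the permutation fixes the coins, and all values of
  \<open>xi0\<close> share one law.\<close>

lemma distr_site_swap: "distr Q Q (\<lambda>x i. x (site_swap y i)) = Q"
proof -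
  let ?D = "\<lambda>i. distr M borel (\<lambda>\<omega>. X \<omega> i)"
  have D: "?D (site_swap y i) = ?D i" for i
    by (cases i) (auto simp: intro: distr_xi0_eq)
  have ps: "prob_space (?D i)" for i by (rule prob_space_distr) (rule X_component_meas)
  have "distr (PiM UNIV ?D) (\<Pi>\<^sub>M i\<in>UNIV. ?D (site_swap y i)) (\<lambda>\<omega>. \<lambda>n\<in>UNIV. \<omega> (site_swap y n)) = (\<Pi>\<^sub>M i\<in>UNIV. ?D (site_swap y i))"
    by (rule distr_PiM_reindex[OF ps]) (auto intro: inj_on_inverseI[where g = "site_swap y"])
  then show ?thesis unfolding D Q_eq[symmetric] by (simp add: restrict_def)
qed

text \<open>Split by the coin at \<open>y\<close>, a coordinate that the permutation fixes. On one
  part the map is the identity, on the other the permutation, and both preserve the law.\<close>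

lemma distr_env_swap: "distr Q Q (env_swap y) = Q"
proof (rule measure_eqI)
  fix A assume "A \<in> sets (distr Q Q (env_swap y))"
  then have A [measurable]: "A \<in> sets env_space" by simp
  let ?s = "\<lambda>x i. x (site_swap y i)" and ?C = "{x \<in> space env_space. x (Inr y) = 1}"
  have C [measurable]: "?C \<in> sets env_space" by measurable
  have spU: "space env_space = UNIV" by (simp add: space_PiM)
  have s: "?s \<in> measurable Q Q"
    by (simp cong: measurable_cong_sets, rule measurable_env_fun) measurable
  have es: "env_swap y \<in> measurable Q Q" by (simp cong: measurable_cong_sets)
  have "emeasure (distr Q Q (env_swap y)) A = emeasure Q (env_swap y -` A)"
    using es by (subst emeasure_distr) auto
  also have "env_swap y -` A = (A \<inter> ?C) \<union> (?s -` (A - ?C))"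
    by (auto simp: env_swap_def spU split: if_splits)
  also have "emeasure Q \<dots> = emeasure Q (A \<inter> ?C) + emeasure Q (?s -` (A - ?C))"
  proof (rule plus_emeasure[symmetric])
    show "?s -` (A - ?C) \<in> sets Q" using measurable_sets[OF s, of "A - ?C"] by simp
    show "A \<inter> ?C \<inter> ?s -` (A - ?C) = {}" by (auto simp: spU)
  qed simp
  also have "emeasure Q (?s -` (A - ?C)) = emeasure (distr Q Q ?s) (A - ?C)"
    using s by (subst emeasure_distr) auto
  also have "\<dots> = emeasure Q (A - ?C)" by (simp only: distr_site_swap)
  also have "emeasure Q (A \<inter> ?C) + emeasure Q (A - ?C) = emeasure Q ((A \<inter> ?C) \<union> (A - ?C))"
    by (rule plus_emeasure) auto
  also have "(A \<inter> ?C) \<union> (A - ?C) = A" by auto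
  finally show "emeasure (distr Q Q (env_swap y)) A = emeasure Q A" .
qed simp

end

section \<open>Measurability of the solution as a function of the environment\<close>

lemma measurable_path_int_param:
  assumes xi: "\<And>w. (\<lambda>x. xi x w) \<in> borel_measurable N"
  shows "(\<lambda>q. path_int (map (xi (snd q)) ws) (fst q)) \<in> borel_measurable (borel \<Otimes>\<^sub>M N)"
proof (induction ws rule: induct_list012)
  case 1
  show ?case by simp
next
  case (2 w)
  have [measurable]: "(\<lambda>q. xi (snd q) w) \<in> borel_measurable (borel \<Otimes>\<^sub>M N)"
    by (rule measurable_compose[OF measurable_snd xi])
  have "(\<lambda>q. ennreal (exp (xi (snd q) w * fst q)) * indicator {0..} (fst q)) \<in> borel_measurable (borel \<Otimes>\<^sub>M N)"
    by measurable
  then show ?case by (simp add: exp_kernel_def)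
next
  case (3 w v vs)
  let ?N = "(borel \<Otimes>\<^sub>M N) \<Otimes>\<^sub>M (lborel :: real measure)"
  have [measurable]: "(\<lambda>q. xi (snd (fst q)) w) \<in> borel_measurable ?N"
    by (rule measurable_compose[OF _ xi]) measurable
  have "(\<lambda>q. (fst (fst q) - snd q, snd (fst q))) \<in> measurable ?N (borel \<Otimes>\<^sub>M N)"
    by measurable
  from measurable_compose[OF this "3.IH"(2)]
  have [measurable]: "(\<lambda>q. path_int (map (xi (snd (fst q))) (v # vs)) (fst (fst q) - snd q)) \<in> borel_measurable ?N"
    by simp
  have "(\<lambda>q. \<integral>\<^sup>+r. (ennreal (exp (xi (snd q) w * r)) * indicator {0..} r) * path_int (map (xi (snd q)) (v # vs)) (fst q - r) \<partial>lborel)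
    \<in> borel_measurable (borel \<Otimes>\<^sub>M N)"
    by measurable
  then show ?case by (simp add: conv_def exp_kernel_def)
qed

lemma measurable_pam_u:
  assumes xi: "\<And>w. (\<lambda>x. xi x w) \<in> borel_measurable N" and "0 \<le> t"
  shows "(\<lambda>x. pam_u (xi x) t z) \<in> borel_measurable N"
proof -
  have 1: "(\<lambda>x. path_int (map (xi x) ws) t) \<in> borel_measurable N" for ws
  proof -
    have "(\<lambda>x. (t, x)) \<in> measurable N (borel \<Otimes>\<^sub>M N)" by measurable
    from measurable_compose[OF this measurable_path_int_param[OF xi]] show ?thesis by simp
  qed
  have [measurable]: "(\<lambda>x. path_sum (xi x) z n 0 t) \<in> borel_measurable N" for n
    unfolding path_sum_def
  proof (rule borel_measurable_sum)
    fix js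
    show "(\<lambda>x. if 0 + sum_list js = z then path_int (map (xi x) (0 # psites 0 js)) t else 0) \<in> borel_measurable N"
      using 1[of "0 # psites 0 js"] by (cases "0 + sum_list js = z") simp_all
  qed
  have "(\<lambda>x. exp (- 2 * t) * enn2real (\<Sum>n. path_sum (xi x) z n 0 t)) \<in> borel_measurable N"
    by measurable
  then show ?thesis using assms(2) by (simp add: pam_u_eq_weight_sum weight_sum_paths_to)
qed

lemma swap_sites_other:
  assumes "0 < y" "0 < y'" "y \<noteq> y'"
  shows "swap_sites xi y' (int y) = xi (int y)" "swap_sites xi y' (- int y) = xi (- int y)"
  using assms by (auto simp: swap_sites_def)

lemma swap_sites_same: "swap_sites xi y (int y) = xi (- int y)" "swap_sites xi y (- int y) = xi (int y)"
  by (auto simp: swap_sites_def)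

text \<open>The gain guaranteed by \<open>log_ratio_swap_gain\<close>. Gaps below 1 count as 0,
  because there the discarded mass could outweigh the gain.\<close>

definition gap_weight :: "real \<Rightarrow> (int \<Rightarrow> real) \<Rightarrow> nat \<Rightarrow> real" where
  "gap_weight Mb xi y = (let D = \<bar>xi (int y) - xi (- int y)\<bar> in if 1 \<le> D then D / (4 * exp 1 * Mb) else 0)"

locale env_scales = duplicated_env M \<alpha> p xi0 coin + scales t a m0 Mb \<theta> L B r N d y0 env
  for M :: "'a measure" and \<alpha> p xi0 coin t a m0 Mb \<theta> L B r N d y0 env +
  assumes y0: "1 \<le> y0"
begin

lemma pred_env_potential_eq [measurable]:
  "Measurable.pred env_space (\<lambda>x. env_potential x v = env_potential x w)"
  unfolding pred_def by (rule borel_measurable_eq; rule measurable_env_potential')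

lemma measurable_Psi_env [measurable]: "(\<lambda>x. Psi (env_potential x) s w) \<in> borel_measurable env_space"
  unfolding Psi_def
  by (intro borel_measurable_diff borel_measurable_times borel_measurable_ln measurable_env_potential') simp

lemma pred_Psi_le [measurable]:
  "Measurable.pred env_space (\<lambda>x. Psi (env_potential x) s v \<le> Psi (env_potential x) s w)"
  unfolding pred_def by (rule borel_measurable_le; rule measurable_Psi_env)

lemma measurable_good_at [measurable]: "Measurable.pred env_space (\<lambda>x. good_at z (env_potential x))"
  unfolding good_at_def by measurable

text \<open>A measurable stand-in for the maximiser, invariant under exchanges because
  \<open>good_at\<close> is.\<close>

definition site :: "(int + nat \<Rightarrow> real) \<Rightarrow> nat" where
  "site x = (LEAST z. good_at z (env_potential x))"

lemma measurable_site [measurable]: "site \<in> measurable env_space (count_space UNIV)"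
  unfolding site_def by measurable

lemma measurable_log_ratio_site [measurable]: "(\<lambda>x. log_ratio t (site x) (env_potential x)) \<in> borel_measurable env_space"
proof (rule measurable_compose_countable[OF _ measurable_site])
  fix z
  have "(\<lambda>x. pam_u (env_potential x) t w) \<in> borel_measurable env_space" for w
    by (rule measurable_pam_u[OF measurable_env_potential']) (use t in simp)
  then show "(\<lambda>x. log_ratio t z (env_potential x)) \<in> borel_measurable env_space"
    unfolding log_ratio_def by measurable
qed

lemma good_at_swap_iff: "good_at z (swap_sites xi y) \<longleftrightarrow> good_at z xi"
  using good_at_swap[of z xi y] good_at_swap[of z "swap_sites xi y" y] by auto

lemma good_site: "good_at z (env_potential x) \<Longrightarrow> good_at (site x) (env_potential x)"
  unfolding site_def by (rule LeastI)

lemma site_swap_eq: "0 < y \<Longrightarrow> site (env_swap y x) = site x"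
  by (simp add: site_def env_potential_swap good_at_swap_iff)

lemma good_at_gap_le:
  assumes g: "good_at z xi" and y: "y \<le> d"
  shows "\<bar>xi (int y) - xi (- int y)\<bar> \<le> Mb"
proof -
  have le: "xi w \<le> Mb" if "\<bar>w\<bar> = int y" for w
  proof -
    have "xi w \<le> env (real_of_int \<bar>w\<bar>)" by (rule good_at_env[OF g])
    also have "\<dots> \<le> env (real N)" using that y d by (intro env_mono) auto
    also have "\<dots> \<le> Mb" by (rule env_M)
    finally show ?thesis .
  qed
  show ?thesis
    using le[of "int y"] le[of "- int y"] good_at_ge_1[OF g, of "int y"] good_at_ge_1[OF g, of "- int y"] by simp
qed

text \<open>The fair sign at \<open>y\<close> is the sign of \<open>\<xi>(y) - \<xi>(-y)\<close>.
  The envelope bounds the gaps by \<open>Mb\<close>, so each weight is at most 1 and hence at most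
  \<open>K\<close>.\<close>

lemma log_ratio_anticoncentration:
  assumes K: "1 \<le> K" and v: "0 < v"
  shows "measure Q {x. (\<exists>z. good_at z (env_potential x)) \<and> \<bar>log_ratio t (site x) (env_potential x)\<bar> \<le> K
     \<and> v\<^sup>2 \<le> (\<Sum>y\<in>{y0..d}. (gap_weight Mb (env_potential x) y)\<^sup>2)} \<le> 4 * K / v"
proof -
  interpret QQ: prob_space Q by (rule prob_space_Q)
  let ?xi = env_potential
  define c where "c y x = gap_weight Mb (?xi x) y" for y x
  define \<sigma> where "\<sigma> y x = sgn (?xi x (int y) - ?xi x (- int y))" for y x
  define G where "G = {x. \<exists>z. good_at z (?xi x)}"
  have M0: "0 < 4 * exp 1 * Mb" using M by simp
  have "measure Q {x \<in> space Q. x \<in> G \<and> \<bar>log_ratio t (site x) (?xi x)\<bar> \<le> K \<and> v\<^sup>2 \<le> (\<Sum>y\<in>{y0..d}. (c y x)\<^sup>2)} \<le> 4 * K / v"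
  proof (rule QQ.swap_anticoncentration[where \<tau> = env_swap and \<sigma> = \<sigma>])
    show "env_swap y \<in> measurable Q Q" for y by (simp cong: measurable_cong_sets)
    show "distr Q Q (env_swap y) = Q" for y by (rule distr_env_swap)
    have "{x \<in> space env_space. \<exists>z. good_at z (?xi x)} \<in> sets env_space" by measurable
    then show "G \<in> sets Q" by (simp add: G_def space_PiM)
    show "(\<lambda>x. log_ratio t (site x) (?xi x)) \<in> borel_measurable Q" by measurable
    have "(\<lambda>x. c y x) \<in> borel_measurable env_space" for y
      unfolding c_def gap_weight_def Let_def by measurable
    then show "c y \<in> borel_measurable Q" for y by (simp cong: measurable_cong_sets)
    have "(\<lambda>x. \<sigma> y x) \<in> borel_measurable env_space" for y
      unfolding \<sigma>_def by measurable
    then show "\<sigma> y \<in> borel_measurable Q" for y by (simp cong: measurable_cong_sets)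
  next
    fix x y assume "y \<in> {y0..d}"
    then have "0 < y" using y0 by auto
    then show "env_swap y x \<in> G \<longleftrightarrow> x \<in> G" by (simp add: G_def env_potential_swap good_at_swap_iff)
  next
    fix x y y' assume "y \<in> {y0..d}" "y' \<in> {y0..d}"
    then have y: "0 < y" "0 < y'" using y0 by auto
    show "c y (env_swap y' x) = c y x"
      using swap_sites_other[OF y, of "?xi x"] swap_sites_same[of "?xi x" y]
      by (cases "y = y'") (simp_all add: c_def gap_weight_def env_potential_swap y abs_minus_commute)
    show "\<sigma> y (env_swap y' x) = (if y = y' then - \<sigma> y x else \<sigma> y x)"
      using swap_sites_other[OF y, of "?xi x"] swap_sites_same[of "?xi x" y]
      by (cases "y = y'") (simp_all add: \<sigma>_def env_potential_swap y sgn_minus[symmetric])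
  next
    fix x y show "\<bar>\<sigma> y x\<bar> \<le> 1" by (simp add: \<sigma>_def sgn_if)
  next
    fix x y assume y: "y \<in> {y0..d}" and x: "x \<in> G"
    then obtain z where g: "good_at z (?xi x)" by (auto simp: G_def)
    have D: "\<bar>?xi x (int y) - ?xi x (- int y)\<bar> \<le> Mb" using y by (intro good_at_gap_le[OF g]) simp
    have "1 \<le> 4 * exp (1::real)" using exp_ge_add_one_self[of "1::real"] by linarith
    then have "Mb * 1 \<le> Mb * (4 * exp 1)" using M by (intro mult_left_mono) auto
    then have "\<bar>?xi x (int y) - ?xi x (- int y)\<bar> / (4 * exp 1 * Mb) \<le> 1"
      using D M0 by (subst divide_le_eq_1_pos) (auto simp: mult_ac)
    then have q: "\<bar>?xi x (int y) - ?xi x (- int y)\<bar> / (4 * exp 1 * Mb) \<le> K" using K by linarith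
    have q0: "0 \<le> \<bar>?xi x (int y) - ?xi x (- int y)\<bar> / (4 * exp 1 * Mb)"
      using M0 by (intro divide_nonneg_pos) auto
    show "0 \<le> c y x \<and> c y x \<le> K"
      unfolding c_def gap_weight_def Let_def using q q0 K by (cases "1 \<le> \<bar>?xi x (int y) - ?xi x (- int y)\<bar>") (simp_all only: if_True if_False simp_thms, linarith)
    assume c0: "0 < c y x"
    then have D1: "1 \<le> \<bar>?xi x (int y) - ?xi x (- int y)\<bar>"
      by (auto simp: c_def gap_weight_def Let_def split: if_splits)
    then show "\<sigma> y x = 1 \<or> \<sigma> y x = -1" by (auto simp: \<sigma>_def sgn_if)
    assume s: "\<sigma> y x = 1"
    then have pos: "0 < ?xi x (int y) - ?xi x (- int y)" by (auto simp: \<sigma>_def sgn_if split: if_splits)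
    then have D2: "1 \<le> ?xi x (int y) - ?xi x (- int y)" using D1 by simp
    have yp: "0 < y" "y0 \<le> y" "y \<le> d" using y y0 by auto
    have "c y x = (?xi x (int y) - ?xi x (- int y)) / (4 * exp 1 * Mb)"
      using D2 by (simp add: c_def gap_weight_def Let_def)
    then show "log_ratio t (site (env_swap y x)) (?xi (env_swap y x)) + c y x \<le> log_ratio t (site x) (?xi x)"
      using log_ratio_swap_gain[OF good_site[OF g] yp D2]
      by (simp add: site_swap_eq[OF yp(1)] env_potential_swap[OF yp(1)])
  qed (use K v in auto)
  then show ?thesis by (simp add: G_def c_def)
qed

end

section \<open>Almost sure uniqueness of the maximiser\<close>

lemma ln_less_minus_one: "0 < x \<Longrightarrow> x \<noteq> 1 \<Longrightarrow> ln x < x - (1::real)"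
  using ln_le_minus_one[of x] ln_eq_minus_one[of x] by fastforce

text \<open>On the positive axis \<open>x - k * ln x\<close> decreases up to \<open>k\<close> and
  increases from there on, so each level is attained at most twice.\<close>

lemma finite_level_set_minus_ln:
  fixes k c :: real
  shows "finite {x. 0 < x \<and> x - k * ln x = c}"
proof -
  define f where "f x = x - k * ln x" for x :: real
  have ineq: "k * ln (y / x) < k * (y / x - 1)" if "0 < k" "0 < x" "0 < y" "x \<noteq> y" for x y
    using that ln_less_minus_one[of "y / x"] by simp
  have up: "f x < f y" if "0 < x" "k \<le> x" "x < y" for x y
  proof -
    have "k * (ln y - ln x) < y - x"
    proof (cases "0 < k")
      case True
      have "k * (y / x - 1) = k / x * (y - x)" using that by (simp add: field_simps)
      also have "\<dots> \<le> 1 * (y - x)" using that by (intro mult_right_mono) auto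
      finally show ?thesis using ineq[OF True, of x y] that by (simp add: ln_div)
    next
      case False
      have "ln x < ln y" using that by simp
      then have "k * (ln y - ln x) \<le> 0" using False by (simp add: mult_le_0_iff)
      then show ?thesis using that by simp
    qed
    then show ?thesis by (simp add: f_def algebra_simps)
  qed
  have down: "f y < f x" if "0 < x" "x < y" "y \<le> k" for x y
  proof -
    have "k * (x / y - 1) = - (k / y * (y - x))" using that by (simp add: field_simps)
    also have "\<dots> \<le> - (1 * (y - x))" using that by (intro le_imp_neg_le mult_right_mono) auto
    finally have 1: "k * (x / y - 1) \<le> - (1 * (y - x))" .
    have "k * ln (x / y) < k * (x / y - 1)" by (rule ineq) (use that in auto)
    moreover have "ln (x / y) = ln x - ln y" using that by (simp add: ln_div)
    ultimately have "k * (ln x - ln y) < - (y - x)" using 1 by simp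
    then show ?thesis by (simp add: f_def algebra_simps)
  qed
  have "inj_on f {x. 0 < x \<and> k \<le> x}"
  proof (rule inj_onI)
    fix x y assume "x \<in> {x. 0 < x \<and> k \<le> x}" "y \<in> {x. 0 < x \<and> k \<le> x}" "f x = f y"
    then show "x = y" using up[of x y] up[of y x] by (cases x y rule: linorder_cases) auto
  qed
  moreover have "inj_on f {x. 0 < x \<and> x \<le> k}"
  proof (rule inj_onI)
    fix x y assume "x \<in> {x. 0 < x \<and> x \<le> k}" "y \<in> {x. 0 < x \<and> x \<le> k}" "f x = f y"
    then show "x = y" using down[of x y] down[of y x] by (cases x y rule: linorder_cases) auto
  qed
  ultimately have "finite (f -` {c} \<inter> {x. 0 < x \<and> k \<le> x})" "finite (f -` {c} \<inter> {x. 0 < x \<and> x \<le> k})"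
    by (auto intro: finite_vimage_IntI)
  then have "finite (f -` {c} \<inter> {x. 0 < x \<and> k \<le> x} \<union> f -` {c} \<inter> {x. 0 < x \<and> x \<le> k})" by simp
  then show ?thesis by (rule rev_finite_subset) (auto simp: f_def)
qed

context duplicated_env
begin

text \<open>The Pareto law has a continuous distribution function, hence no atoms, and the
  exceptional set among positive values is finite.\<close>

lemma AE_xi0_level: "AE x in distr M borel (\<lambda>\<omega>. xi0 \<omega> z). x - k * ln x \<noteq> c"
proof -
  interpret D: real_distribution "distr M borel (\<lambda>\<omega>. xi0 \<omega> z)" by (rule real_distribution_xi0)
  have "measure (distr M borel (\<lambda>\<omega>. xi0 \<omega> z)) {x} = 0" for x
  proof -
    have "isCont (\<lambda>x. 1 - max 1 x powr (- \<alpha>)) x"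
      by (intro continuous_intros) auto
    moreover have "cdf (distr M borel (\<lambda>\<omega>. xi0 \<omega> z)) = (\<lambda>x. 1 - max 1 x powr (- \<alpha>))"
      by (rule ext) (rule cdf_xi0)
    ultimately have "isCont (cdf (distr M borel (\<lambda>\<omega>. xi0 \<omega> z))) x" by simp
    then show ?thesis by (simp add: D.isCont_cdf)
  qed
  then have sing: "AE x in distr M borel (\<lambda>\<omega>. xi0 \<omega> z). x \<noteq> u" for u
    by (intro AE_I[of _ _ "{u}"]) (auto simp: D.emeasure_eq_measure)
  let ?S = "{x. 0 < x \<and> x - k * ln x = c}"
  have "AE x in distr M borel (\<lambda>\<omega>. xi0 \<omega> z). \<forall>u\<in>?S. x \<noteq> u"
    by (rule AE_finite_allI[OF finite_level_set_minus_ln]) (rule sing)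
  moreover have "AE x in distr M borel (\<lambda>\<omega>. xi0 \<omega> z). 1 < x"
    by (subst AE_distr_iff) (auto intro: AE_xi0_gt_1)
  ultimately show ?thesis
  proof eventually_elim
    case (elim x)
    then have "x \<notin> ?S" by blast
    then show ?case using elim by auto
  qed
qed

text \<open>By independence and Fubini the value at \<open>z\<close> can be frozen; a tie then asks
  the value at \<open>z'\<close> to lie in a null level set.\<close>

lemma AE_no_tie:
  assumes "z \<noteq> z'"
  shows "AE \<omega> in M. xi0 \<omega> z - k * ln (xi0 \<omega> z) \<noteq> xi0 \<omega> z' - k' * ln (xi0 \<omega> z')"
proof -
  let ?X = "\<lambda>\<omega>. xi0 \<omega> z" and ?Y = "\<lambda>\<omega>. xi0 \<omega> z'"
  have "indep_var borel (\<lambda>\<omega>. X \<omega> (Inl z)) borel (\<lambda>\<omega>. X \<omega> (Inl z'))"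
    using indep_vars_sum[of "{Inl z'}" "Inl z" "\<lambda>i \<omega>. X \<omega> i"] indep_vars_subset[OF indep, of "{Inl z, Inl z'}"] assms
    by (simp add: X_def)
  then have iv: "indep_var borel ?X borel ?Y" by simp
  have eq: "distr M borel ?X \<Otimes>\<^sub>M distr M borel ?Y = distr M (borel \<Otimes>\<^sub>M borel) (\<lambda>\<omega>. (?X \<omega>, ?Y \<omega>))"
    using iv unfolding indep_var_distribution_eq by simp
  interpret DX: real_distribution "distr M borel ?X" by (rule real_distribution_xi0)
  interpret DY: real_distribution "distr M borel ?Y" by (rule real_distribution_xi0)
  interpret P: pair_prob_space "distr M borel ?Y" "distr M borel ?X" by unfold_locales
  interpret P': pair_prob_space "distr M borel ?X" "distr M borel ?Y" by unfold_locales
  let ?P = "\<lambda>x y. x - k * ln x \<noteq> y - k' * ln y"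
  have meas: "{q \<in> space (distr M borel ?X \<Otimes>\<^sub>M distr M borel ?Y). ?P (fst q) (snd q)} \<in> sets (distr M borel ?X \<Otimes>\<^sub>M distr M borel ?Y)"
    by measurable
  have "AE x in distr M borel ?X. AE y in distr M borel ?Y. ?P x y"
  proof (rule AE_I2)
    fix x
    from AE_xi0_level[where z = z' and k = k' and c = "x - k * ln x"]
    show "AE y in distr M borel ?Y. ?P x y" by eventually_elim simp
  qed
  then have "AE q in distr M borel ?X \<Otimes>\<^sub>M distr M borel ?Y. ?P (fst q) (snd q)"
    by (intro P'.AE_pair_measure meas) simp
  then have "AE q in distr M (borel \<Otimes>\<^sub>M borel) (\<lambda>\<omega>. (?X \<omega>, ?Y \<omega>)). ?P (fst q) (snd q)"
    unfolding eq .
  then show ?thesis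
    by (subst (asm) AE_distr_iff) auto
qed

end

section \<open>The good event for the environment\<close>

context env_scales
begin

definition good_env :: "nat \<Rightarrow> real \<Rightarrow> 'a \<Rightarrow> bool" where
  "good_env J h \<omega> \<longleftrightarrow> (\<forall>w. 1 \<le> xi0 \<omega> w) \<and> (\<forall>w. xi0 \<omega> w \<le> env (real_of_int \<bar>w\<bar>)) \<and>
     (\<forall>w\<in>{- int d..int d}. xi0 \<omega> w \<le> m0 / 2) \<and>
     (\<forall>n\<in>{1..N}. coin \<omega> n \<or> (xi0 \<omega> (int n) \<le> m0 \<and> xi0 \<omega> (- int n) \<le> m0)) \<and>
     (\<exists>n\<in>{1..J}. h < xi0 \<omega> (int n))"

text \<open>The peak exceeds \<open>h \<ge> m0\<close> within distance \<open>J\<close>, so it must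
  be duplicated, since unduplicated values are at most \<open>m0\<close>. It therefore competes in
  \<open>D\<close>, and
  \<open>\<xi>(z) \<ge> Psi(z) \<ge> h - J / t * ln h \<ge> m0\<close>.\<close>

lemma good_env_imp_good_at:
  assumes E: "good_env J h \<omega>"
    and Z: "z \<in> Dset (potential (xi0 \<omega>) (coin \<omega>))"
      "\<forall>y \<in> Dset (potential (xi0 \<omega>) (coin \<omega>)). Psi (potential (xi0 \<omega>) (coin \<omega>)) t (int y) \<le> Psi (potential (xi0 \<omega>) (coin \<omega>)) t (int z)"
    and J: "J \<le> N" "0 < h" "J / t \<le> h" "m0 \<le> h - J / t * ln h"
  shows "good_at z (potential (xi0 \<omega>) (coin \<omega>))"
proof -
  let ?xi = "potential (xi0 \<omega>) (coin \<omega>)"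
  have E1: "1 \<le> xi0 \<omega> w" and E2: "xi0 \<omega> w \<le> env (real_of_int \<bar>w\<bar>)" for w
    using E unfolding good_env_def by blast+
  have E3: "xi0 \<omega> w \<le> m0 / 2" if "\<bar>w\<bar> \<le> int d" for w
    using E that unfolding good_env_def by (simp add: abs_le_iff)
  have E4: "coin \<omega> n \<or> (xi0 \<omega> (int n) \<le> m0 \<and> xi0 \<omega> (- int n) \<le> m0)" if "1 \<le> n" "n \<le> N" for n
    using E that unfolding good_env_def by simp
  obtain n where n: "1 \<le> n" "n \<le> J" "h < xi0 \<omega> (int n)"
    using E unfolding good_env_def by auto
  have val: "?xi w = xi0 \<omega> w \<or> ?xi w = xi0 \<omega> (- w)" for w by (simp add: potential_def)
  \<comment> \<open>For \<open>h < 1\<close> the logarithm is negative and could help. But then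
    \<open>h - J / t * ln h\<close> is below 2 by \<open>J / t \<le> h\<close>, which contradicts
    \<open>8 \<le> m0\<close>.\<close>
  have hm: "m0 \<le> h"
  proof -
    have "0 \<le> ln h \<or> h < 1" using J by auto
    moreover have "\<not> h < 1"
    proof
      assume h1: "h < 1"
      have "J / t * (- ln h) \<le> h * (- ln h)" using J h1 by (intro mult_right_mono) auto
      also have "h * (- ln h) \<le> 1"
      proof -
        have "- ln h \<le> 1 / h - 1" using ln_le_minus_one[of "1 / h"] J by (simp add: ln_div)
        then have "h * (- ln h) \<le> h * (1 / h - 1)" using J by (intro mult_left_mono) auto
        then show ?thesis using J by (simp add: right_diff_distrib)
      qed
      finally show False using J m0 h1 by simp
    qed
    ultimately have "0 \<le> J / t * ln h" using t by simp
    then show ?thesis using J by simp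
  qed
  have sym: "?xi w = ?xi (- w)" if w: "w \<noteq> 0" "coin \<omega> (nat \<bar>w\<bar>)" for w
    using that by (cases "w > 0") (auto simp: potential_def)
  have "coin \<omega> n" using E4[of n] n J hm by auto
  then have nD: "n \<in> Dset ?xi" using sym[of "int n"] n by (simp add: Dset_def)
  \<comment> \<open>The function \<open>x - J / t * ln x\<close> is increasing for
    \<open>x \<ge> J / t\<close>, and \<open>h\<close> lies in this range.\<close>
  have "h - J / t * ln h \<le> xi0 \<omega> (int n) - J / t * ln (xi0 \<omega> (int n))"
  proof -
    let ?u = "xi0 \<omega> (int n)"
    have "ln (?u / h) \<le> ?u / h - 1" using n J by (intro ln_le_minus_one) auto
    then have "J / t * (ln ?u - ln h) \<le> J / t * (?u / h - 1)"
      using n J t by (intro mult_left_mono) (auto simp: ln_div)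
    also have "\<dots> \<le> h * (?u / h - 1)" using n J by (intro mult_right_mono) (auto simp: field_simps)
    also have "\<dots> = ?u - h" using J by (simp add: field_simps)
    finally show ?thesis by (simp add: right_diff_distrib)
  qed
  also have "\<dots> \<le> Psi ?xi t (int n)"
  proof -
    have "real n / t * ln (xi0 \<omega> (int n)) \<le> J / t * ln (xi0 \<omega> (int n))"
      using n t E1 by (intro mult_right_mono divide_right_mono) auto
    then show ?thesis by (simp add: Psi_def potential_def)
  qed
  also have "\<dots> \<le> Psi ?xi t (int z)" using Z nD by blast
  also have "\<dots> \<le> ?xi (int z)"
    using E1[of "int z"] t by (simp add: Psi_def potential_def)
  finally have mz: "m0 \<le> ?xi (int z)" using J by simp
  show ?thesis
    unfolding good_at_def
  proof (intro conjI allI impI)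
    fix w
    show "1 \<le> ?xi w" using val[of w] E1[of w] E1[of "- w"] by auto
    show "?xi w \<le> env (real_of_int \<bar>w\<bar>)" using val[of w] E2[of w] E2[of "- w"] by auto
    show "?xi w \<le> m0 / 2" if "\<bar>w\<bar> \<le> int d" using val[of w] E3[of w] E3[of "- w"] that by auto
    show "Psi ?xi t w \<le> Psi ?xi t (int z)" if w: "?xi w = ?xi (- w)"
    proof -
      have "?xi (int (nat \<bar>w\<bar>)) = ?xi w" "?xi (- int (nat \<bar>w\<bar>)) = ?xi w"
        using w by (cases "w \<ge> 0"; simp)+
      then have D: "nat \<bar>w\<bar> \<in> Dset ?xi" and e: "Psi ?xi t w = Psi ?xi t (int (nat \<bar>w\<bar>))"
        by (simp_all add: Dset_def Psi_def)
      show ?thesis unfolding e by (rule Z(2)[rule_format, OF D])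
    qed
    show "?xi w \<le> m0" if w: "\<bar>w\<bar> \<le> int N" "?xi w \<noteq> ?xi (- w)"
    proof -
      have w0: "w \<noteq> 0" using w by auto
      then have nc: "\<not> coin \<omega> (nat \<bar>w\<bar>)" using sym[of w] w by auto
      have "xi0 \<omega> (int (nat \<bar>w\<bar>)) \<le> m0 \<and> xi0 \<omega> (- int (nat \<bar>w\<bar>)) \<le> m0"
        using E4[of "nat \<bar>w\<bar>"] nc w0 w by auto
      then have "xi0 \<omega> w \<le> m0" "xi0 \<omega> (- w) \<le> m0" by (cases "w \<ge> 0"; simp)+
      then show ?thesis using val[of w] by auto
    qed
  qed (use Z mz in \<open>auto simp: Dset_def\<close>)
qed

text \<open>The hypothesis on \<open>Z\<close> gives no measurability, so the event is covered by a
  measurable set. On the good event both \<open>Z\<close> and \<open>site\<close> maximise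
  \<open>Psi\<close> over \<open>D\<close>, and in the absence of ties they coincide.\<close>

lemma log_ratio_bound:
  assumes Z: "AE \<omega> in M. Z \<omega> \<in> Dset (potential (xi0 \<omega>) (coin \<omega>)) \<and>
     (\<forall>y \<in> Dset (potential (xi0 \<omega>) (coin \<omega>)). Psi (potential (xi0 \<omega>) (coin \<omega>)) t (int y) \<le> Psi (potential (xi0 \<omega>) (coin \<omega>)) t (int (Z \<omega>)))"
    and J: "J \<le> N" "0 < h" "J / t \<le> h" "m0 \<le> h - J / t * ln h"
    and K: "1 \<le> K" and v: "0 < v"
  shows "\<exists>A\<in>sets M. {\<omega> \<in> space M. \<bar>log_ratio t (Z \<omega>) (potential (xi0 \<omega>) (coin \<omega>))\<bar> \<le> K} \<subseteq> A \<and>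
     measure M A \<le> measure M {\<omega> \<in> space M. \<not> good_env J h \<omega>}
       + measure M {\<omega> \<in> space M. (\<Sum>y\<in>{y0..d}. (gap_weight Mb (potential (xi0 \<omega>) (coin \<omega>)) y)\<^sup>2) < v\<^sup>2} + 4 * K / v"
proof -
  let ?xi = "\<lambda>\<omega>. potential (xi0 \<omega>) (coin \<omega>)"
  have tie: "AE \<omega> in M. \<forall>z z'. z \<noteq> z' \<longrightarrow> Psi (?xi \<omega>) t (int z) \<noteq> Psi (?xi \<omega>) t (int z')"
  proof -
    have "AE \<omega> in M. z \<noteq> z' \<longrightarrow> Psi (?xi \<omega>) t (int z) \<noteq> Psi (?xi \<omega>) t (int z')" for z z' :: nat
      using AE_no_tie[of "int z" "int z'" "z / t" "z' / t"]
      by (cases "z = z'") (simp_all add: Psi_def potential_def)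
    then show ?thesis unfolding AE_all_countable by blast
  qed
  from AE_conjI[OF Z tie] obtain N1 where N1: "{\<omega> \<in> space M. \<not> ((Z \<omega> \<in> Dset (?xi \<omega>) \<and>
     (\<forall>y \<in> Dset (?xi \<omega>). Psi (?xi \<omega>) t (int y) \<le> Psi (?xi \<omega>) t (int (Z \<omega>)))) \<and>
     (\<forall>z z'. z \<noteq> z' \<longrightarrow> Psi (?xi \<omega>) t (int z) \<noteq> Psi (?xi \<omega>) t (int z')))} \<subseteq> N1"
     "emeasure M N1 = 0" "N1 \<in> sets M" by (rule AE_E)
  let ?B = "{\<omega> \<in> space M. \<not> good_env J h \<omega>}"
  let ?V = "{\<omega> \<in> space M. (\<Sum>y\<in>{y0..d}. (gap_weight Mb (?xi \<omega>) y)\<^sup>2) < v\<^sup>2}"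
  let ?W = "{x. (\<exists>z. good_at z (env_potential x)) \<and> \<bar>log_ratio t (site x) (env_potential x)\<bar> \<le> K
     \<and> v\<^sup>2 \<le> (\<Sum>y\<in>{y0..d}. (gap_weight Mb (env_potential x) y)\<^sup>2)}"
  let ?A = "N1 \<union> (?B \<union> (?V \<union> (X -` ?W \<inter> space M)))"
  have B: "?B \<in> sets M" unfolding good_env_def by measurable
  have gw: "(\<lambda>x. gap_weight Mb (env_potential x) y) \<in> borel_measurable env_space" for y
    unfolding gap_weight_def Let_def by measurable
  have gw': "(\<lambda>\<omega>. gap_weight Mb (?xi \<omega>) y) \<in> borel_measurable M" for y
    using measurable_compose[OF X_meas gw[of y]] by (simp add: env_potential_X)
  have V: "?V \<in> sets M" using gw' by measurable
  have "{x \<in> space env_space. (\<exists>z. good_at z (env_potential x)) \<and> \<bar>log_ratio t (site x) (env_potential x)\<bar> \<le> K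
     \<and> v\<^sup>2 \<le> (\<Sum>y\<in>{y0..d}. (gap_weight Mb (env_potential x) y)\<^sup>2)} \<in> sets env_space"
    using gw by measurable
  then have W0: "?W \<in> sets env_space" by (simp add: space_PiM)
  have W: "X -` ?W \<inter> space M \<in> sets M" using measurable_sets[OF X_meas W0] .
  have mW: "measure M (X -` ?W \<inter> space M) \<le> 4 * K / v"
    using log_ratio_anticoncentration[OF K v] measure_distr[OF X_meas, of ?W] W0 by (simp add: Q_def)
  have sub: "{\<omega> \<in> space M. \<bar>log_ratio t (Z \<omega>) (?xi \<omega>)\<bar> \<le> K} \<subseteq> ?A"
  proof
    fix \<omega> assume \<omega>: "\<omega> \<in> {\<omega> \<in> space M. \<bar>log_ratio t (Z \<omega>) (?xi \<omega>)\<bar> \<le> K}"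
    show "\<omega> \<in> ?A"
    proof (rule ccontr)
      assume n: "\<omega> \<notin> ?A"
      then have ZD: "Z \<omega> \<in> Dset (?xi \<omega>)" "\<forall>y \<in> Dset (?xi \<omega>). Psi (?xi \<omega>) t (int y) \<le> Psi (?xi \<omega>) t (int (Z \<omega>))"
        and nt: "\<forall>z z'. z \<noteq> z' \<longrightarrow> Psi (?xi \<omega>) t (int z) \<noteq> Psi (?xi \<omega>) t (int z')"
        using N1(1) \<omega> by blast+
      have E: "good_env J h \<omega>" and V: "v\<^sup>2 \<le> (\<Sum>y\<in>{y0..d}. (gap_weight Mb (?xi \<omega>) y)\<^sup>2)"
        using n \<omega> by (auto simp: not_less)
      have gZ: "good_at (Z \<omega>) (?xi \<omega>)" by (rule good_env_imp_good_at[OF E ZD J])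
      have gs: "good_at (site (X \<omega>)) (?xi \<omega>)"
        using good_site[of "Z \<omega>" "X \<omega>"] gZ by (simp add: env_potential_X)
      have "Psi (?xi \<omega>) t (int (site (X \<omega>))) \<le> Psi (?xi \<omega>) t (int (Z \<omega>))"
        by (rule good_at_Psi[OF good_at_sym[OF gs] gZ])
      moreover have "Psi (?xi \<omega>) t (int (Z \<omega>)) \<le> Psi (?xi \<omega>) t (int (site (X \<omega>)))"
        by (rule good_at_Psi[OF good_at_sym[OF gZ] gs])
      ultimately have "site (X \<omega>) = Z \<omega>" using nt by force
      then have "\<omega> \<in> X -` ?W \<inter> space M"
        using \<omega> V gZ by (auto simp: env_potential_X)
      then show False using n by blast
    qed
  qed
  have "measure M ?A \<le> measure M N1 + (measure M ?B + (measure M ?V + measure M (X -` ?W \<inter> space M)))"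
    using N1(3) B V W by (intro order_trans[OF measure_Un_le] add_left_mono measure_Un_le sets.Un) auto
  also have "measure M N1 = 0" using N1(2) by (simp add: measure_def)
  finally have "measure M ?A \<le> measure M ?B + measure M ?V + 4 * K / v" using mW by simp
  then show ?thesis using sub N1(3) B V W by (intro bexI[of _ ?A]) auto
qed

end

section \<open>Probability estimates for the environment\<close>

text \<open>From the second on, each summand is at most the decrement of
  \<open>2 * r / sqrt (1 + n / r)\<close>; the first summand is 1.\<close>

lemma sum_inverse_cube_sqrt_le:
  fixes r :: real
  assumes r: "1 \<le> r"
  shows "(\<Sum>n<k. (1 + real n / r) powr (- (3 / 2))) \<le> 3 * r"
proof -
  define s where "s n = sqrt (1 + real n / r)" for n
  have s1: "1 \<le> s n" for n using r by (simp add: s_def)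
  have pw: "(1 + real n / r) powr (- (3 / 2)) = 1 / (s n * s n * s n)" for n
  proof -
    have pos: "0 < 1 + real n / r" using r by (simp add: add_pos_nonneg)
    have "(1 + real n / r) powr (3 / 2) = ((1 + real n / r) powr (1 / 2)) powr 3"
      by (simp add: powr_powr)
    also have "(1 + real n / r) powr (1 / 2) = s n" using pos by (simp add: s_def powr_half_sqrt)
    also have "s n powr 3 = s n ^ 3" using powr_realpow[of "s n" 3] s1[of n] by simp
    finally show ?thesis using pos by (simp add: powr_minus_divide power3_eq_cube)
  qed
  have step: "1 / (s (Suc n) * s (Suc n) * s (Suc n)) \<le> 2 * r / s n - 2 * r / s (Suc n)" for n
  proof -
    let ?u = "s n" and ?v = "s (Suc n)"
    have u: "0 < ?u" and v: "0 < ?v" using s1[of n] s1[of "Suc n"] by linarith+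
    have uv: "?u \<le> ?v" using r by (simp add: s_def divide_right_mono)
    have "?u * ?u = 1 + n / r" "?v * ?v = 1 + Suc n / r" using r by (auto simp: s_def add_nonneg_nonneg)
    then have "?v * ?v - ?u * ?u = 1 / r" using r by (simp add: field_simps)
    then have "r * ((?v - ?u) * (?v + ?u)) = 1" using r by (simp add: algebra_simps)
    then have e: "r * (?v - ?u) = 1 / (?v + ?u)" using u v by (simp add: field_simps)
    have "2 * r / ?u - 2 * r / ?v = 2 * (r * (?v - ?u)) / (?u * ?v)"
      using u v by (simp add: field_simps)
    also have "\<dots> = 2 / ((?v + ?u) * (?u * ?v))" unfolding e by simp
    also have "\<dots> \<ge> 2 / ((?v + ?v) * (?v * ?v))"
      using u v uv by (intro divide_left_mono mult_mono add_mono mult_pos_pos add_pos_pos) auto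
    finally have "2 / ((?v + ?v) * (?v * ?v)) \<le> 2 * r / ?u - 2 * r / ?v" .
    moreover have "2 / ((?v + ?v) * (?v * ?v)) = 1 / (?v * ?v * ?v)" using v by (simp add: field_simps)
    ultimately show ?thesis by simp
  qed
  have "(\<Sum>n<Suc k. 1 / (s n * s n * s n)) \<le> 1 + 2 * r - 2 * r / s k" for k
  proof (induction k)
    case 0
    show ?case by (simp add: s_def)
  next
    case (Suc k)
    show ?case using Suc step[of k] by simp
  qed
  from this[of k] have "(\<Sum>n<Suc k. 1 / (s n * s n * s n)) \<le> 1 + 2 * r"
    using r s1[of k] by (smt (verit) divide_nonneg_nonneg)
  moreover have "(\<Sum>n<k. 1 / (s n * s n * s n)) \<le> (\<Sum>n<Suc k. 1 / (s n * s n * s n))"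
    using s1[of k] by simp
  ultimately show ?thesis unfolding pw using r by linarith
qed

context duplicated_env
begin

text \<open>Since \<open>3 / 4 * \<alpha> \<ge> 3 / 2\<close>, an exceedance at distance
  \<open>n\<close> has probability of order \<open>(1 + n / r) powr (- (3 / 2)) / r\<close>. The sum
  over \<open>n\<close> is of order 1, and the factor \<open>B powr (- \<alpha>)\<close>
  remains.\<close>

lemma prob_envelope_exceeded:
  assumes a: "0 < a" and r: "r = a powr \<alpha>" "1 \<le> r" and B: "0 < B" "1 \<le> B * a"
  shows "measure M {\<omega> \<in> space M. \<exists>w. B * a * (1 + real_of_int \<bar>w\<bar> / r) powr (3 / 4) < xi0 \<omega> w} \<le> 6 * B powr (- \<alpha>)"
proof -
  define e where "e x = B * a * (1 + x / r) powr (3 / 4)" for x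
  have e1: "1 \<le> e (real n)" for n
  proof -
    have "1 \<le> (1 + real n / r) powr (3 / 4)" using r by (intro ge_one_powr_ge_zero) auto
    then have "1 * 1 \<le> B * a * (1 + real n / r) powr (3 / 4)" using B by (intro mult_mono) auto
    then show ?thesis by (simp add: e_def)
  qed
  have pe: "e (real n) powr (- \<alpha>) \<le> B powr (- \<alpha>) / r * (1 + real n / r) powr (- (3 / 2))" for n
  proof -
    have b1: "1 \<le> 1 + real n / r" using r by simp
    have "e (real n) powr (- \<alpha>) = B powr (- \<alpha>) * a powr (- \<alpha>) * (1 + real n / r) powr (3 / 4 * (- \<alpha>))"
      using a B b1 by (simp add: e_def powr_mult powr_powr)
    also have "a powr (- \<alpha>) = 1 / r" using a by (simp add: r powr_minus_divide)
    also have "(1 + real n / r) powr (3 / 4 * (- \<alpha>)) \<le> (1 + real n / r) powr (- (3 / 2))"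
      using b1 \<alpha> by (intro powr_mono) auto
    finally have "e (real n) powr (- \<alpha>) \<le> B powr (- \<alpha>) * (1 / r) * (1 + real n / r) powr (- (3 / 2))"
      using r(2) by (simp only: mult_left_mono mult_nonneg_nonneg powr_ge_zero divide_nonneg_nonneg zero_le_one order_trans[OF zero_le_one r(2)])
    then show ?thesis by simp
  qed
  let ?A = "\<lambda>n. {\<omega> \<in> space M. e (real n) < xi0 \<omega> (int n)} \<union> {\<omega> \<in> space M. e (real n) < xi0 \<omega> (- int n)}"
  let ?c = "\<lambda>n. 2 * (B powr (- \<alpha>) / r * (1 + real n / r) powr (- (3 / 2)))"
  have mA: "measure M (?A n) \<le> ?c n" for n
  proof -
    have "measure M (?A n) \<le> measure M {\<omega> \<in> space M. e (real n) < xi0 \<omega> (int n)} + measure M {\<omega> \<in> space M. e (real n) < xi0 \<omega> (- int n)}"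
      by (rule measure_Un_le) measurable
    also have "\<dots> = 2 * e (real n) powr (- \<alpha>)" using tail[OF e1[of n]] by simp
    finally show ?thesis using pe[of n] by linarith
  qed
  have part: "(\<Sum>n<k. ?c n) \<le> 6 * B powr (- \<alpha>)" for k
  proof -
    have "(\<Sum>n<k. ?c n) = 2 * B powr (- \<alpha>) / r * (\<Sum>n<k. (1 + real n / r) powr (- (3 / 2)))"
      by (simp add: sum_distrib_left mult_ac)
    also have "\<dots> \<le> 2 * B powr (- \<alpha>) / r * (3 * r)"
      using r by (intro mult_left_mono sum_inverse_cube_sqrt_le) auto
    also have "\<dots> = 6 * B powr (- \<alpha>)" using r(2) by simp
    finally show ?thesis .
  qed
  have sc: "summable ?c"
    by (rule summableI_nonneg_bounded[OF _ part]) (use r in simp)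
  have sm: "summable (\<lambda>n. measure M (?A n))"
    by (rule summable_comparison_test'[OF sc, of 0]) (use mA in auto)
  have "{\<omega> \<in> space M. \<exists>w. B * a * (1 + real_of_int \<bar>w\<bar> / r) powr (3 / 4) < xi0 \<omega> w} \<subseteq> (\<Union>n. ?A n)"
  proof
    fix \<omega> assume "\<omega> \<in> {\<omega> \<in> space M. \<exists>w. B * a * (1 + real_of_int \<bar>w\<bar> / r) powr (3 / 4) < xi0 \<omega> w}"
    then obtain w where w: "\<omega> \<in> space M" "e (real_of_int \<bar>w\<bar>) < xi0 \<omega> w" by (auto simp: e_def)
    have "\<omega> \<in> ?A (nat \<bar>w\<bar>)" using w by (cases "0 \<le> w") auto
    then show "\<omega> \<in> (\<Union>n. ?A n)" by blast
  qed
  then have "measure M {\<omega> \<in> space M. \<exists>w. B * a * (1 + real_of_int \<bar>w\<bar> / r) powr (3 / 4) < xi0 \<omega> w} \<le> measure M (\<Union>n. ?A n)"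
    by (intro finite_measure_mono) measurable
  also have "\<dots> \<le> (\<Sum>n. measure M (?A n))"
    by (rule finite_measure_subadditive_countably[OF _ sm]) auto
  also have "\<dots> \<le> (\<Sum>n. ?c n)" by (rule suminf_le[OF mA sm sc])
  also have "\<dots> \<le> 6 * B powr (- \<alpha>)" by (rule suminf_le_const[OF sc part])
  finally show ?thesis .
qed

lemma prob_low_exceeded:
  assumes "1 \<le> u"
  shows "measure M {\<omega> \<in> space M. \<exists>w\<in>{- int d..int d}. u < xi0 \<omega> w} \<le> (2 * real d + 1) * u powr (- \<alpha>)"
proof -
  have "{\<omega> \<in> space M. \<exists>w\<in>{- int d..int d}. u < xi0 \<omega> w} = (\<Union>w\<in>{- int d..int d}. {\<omega> \<in> space M. u < xi0 \<omega> w})" by auto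
  also have "measure M \<dots> \<le> (\<Sum>w\<in>{- int d..int d}. measure M {\<omega> \<in> space M. u < xi0 \<omega> w})"
    by (rule finite_measure_subadditive_finite) auto
  also have "\<dots> = (2 * real d + 1) * u powr (- \<alpha>)" using tail[OF assms] by simp
  finally show ?thesis .
qed

lemma indep_coin_xi0: "indep_var borel (\<lambda>\<omega>. of_bool (coin \<omega> n) :: real) borel (\<lambda>\<omega>. xi0 \<omega> z)"
  using indep_vars_sum[of "{Inl z}" "Inr n" "\<lambda>i \<omega>. X \<omega> i"] indep_vars_subset[OF indep, of "{Inr n, Inl z}"]
  by (simp add: X_def)

lemma prob_not_coin: "measure M {\<omega> \<in> space M. \<not> coin \<omega> n} = 1 - p n"
  using prob_neg[of "\<lambda>\<omega>. coin \<omega> n"] coin_prob[of n] by simp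

lemma prob_not_coin_xi0:
  assumes "1 \<le> u"
  shows "measure M {\<omega> \<in> space M. \<not> coin \<omega> n \<and> u < xi0 \<omega> z} = (1 - p n) * u powr (- \<alpha>)"
proof -
  have "measure M {\<omega> \<in> space M. (of_bool (coin \<omega> n) :: real) \<in> {0} \<and> xi0 \<omega> z \<in> {u<..}}
     = measure M {\<omega> \<in> space M. (of_bool (coin \<omega> n) :: real) \<in> {0}} * measure M {\<omega> \<in> space M. xi0 \<omega> z \<in> {u<..}}"
    by (rule prob_indep_random_variable[OF indep_coin_xi0]) auto
  then show ?thesis using tail[OF assms] prob_not_coin by simp
qed

lemma prob_asym_exceeded:
  assumes "1 \<le> u"
  shows "measure M {\<omega> \<in> space M. \<exists>n\<in>{1..N}. \<not> coin \<omega> n \<and> (u < xi0 \<omega> (int n) \<or> u < xi0 \<omega> (- int n))}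
     \<le> 2 * u powr (- \<alpha>) * eta p N"
proof -
  let ?A = "\<lambda>n z. {\<omega> \<in> space M. \<not> coin \<omega> n \<and> u < xi0 \<omega> z}"
  have "{\<omega> \<in> space M. \<exists>n\<in>{1..N}. \<not> coin \<omega> n \<and> (u < xi0 \<omega> (int n) \<or> u < xi0 \<omega> (- int n))} = (\<Union>n\<in>{1..N}. ?A n (int n) \<union> ?A n (- int n))" by auto
  also have "measure M \<dots> \<le> (\<Sum>n\<in>{1..N}. measure M (?A n (int n) \<union> ?A n (- int n)))"
    by (rule finite_measure_subadditive_finite) auto
  also have "\<dots> \<le> (\<Sum>n\<in>{1..N}. 2 * u powr (- \<alpha>) * (1 - p n))"
  proof (intro sum_mono)
    fix n
    have "measure M (?A n (int n) \<union> ?A n (- int n)) \<le> measure M (?A n (int n)) + measure M (?A n (- int n))"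
      by (rule measure_Un_le) measurable
    then show "measure M (?A n (int n) \<union> ?A n (- int n)) \<le> 2 * u powr (- \<alpha>) * (1 - p n)"
      by (simp add: prob_not_coin_xi0[OF assms] mult_ac)
  qed
  also have "\<dots> = 2 * u powr (- \<alpha>) * eta p N" by (simp add: eta_def sum_distrib_left)
  finally show ?thesis .
qed

lemma prob_no_peak:
  assumes h: "1 \<le> h" and J: "1 \<le> J"
  shows "measure M {\<omega> \<in> space M. \<forall>n\<in>{1..J}. xi0 \<omega> (int n) \<le> h} \<le> exp (- real J * h powr (- \<alpha>))"
proof -
  let ?I = "(\<lambda>n. Inl (int n) :: int + nat) ` {1..J}"
  have inj: "inj_on (\<lambda>n. Inl (int n) :: int + nat) {1..J}" by (auto simp: inj_on_def)
  have "{\<omega> \<in> space M. \<forall>n\<in>{1..J}. xi0 \<omega> (int n) \<le> h} = (\<Inter>i\<in>?I. (\<lambda>\<omega>. X \<omega> i) -` {..h} \<inter> space M)"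
    using J by auto
  also have "measure M \<dots> = (\<Prod>i\<in>?I. measure M ((\<lambda>\<omega>. X \<omega> i) -` {..h} \<inter> space M))"
    by (rule indep_varsD[OF indep[folded X_def]]) (use J in auto)
  also have "\<dots> = (\<Prod>n\<in>{1..J}. 1 - (h powr (- \<alpha>)))"
  proof (subst prod.reindex[OF inj], intro prod.cong refl)
    fix n
    have "(\<lambda>\<omega>. xi0 \<omega> (int n)) -` {..h} \<inter> space M = {\<omega> \<in> space M. \<not> h < xi0 \<omega> (int n)}" by auto
    then have "measure M ((\<lambda>\<omega>. xi0 \<omega> (int n)) -` {..h} \<inter> space M) = 1 - (h powr (- \<alpha>))"
      using prob_neg[of "\<lambda>\<omega>. h < xi0 \<omega> (int n)"] tail[OF h] by simp
    then show "((\<lambda>i. measure M ((\<lambda>\<omega>. X \<omega> i) -` {..h} \<inter> space M)) \<circ> (\<lambda>n. Inl (int n))) n = 1 - (h powr (- \<alpha>))"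
      by simp
  qed
  also have "\<dots> = (1 - (h powr (- \<alpha>))) ^ J" by simp
  also have "\<dots> \<le> exp (- (h powr (- \<alpha>))) ^ J"
  proof (rule power_mono)
    show "1 - (h powr (- \<alpha>)) \<le> exp (- (h powr (- \<alpha>)))" using exp_ge_add_one_self[of "- (h powr (- \<alpha>))"] by simp
    have "h powr (- \<alpha>) \<le> h powr 0" using h \<alpha> by (intro powr_mono) auto
    then show "0 \<le> 1 - (h powr (- \<alpha>))" using h by simp
  qed
  also have "\<dots> = exp (- real J * h powr (- \<alpha>))" by (simp add: exp_of_nat_mult[symmetric])
  finally show ?thesis .
qed

end

text \<open>A bounded minorant of a multiple of \<open>u\<^sup>2\<close>. For \<open>\<alpha> = 2\<close> the variable \<open>\<xi>\<^sub>0\<^sup>2\<close> is not integrable, and the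
  mean of the minorant grows like \<open>k\<close>; this is the logarithm in \<open>\<kappa>\<close>.\<close>

definition dyadic_square :: "nat \<Rightarrow> real \<Rightarrow> real" where
  "dyadic_square k u = (\<Sum>i<k. 4 ^ i * indicator {4 * 2 ^ i<..} u)"

lemma dyadic_square_nonneg: "0 \<le> dyadic_square k u"
  by (auto simp: dyadic_square_def intro!: sum_nonneg)

lemma dyadic_square_le_power: "dyadic_square k u \<le> 4 ^ k / 3"
proof -
  have "dyadic_square k u \<le> (\<Sum>i<k. 4 ^ i)"
    unfolding dyadic_square_def by (intro sum_mono) (auto simp: indicator_def)
  also have "\<dots> \<le> 4 ^ k / 3"
    by (induction k) auto
  finally show ?thesis .
qed

lemma dyadic_square_le:
  assumes "0 \<le> u"
  shows "dyadic_square k u \<le> u\<^sup>2 / 12"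
proof (induction k)
  case (Suc k)
  have S: "dyadic_square (Suc k) u = dyadic_square k u + 4 ^ k * indicator {4 * 2 ^ k<..} u"
    by (simp add: dyadic_square_def)
  show ?case
  proof (cases "4 * 2 ^ k < u")
    case True
    have "(4 * 2 ^ k)\<^sup>2 \<le> u\<^sup>2" using True by (intro power_mono) auto
    moreover have "(4 * 2 ^ k :: real)\<^sup>2 = 16 * 4 ^ k"
      by (simp add: power_mult_distrib power2_eq_square flip: power_mult_distrib)
    ultimately have "16 * 4 ^ k \<le> u\<^sup>2" by simp
    then show ?thesis using True dyadic_square_le_power[of k u] by (simp add: S)
  qed (use Suc in \<open>simp add: S\<close>)
qed (simp add: dyadic_square_def)

lemma dyadic_square_pos_imp: "0 < dyadic_square k u \<Longrightarrow> 4 < u"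
proof (rule ccontr)
  assume pos: "0 < dyadic_square k u" and "\<not> 4 < u"
  have "\<not> 4 * 2 ^ i < u" for i
  proof -
    have "4 * 1 \<le> 4 * (2::real) ^ i" by (intro mult_left_mono) auto
    then show ?thesis using \<open>\<not> 4 < u\<close> by linarith
  qed
  then have "dyadic_square k u = 0" by (auto simp: dyadic_square_def indicator_def)
  then show False using pos by simp
qed

lemma measurable_dyadic_square [measurable]: "dyadic_square k \<in> borel_measurable borel"
  unfolding dyadic_square_def by measurable

lemma abs_dyadic_square_le: "\<bar>dyadic_square k u\<bar> \<le> 4 ^ k"
proof -
  have "0 \<le> (4::real) ^ k" by simp
  then show ?thesis using dyadic_square_nonneg[of k u] dyadic_square_le_power[of k u] by linarith
qed

context duplicated_env
begin

text \<open>Three requirements at a site \<open>y > 0\<close>: no duplication, a large value at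
  \<open>y\<close>, a value at most 2 at \<open>-y\<close>. The product form gives an explicit mean
  and makes different sites uncorrelated.\<close>

definition gap_factor :: "nat \<Rightarrow> int + nat \<Rightarrow> real \<Rightarrow> real" where
  "gap_factor k i u = (case i of Inr n \<Rightarrow> (if u = 1 then 0 else 1)
     | Inl w \<Rightarrow> if 0 < w then dyadic_square k u else indicator {..2} u)"

definition gap_block :: "nat \<Rightarrow> (int + nat) set" where
  "gap_block y = {Inr y, Inl (int y), Inl (- int y)}"

definition gap_lower :: "nat \<Rightarrow> nat \<Rightarrow> 'a \<Rightarrow> real" where
  "gap_lower k y \<omega> = (\<Prod>i\<in>gap_block y. gap_factor k i (X \<omega> i))"

text \<open>The mean of \<open>dyadic_square k\<close> under the Pareto law, thresholds being at
  least 1.\<close>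

definition dyadic_mean :: "nat \<Rightarrow> real" where
  "dyadic_mean k = (\<Sum>i<k. 4 ^ i * (4 * 2 ^ i) powr (- \<alpha>))"

lemma measurable_gap_factor [measurable]: "gap_factor k i \<in> borel_measurable borel"
proof (cases i)
  case (Inl w)
  then have "gap_factor k i = (if 0 < w then dyadic_square k else indicator {..2})"
    by (auto simp: gap_factor_def fun_eq_iff)
  then show ?thesis by simp
next
  case (Inr n)
  then have "gap_factor k i = (\<lambda>u. if u = 1 then 0 else 1)" by (auto simp: gap_factor_def)
  then show ?thesis by simp
qed

lemma gap_factor_bounds: "0 \<le> gap_factor k i u" "\<bar>gap_factor k i u\<bar> \<le> 4 ^ k"
  using dyadic_square_nonneg[of k u] abs_dyadic_square_le[of k u]
  by (auto simp: gap_factor_def indicator_def split: sum.splits)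

lemma gap_lower_eq:
  assumes "0 < y"
  shows "gap_lower k y \<omega> = (if coin \<omega> y then 0 else 1) * dyadic_square k (xi0 \<omega> (int y)) * indicator {..2} (xi0 \<omega> (- int y))"
  using assms by (simp add: gap_lower_def gap_block_def gap_factor_def)

lemma measurable_gap_lower [measurable]: "gap_lower k y \<in> borel_measurable M"
  unfolding gap_lower_def using measurable_compose[OF X_component_meas measurable_gap_factor] by measurable

lemma gap_lower_bounds:
  assumes "0 < y"
  shows "0 \<le> gap_lower k y \<omega>" "gap_lower k y \<omega> \<le> 4 ^ k"
  using dyadic_square_nonneg[of k "xi0 \<omega> (int y)"] abs_dyadic_square_le[of k "xi0 \<omega> (int y)"]
  by (auto simp: gap_lower_eq[OF assms] indicator_def)

text \<open>Where the minorant is positive, the value at \<open>y\<close> is a number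
  \<open>u > 4\<close> and the value at \<open>-y\<close> is at most 2. The gap is then at least 1
  and at least \<open>u / 2\<close>, whose square exceeds \<open>u\<^sup>2 / 12\<close>.\<close>

lemma gap_lower_le_gap_weight:
  assumes y: "0 < y" and Mb: "0 < Mb" and pos: "0 \<le> xi0 \<omega> (- int y)"
  shows "gap_lower k y \<omega> / (4 * exp 1 * Mb)\<^sup>2 \<le> (gap_weight Mb (potential (xi0 \<omega>) (coin \<omega>)) y)\<^sup>2"
proof (cases "0 < gap_lower k y \<omega>")
  case True
  let ?u = "xi0 \<omega> (int y)" and ?v = "xi0 \<omega> (- int y)"
  have c: "\<not> coin \<omega> y" and v: "?v \<le> 2" and du: "0 < dyadic_square k ?u"
    and g: "gap_lower k y \<omega> = dyadic_square k ?u"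
    using True dyadic_square_nonneg[of k ?u] by (auto simp: gap_lower_eq[OF y] indicator_def less_le split: if_splits)
  have u: "4 < ?u" by (rule dyadic_square_pos_imp[OF du])
  have pu: "potential (xi0 \<omega>) (coin \<omega>) (int y) = ?u" "potential (xi0 \<omega>) (coin \<omega>) (- int y) = ?v"
    using y c by (auto simp: potential_def)
  have D: "\<bar>?u - ?v\<bar> = ?u - ?v" "1 \<le> ?u - ?v" "?u / 2 \<le> ?u - ?v" using u v by auto
  have "dyadic_square k ?u \<le> ?u\<^sup>2 / 12" using u by (intro dyadic_square_le) simp
  also have "\<dots> \<le> (?u / 2)\<^sup>2" by (simp add: power_divide)
  also have "\<dots> \<le> (?u - ?v)\<^sup>2" using D u by (intro power_mono) auto
  finally have "dyadic_square k ?u / (4 * exp 1 * Mb)\<^sup>2 \<le> (?u - ?v)\<^sup>2 / (4 * exp 1 * Mb)\<^sup>2"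
    by (intro divide_right_mono) auto
  also have "\<dots> = (gap_weight Mb (potential (xi0 \<omega>) (coin \<omega>)) y)\<^sup>2"
    using D by (simp add: gap_weight_def pu power_divide)
  finally show ?thesis by (simp add: g)
next
  case False
  then have "gap_lower k y \<omega> = 0" using gap_lower_bounds[OF y, of k \<omega>] by simp
  then show ?thesis by simp
qed

lemma indep_gap_factors: "indep_vars (\<lambda>_. borel) (\<lambda>i \<omega>. gap_factor k i (X \<omega> i)) UNIV"
  using indep_vars_compose2[OF indep[folded X_def] measurable_gap_factor] by simp

lemma integrable_gap_factor: "integrable M (\<lambda>\<omega>. gap_factor k i (X \<omega> i))"
proof (rule integrable_const_bound[of _ "4 ^ k"])
  show "AE \<omega> in M. norm (gap_factor k i (X \<omega> i)) \<le> 4 ^ k" using gap_factor_bounds by simp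
  show "(\<lambda>\<omega>. gap_factor k i (X \<omega> i)) \<in> borel_measurable M"
    by (rule measurable_compose[OF X_component_meas measurable_gap_factor])
qed

lemma expectation_gap_product:
  assumes "finite I"
  shows "(\<integral>\<omega>. (\<Prod>i\<in>I. gap_factor k i (X \<omega> i)) \<partial>M) = (\<Prod>i\<in>I. \<integral>\<omega>. gap_factor k i (X \<omega> i) \<partial>M)"
  using assms by (intro indep_vars_lebesgue_integral indep_vars_subset[OF indep_gap_factors] integrable_gap_factor) auto

lemma expectation_gap_lower:
  assumes y: "0 < y"
  shows "(\<integral>\<omega>. gap_lower k y \<omega> \<partial>M) = dyadic_mean k * (1 - 2 powr (- \<alpha>)) * (1 - p y)"
proof -
  have 1: "(\<integral>\<omega>. gap_factor k (Inr y) (X \<omega> (Inr y)) \<partial>M) = 1 - p y"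
  proof -
    have "(\<integral>\<omega>. gap_factor k (Inr y) (X \<omega> (Inr y)) \<partial>M) = (\<integral>\<omega>. indicator {\<omega> \<in> space M. \<not> coin \<omega> y} \<omega> \<partial>M)"
      by (intro Bochner_Integration.integral_cong refl) (auto simp: gap_factor_def indicator_def)
    then show ?thesis by (simp add: prob_not_coin)
  qed
  have 2: "(\<integral>\<omega>. gap_factor k (Inl (int y)) (X \<omega> (Inl (int y))) \<partial>M) = dyadic_mean k"
  proof -
    have "(\<integral>\<omega>. gap_factor k (Inl (int y)) (X \<omega> (Inl (int y))) \<partial>M)
       = (\<integral>\<omega>. (\<Sum>i<k. 4 ^ i * indicator {\<omega> \<in> space M. 4 * 2 ^ i < xi0 \<omega> (int y)} \<omega>) \<partial>M)"
      using y by (intro Bochner_Integration.integral_cong refl) (auto simp: gap_factor_def dyadic_square_def indicator_def)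
    also have "\<dots> = (\<Sum>i<k. 4 ^ i * measure M {\<omega> \<in> space M. 4 * 2 ^ i < xi0 \<omega> (int y)})"
      by (subst Bochner_Integration.integral_sum) (auto simp: emeasure_eq_measure)
    also have "\<dots> = dyadic_mean k"
      unfolding dyadic_mean_def
    proof (intro sum.cong refl)
      fix i
      have "1 * 1 \<le> 4 * (2::real) ^ i" by (intro mult_mono) auto
      then show "4 ^ i * measure M {\<omega> \<in> space M. 4 * 2 ^ i < xi0 \<omega> (int y)} = 4 ^ i * (4 * 2 ^ i) powr (- \<alpha>)"
        using tail[of "4 * 2 ^ i" "int y"] by simp
    qed
    finally show ?thesis .
  qed
  have 3: "(\<integral>\<omega>. gap_factor k (Inl (- int y)) (X \<omega> (Inl (- int y))) \<partial>M) = 1 - 2 powr (- \<alpha>)"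
  proof -
    have "(\<integral>\<omega>. gap_factor k (Inl (- int y)) (X \<omega> (Inl (- int y))) \<partial>M) = (\<integral>\<omega>. indicator {\<omega> \<in> space M. \<not> 2 < xi0 \<omega> (- int y)} \<omega> \<partial>M)"
      by (intro Bochner_Integration.integral_cong refl) (auto simp: gap_factor_def indicator_def)
    then show ?thesis using prob_neg[of "\<lambda>\<omega>. 2 < xi0 \<omega> (- int y)"] tail[of 2 "- int y"] by simp
  qed
  have "(\<integral>\<omega>. gap_lower k y \<omega> \<partial>M) = (\<Prod>i\<in>gap_block y. \<integral>\<omega>. gap_factor k i (X \<omega> i) \<partial>M)"
    unfolding gap_lower_def by (rule expectation_gap_product) (simp add: gap_block_def)
  also have "\<dots> = (1 - p y) * (dyadic_mean k * (1 - 2 powr (- \<alpha>)))"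
    using y 1 2 3 by (simp add: gap_block_def del: X_simps)
  finally show ?thesis by simp
qed

lemma expectation_gap_lower_mult:
  assumes y: "0 < y" "0 < y'" "y \<noteq> y'"
  shows "(\<integral>\<omega>. gap_lower k y \<omega> * gap_lower k y' \<omega> \<partial>M) = (\<integral>\<omega>. gap_lower k y \<omega> \<partial>M) * (\<integral>\<omega>. gap_lower k y' \<omega> \<partial>M)"
proof -
  have fin: "finite (gap_block y)" for y by (simp add: gap_block_def)
  have disj: "gap_block y \<inter> gap_block y' = {}" using y by (auto simp: gap_block_def)
  have "gap_lower k y \<omega> * gap_lower k y' \<omega> = (\<Prod>i\<in>gap_block y \<union> gap_block y'. gap_factor k i (X \<omega> i))" for \<omega>
    unfolding gap_lower_def by (rule prod.union_disjoint[symmetric, OF fin fin disj])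
  then have "(\<integral>\<omega>. gap_lower k y \<omega> * gap_lower k y' \<omega> \<partial>M) = (\<Prod>i\<in>gap_block y \<union> gap_block y'. \<integral>\<omega>. gap_factor k i (X \<omega> i) \<partial>M)"
    using expectation_gap_product[of "gap_block y \<union> gap_block y'" k] fin by simp
  also have "\<dots> = (\<integral>\<omega>. gap_lower k y \<omega> \<partial>M) * (\<integral>\<omega>. gap_lower k y' \<omega> \<partial>M)"
    unfolding gap_lower_def using fin disj by (simp add: prod.union_disjoint expectation_gap_product)
  finally show ?thesis .
qed

lemma integrable_gap_lower:
  assumes "0 < y"
  shows "integrable M (gap_lower k y)"
  by (rule integrable_const_bound[of _ "4 ^ k"]) (use gap_lower_bounds[OF assms, of k] in auto)

lemma integrable_gap_lower_mult:
  assumes "0 < y" "0 < y'"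
  shows "integrable M (\<lambda>\<omega>. gap_lower k y \<omega> * gap_lower k y' \<omega>)"
proof (rule integrable_const_bound[of _ "4 ^ k * 4 ^ k"])
  have "\<bar>gap_lower k y \<omega> * gap_lower k y' \<omega>\<bar> \<le> 4 ^ k * 4 ^ k" for \<omega>
    unfolding abs_mult using gap_lower_bounds[OF assms(1), of k \<omega>] gap_lower_bounds[OF assms(2), of k \<omega>]
    by (intro mult_mono) auto
  then show "AE \<omega> in M. norm (gap_lower k y \<omega> * gap_lower k y' \<omega>) \<le> 4 ^ k * 4 ^ k" by simp
qed measurable

text \<open>Chebyshev's inequality. The terms are uncorrelated and take values in
  \<open>[0, 4 ^ k]\<close>, so the variance of the sum is at most
  \<open>4 ^ k * \<mu>\<close>.\<close>

lemma prob_gap_sum_small: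
  assumes y0: "1 \<le> y0" and \<mu>: "\<mu> = dyadic_mean k * (1 - 2 powr (- \<alpha>)) * (\<Sum>y\<in>{y0..d}. 1 - p y)" "0 < \<mu>"
  shows "measure M {\<omega> \<in> space M. (\<Sum>y\<in>{y0..d}. gap_lower k y \<omega>) \<le> \<mu> / 2} \<le> 4 * 4 ^ k / \<mu>"
proof -
  let ?S = "\<lambda>\<omega>. \<Sum>y\<in>{y0..d}. gap_lower k y \<omega>"
  have pos: "0 < y" if "y \<in> {y0..d}" for y using that y0 by auto
  have ES: "expectation ?S = \<mu>"
    using pos by (subst Bochner_Integration.integral_sum) (auto simp: integrable_gap_lower expectation_gap_lower \<mu>(1) sum_distrib_left)
  have sq: "(?S \<omega>)\<^sup>2 = (\<Sum>y\<in>{y0..d}. \<Sum>y'\<in>{y0..d}. gap_lower k y \<omega> * gap_lower k y' \<omega>)" for \<omega>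
    by (simp add: power2_eq_square sum_product)
  have int_sq: "integrable M (\<lambda>\<omega>. (?S \<omega>)\<^sup>2)"
    unfolding sq using pos by (intro Bochner_Integration.integrable_sum integrable_gap_lower_mult) auto
  have "expectation (\<lambda>\<omega>. (?S \<omega>)\<^sup>2) = (\<Sum>y\<in>{y0..d}. \<Sum>y'\<in>{y0..d}. expectation (\<lambda>\<omega>. gap_lower k y \<omega> * gap_lower k y' \<omega>))"
    unfolding sq using pos
    by (subst Bochner_Integration.integral_sum, intro Bochner_Integration.integrable_sum integrable_gap_lower_mult)
       (auto intro!: sum.cong Bochner_Integration.integral_sum integrable_gap_lower_mult)
  also have "\<dots> \<le> (\<Sum>y\<in>{y0..d}. \<Sum>y'\<in>{y0..d}. expectation (gap_lower k y) * expectation (gap_lower k y') + (if y = y' then 4 ^ k * expectation (gap_lower k y) else 0))"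
  proof (intro sum_mono)
    fix y y' assume y: "y \<in> {y0..d}" and y': "y' \<in> {y0..d}"
    have e0: "0 \<le> expectation (gap_lower k v)" if "v \<in> {y0..d}" for v
      using gap_lower_bounds[OF pos[OF that]] by (intro Bochner_Integration.integral_nonneg) auto
    show "expectation (\<lambda>\<omega>. gap_lower k y \<omega> * gap_lower k y' \<omega>) \<le> expectation (gap_lower k y) * expectation (gap_lower k y') + (if y = y' then 4 ^ k * expectation (gap_lower k y) else 0)"
    proof (cases "y = y'")
      case True
      have "expectation (\<lambda>\<omega>. gap_lower k y \<omega> * gap_lower k y \<omega>) \<le> expectation (\<lambda>\<omega>. 4 ^ k * gap_lower k y \<omega>)"
        using gap_lower_bounds[OF pos[OF y]] pos[OF y]
        by (intro integral_mono integrable_gap_lower_mult Bochner_Integration.integrable_mult_right integrable_gap_lower mult_right_mono) auto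
      then show ?thesis using True e0[OF y] by (simp add: add_nonneg_nonneg add_increasing)
    next
      case False
      then show ?thesis using expectation_gap_lower_mult[OF pos[OF y] pos[OF y'] False] by simp
    qed
  qed
  also have "\<dots> = (\<Sum>y\<in>{y0..d}. expectation (gap_lower k y)) * (\<Sum>y\<in>{y0..d}. expectation (gap_lower k y)) + 4 ^ k * (\<Sum>y\<in>{y0..d}. expectation (gap_lower k y))"
    unfolding sum_product by (simp add: sum.distrib sum_distrib_left)
  also have "(\<Sum>y\<in>{y0..d}. expectation (gap_lower k y)) = \<mu>"
    using pos by (simp add: expectation_gap_lower \<mu>(1) sum_distrib_left)
  finally have E2: "expectation (\<lambda>\<omega>. (?S \<omega>)\<^sup>2) \<le> \<mu>\<^sup>2 + 4 ^ k * \<mu>" by (simp add: power2_eq_square)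
  have intS: "integrable M ?S" using pos by (intro Bochner_Integration.integrable_sum integrable_gap_lower)
  have var: "variance ?S \<le> 4 ^ k * \<mu>"
    using variance_eq[OF intS int_sq] E2 by (simp add: ES)
  have "measure M {\<omega> \<in> space M. ?S \<omega> \<le> \<mu> / 2} \<le> measure M {\<omega> \<in> space M. \<mu> / 2 \<le> \<bar>?S \<omega> - \<mu>\<bar>}"
    by (intro finite_measure_mono) (auto simp: abs_if)
  also have "\<dots> \<le> variance ?S / (\<mu> / 2)\<^sup>2"
    using Chebyshev_inequality[of ?S "\<mu> / 2"] int_sq \<mu>(2) by (simp add: ES)
  also have "\<dots> \<le> 4 ^ k * \<mu> / (\<mu> / 2)\<^sup>2" using var by (intro divide_right_mono) auto
  also have "\<dots> = 4 * 4 ^ k / \<mu>" using \<mu>(2) by (simp add: power2_eq_square field_simps)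
  finally show ?thesis .
qed

end

lemma (in duplicated_env) AE_xi0_ge_1: "AE \<omega> in M. \<forall>w. 1 \<le> xi0 \<omega> w"
  unfolding AE_all_countable
proof
  fix w
  show "AE \<omega> in M. 1 \<le> xi0 \<omega> w" using AE_xi0_gt_1[of w] by eventually_elim simp
qed

context env_scales
begin

lemma prob_not_good_env:
  assumes r': "r = a powr \<alpha>" "1 \<le> r" and B': "1 \<le> B * a" and h: "1 \<le> h" and J: "1 \<le> J"
  shows "measure M {\<omega> \<in> space M. \<not> good_env J h \<omega>}
    \<le> 6 * B powr (- \<alpha>) + (2 * real d + 1) * (m0 / 2) powr (- \<alpha>) + 2 * m0 powr (- \<alpha>) * eta p N + exp (- real J * h powr (- \<alpha>))"
proof -
  let ?A1 = "{\<omega> \<in> space M. \<exists>w. env (real_of_int \<bar>w\<bar>) < xi0 \<omega> w}"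
  let ?A2 = "{\<omega> \<in> space M. \<exists>w\<in>{- int d..int d}. m0 / 2 < xi0 \<omega> w}"
  let ?A3 = "{\<omega> \<in> space M. \<exists>n\<in>{1..N}. \<not> coin \<omega> n \<and> (m0 < xi0 \<omega> (int n) \<or> m0 < xi0 \<omega> (- int n))}"
  let ?A4 = "{\<omega> \<in> space M. \<forall>n\<in>{1..J}. xi0 \<omega> (int n) \<le> h}"
  note ae = AE_xi0_ge_1
  have [measurable]: "?A1 \<in> sets M" "?A2 \<in> sets M" "?A3 \<in> sets M" "?A4 \<in> sets M" by measurable
  have "measure M {\<omega> \<in> space M. \<not> good_env J h \<omega>} \<le> measure M (?A1 \<union> (?A2 \<union> (?A3 \<union> ?A4)))"
  proof (rule finite_measure_mono_AE)
    show "AE \<omega> in M. \<omega> \<in> {\<omega> \<in> space M. \<not> good_env J h \<omega>} \<longrightarrow> \<omega> \<in> ?A1 \<union> (?A2 \<union> (?A3 \<union> ?A4))"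
      using ae
    proof eventually_elim
      case (elim \<omega>)
      then show ?case by (simp add: good_env_def) (auto simp: not_le not_less)
    qed
  qed measurable
  also have "\<dots> \<le> measure M ?A1 + (measure M ?A2 + (measure M ?A3 + measure M ?A4))"
    by (intro order_trans[OF measure_Un_le] add_left_mono) auto
  also have "measure M ?A1 \<le> 6 * B powr (- \<alpha>)"
    using prob_envelope_exceeded[OF a r' B B'] by (simp add: env_def)
  also have "measure M ?A2 \<le> (2 * real d + 1) * (m0 / 2) powr (- \<alpha>)"
    by (rule prob_low_exceeded) (use m0 in simp)
  also have "measure M ?A3 \<le> 2 * m0 powr (- \<alpha>) * eta p N"
    by (rule prob_asym_exceeded) (use m0 in simp)
  also have "measure M ?A4 \<le> exp (- real J * h powr (- \<alpha>))"
    by (rule prob_no_peak[OF h J])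
  finally show ?thesis by simp
qed

lemma prob_gap_weights_small:
  assumes \<mu>: "\<mu> = dyadic_mean k * (1 - 2 powr (- \<alpha>)) * (\<Sum>y\<in>{y0..d}. 1 - p y)" "0 < \<mu>"
    and v: "2 * (v\<^sup>2 * (4 * exp 1 * Mb)\<^sup>2) \<le> \<mu>"
  shows "measure M {\<omega> \<in> space M. (\<Sum>y\<in>{y0..d}. (gap_weight Mb (potential (xi0 \<omega>) (coin \<omega>)) y)\<^sup>2) < v\<^sup>2} \<le> 4 * 4 ^ k / \<mu>"
proof -
  note ae = AE_xi0_ge_1
  have "measure M {\<omega> \<in> space M. (\<Sum>y\<in>{y0..d}. (gap_weight Mb (potential (xi0 \<omega>) (coin \<omega>)) y)\<^sup>2) < v\<^sup>2}
    \<le> measure M {\<omega> \<in> space M. (\<Sum>y\<in>{y0..d}. gap_lower k y \<omega>) \<le> \<mu> / 2}"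
  proof (rule finite_measure_mono_AE)
    show "AE \<omega> in M. \<omega> \<in> {\<omega> \<in> space M. (\<Sum>y\<in>{y0..d}. (gap_weight Mb (potential (xi0 \<omega>) (coin \<omega>)) y)\<^sup>2) < v\<^sup>2} \<longrightarrow>
      \<omega> \<in> {\<omega> \<in> space M. (\<Sum>y\<in>{y0..d}. gap_lower k y \<omega>) \<le> \<mu> / 2}"
      using ae
    proof eventually_elim
      case (elim \<omega>)
      have c: "0 < (4 * exp 1 * Mb)\<^sup>2" using M by simp
      have pw: "gap_lower k y \<omega> / (4 * exp 1 * Mb)\<^sup>2 \<le> (gap_weight Mb (potential (xi0 \<omega>) (coin \<omega>)) y)\<^sup>2" if "y \<in> {y0..d}" for y
      proof (rule gap_lower_le_gap_weight)
        show "0 < y" using that y0 by auto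
        show "0 < Mb" using M by simp
        have "1 \<le> xi0 \<omega> (- int y)" using elim by blast
        then show "0 \<le> xi0 \<omega> (- int y)" by simp
      qed
      have "(\<Sum>y\<in>{y0..d}. gap_lower k y \<omega>) / (4 * exp 1 * Mb)\<^sup>2 \<le> (\<Sum>y\<in>{y0..d}. (gap_weight Mb (potential (xi0 \<omega>) (coin \<omega>)) y)\<^sup>2)"
        unfolding sum_divide_distrib by (rule sum_mono) (rule pw)
      then have "(\<Sum>y\<in>{y0..d}. gap_lower k y \<omega>) \<le> (\<Sum>y\<in>{y0..d}. (gap_weight Mb (potential (xi0 \<omega>) (coin \<omega>)) y)\<^sup>2) * (4 * exp 1 * Mb)\<^sup>2"
        using c by (simp only: pos_divide_le_eq)
      moreover have "(\<Sum>y\<in>{y0..d}. (gap_weight Mb (potential (xi0 \<omega>) (coin \<omega>)) y)\<^sup>2) * (4 * exp 1 * Mb)\<^sup>2 \<le> v\<^sup>2 * (4 * exp 1 * Mb)\<^sup>2"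
        if "(\<Sum>y\<in>{y0..d}. (gap_weight Mb (potential (xi0 \<omega>) (coin \<omega>)) y)\<^sup>2) < v\<^sup>2"
        using that by (intro mult_right_mono) auto
      ultimately have "(\<Sum>y\<in>{y0..d}. gap_lower k y \<omega>) \<le> \<mu> / 2"
        if "(\<Sum>y\<in>{y0..d}. (gap_weight Mb (potential (xi0 \<omega>) (coin \<omega>)) y)\<^sup>2) < v\<^sup>2"
        using v that by linarith
      then show ?case by blast
    qed
  qed measurable
  also have "\<dots> \<le> 4 * 4 ^ k / \<mu>" by (rule prob_gap_sum_small[OF y0 \<mu>])
  finally show ?thesis .
qed

end

section \<open>Choice of the scales\<close>

text \<open>A single term of the exponential series at \<open>n\<close>.\<close>

lemma fact_ge_power_exp: "(real n / exp 1) ^ n \<le> fact n"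
proof -
  have "real n ^ n / fact n \<le> exp (real n)"
    using sum_le_suminf[OF summable_exp[of "real n"], of "{n}"]
    by (simp add: exp_def divide_inverse mult.commute)
  then have "real n ^ n \<le> exp (real n) * fact n" by (simp add: field_simps)
  then show ?thesis by (simp add: power_divide exp_of_nat_mult[symmetric] field_simps)
qed

text \<open>The relations \<open>r = a powr \<alpha>\<close> and \<open>r * L = t * a\<close>
  balance the two terms of \<open>Psi\<close> at heights of order \<open>a\<close> and distances of
  order \<open>r\<close>. Exponents of order \<open>r\<close> or \<open>r * ln L\<close> lose
  against \<open>r * ln a\<close>. \<open>C2\<close> is a fourth power because at distance
  \<open>C2 * r\<close> the envelope has fallen behind linear growth by a factor of order
  \<open>C2 powr (- (1 / 4))\<close>. The condition on \<open>y0\<close> makes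
  \<open>r / a ^ (2 * y0)\<close> at most \<open>1 / a ^ 2\<close>.\<close>

lemma scalesI:
  fixes t a r L B b C2 C3 \<delta> \<theta>0 \<alpha> :: real and N d y0 :: nat
  assumes \<alpha>: "2 \<le> \<alpha>" and B: "1 \<le> B" and b: "0 < b" "b \<le> 1" and \<delta>: "0 < \<delta>" "\<delta> \<le> 1"
    and C2: "C2 = (16 * B * (\<alpha> - 1)) ^ 4" and C3: "C3 = B * (C2 + 2)" and \<theta>0: "\<theta>0 = 1 / (24 * exp 1 * C3)"
    and y0: "\<alpha> + 2 \<le> 2 * real y0"
    and t: "0 < t" and L: "L = ln t" and a: "32 / b \<le> a" and r: "r = a powr \<alpha>" "r * L = t * a"
    and N: "C2 * r \<le> real N" "real N \<le> C2 * r + 1" and d: "\<delta> * r \<le> real d + 1" "real d \<le> \<delta> * r"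
    and L1: "4 * C2 \<le> L" and La: "L \<le> 2 * (\<alpha> - 1) * ln a" and lnL: "ln L \<le> ln a / 4" "2 * C2 * ln L \<le> \<delta> / 8 * ln a"
    and \<Lambda>: "4 \<le> ln a" "2 * ln (4 / b) \<le> ln a" "ln (2 / \<theta>0) \<le> ln a" "2 * C3 + 2 * C2 \<le> \<delta> / 8 * ln a"
    and r8: "8 / \<delta> \<le> r" and near: "4 * C2 * (16 / b) ^ (2 * y0) / \<theta>0 \<le> a"
  shows "scales t a (b / 4 * a) (C3 * a) (\<theta>0 / a) L B r N d y0"
proof -
  have a1: "1 \<le> a"
  proof -
    have "32 * 1 \<le> 32 / b" using b by (simp add: field_simps)
    then show ?thesis using a by linarith
  qed
  have a0: "0 < a" using a1 by simp
  have B1: "16 \<le> 16 * B * (\<alpha> - 1)"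
    using mult_mono[of 1 B 1 "\<alpha> - 1"] B \<alpha> by simp
  have C2big: "16 \<le> C2"
  proof -
    have "(16::real) ^ 1 \<le> 16 ^ 4" by (rule power_increasing) auto
    also have "\<dots> \<le> (16 * B * (\<alpha> - 1)) ^ 4" using B1 by (intro power_mono) auto
    finally show ?thesis by (simp add: C2)
  qed
  have e3: "exp 1 \<le> (3::real)" by (rule exp_le)
  have C3big: "1 \<le> C3" using mult_mono[of 1 B 1 "C2 + 2"] B C2big by (simp add: C3)
  have L0: "64 \<le> L" using L1 C2big by linarith
  have r1: "1 \<le> r" using a1 \<alpha> by (simp add: r(1) ge_one_powr_ge_zero)
  have \<theta>0p: "0 < \<theta>0" using C3big by (simp add: \<theta>0)
  have N16: "16 \<le> real N" using mult_mono[of 16 C2 1 r] C2big r1 N by simp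
  have N2: "real N \<le> 2 * C2 * r"
  proof -
    have "1 * 1 \<le> C2 * r" using C2big r1 by (intro mult_mono) auto
    then show ?thesis using N by simp
  qed
  have dr: "\<delta> * r / 2 \<le> real d"
  proof -
    have "8 \<le> \<delta> * r" using r8 \<delta> by (simp add: field_simps)
    then show ?thesis using d by linarith
  qed
  let ?\<Lambda> = "ln a"
  define env where "env x = B * a * (1 + x / r) powr (3 / 4)" for x
  \<comment> \<open>Beyond \<open>N\<close> the envelope is worth at most \<open>ln a / 4\<close>
    per step, while a step costs about \<open>ln a\<close>.\<close>
  have env_bd: "t * env (real n) \<le> ?\<Lambda> / 4 * real n" if n: "N \<le> n" for n
  proof -
    define s where "s = real n / r"
    have sC: "C2 \<le> s" using N n r1 by (simp add: s_def pos_le_divide_eq)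
    have s1: "1 \<le> s" using sC C2big by linarith
    have "(1 + s) powr (3 / 4) \<le> (2 * s) powr (3 / 4)" using s1 by (intro powr_mono2) auto
    also have "\<dots> = 2 powr (3 / 4) * s powr (3 / 4)" using s1 by (simp add: powr_mult)
    also have "\<dots> \<le> 2 powr 1 * s powr (3 / 4)" by (intro mult_right_mono powr_mono) auto
    also have "s powr (3 / 4) = s * s powr (- (1 / 4))"
      using s1 powr_add[of s 1 "- (1 / 4)"] by simp
    also have "s powr (- (1 / 4)) \<le> C2 powr (- (1 / 4))"
      using sC C2big by (intro powr_mono2') auto
    also have "C2 powr (- (1 / 4)) = 1 / (16 * B * (\<alpha> - 1))"
    proof -
      have "C2 powr (1 / 4) = 16 * B * (\<alpha> - 1)"
      proof -
        have "C2 = (16 * B * (\<alpha> - 1)) powr 4"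
          using B1 powr_realpow[of "16 * B * (\<alpha> - 1)" 4] by (simp add: C2)
        then have "C2 powr (1 / 4) = (16 * B * (\<alpha> - 1)) powr (4 * (1 / 4))"
          by (simp only: powr_powr)
        then show ?thesis using B1 by simp
      qed
      then show ?thesis by (simp add: powr_minus_divide)
    qed
    finally have p: "(1 + s) powr (3 / 4) \<le> 2 * (s * (1 / (16 * B * (\<alpha> - 1))))"
      using s1 by simp
    have "t * env (real n) = B * (t * a) * (1 + s) powr (3 / 4)" by (simp add: env_def s_def)
    also have "\<dots> \<le> B * (t * a) * (2 * (s * (1 / (16 * B * (\<alpha> - 1)))))"
      using B t a0 by (intro mult_left_mono p) auto
    also have "\<dots> = L * real n / (8 * (\<alpha> - 1))"
      unfolding r(2)[symmetric] s_def using r1 B \<alpha> by (simp add: field_simps)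
    also have "\<dots> \<le> (2 * (\<alpha> - 1) * ?\<Lambda>) * real n / (8 * (\<alpha> - 1))"
      using La \<alpha> by (intro divide_right_mono mult_right_mono) auto
    also have "\<dots> = ?\<Lambda> / 4 * real n" using \<alpha> by (simp add: field_simps)
    finally show ?thesis .
  qed
  have lnL0: "0 < L" "0 \<le> ln L" using L0 by auto
  show ?thesis
  proof
    show "0 < t" "0 < a" "0 < B" "0 < r" using t a0 B r1 by auto
    show "8 \<le> b / 4 * a" using a b by (simp add: field_simps)
    show "t * (B * a * (1 + real n / r) powr (3 / 4)) < real n * ln (b / 4 * a)" if n: "N \<le> n" for n
    proof -
      have "ln (b / 4 * a) = ?\<Lambda> - ln (4 / b)" using b a0 by (simp add: ln_mult ln_div)
      then have "?\<Lambda> / 4 < ln (b / 4 * a)" using \<Lambda> by linarith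
      then have "?\<Lambda> / 4 * real n < ln (b / 4 * a) * real n" using n N16 by (intro mult_strict_right_mono) auto
      then show ?thesis using env_bd[OF n] by (simp add: env_def mult.commute)
    qed
    show "2 ^ n * (exp (B * a * (1 + real n / r) powr (3 / 4) * t) * (t ^ n / fact n)) \<le> \<theta>0 / a * exp (- real N) / 2 * (1 / 2) ^ n"
      if n: "N \<le> n" for n
    proof -
      have n0: "0 < real n" using n N16 by linarith
      have e: "exp (env (real n) * t) \<le> exp (?\<Lambda> / 4 * real n)" using env_bd[OF n] by (simp add: mult.commute)
      \<comment> \<open>By \<open>n ! \<ge> (n / e) ^ n\<close> the factor
        \<open>(4 * t) ^ n / n !\<close> is at most the \<open>n\<close>-th power of this quotient.
        In the 4, one factor 2 counts the jump sequences and the other pays for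
        \<open>(1 / 2) ^ n\<close>.\<close>
      have "4 * exp 1 * t / real n \<le> L / a"
      proof -
        have "4 * exp 1 * r \<le> C2 * r" using e3 C2big r1 by (intro mult_right_mono) auto
        also have "\<dots> \<le> real n" using N n by linarith
        finally have "L * (4 * exp 1 * r) \<le> L * real n" using lnL0 by (intro mult_left_mono) auto
        moreover have "L * (4 * exp 1 * r) = 4 * exp 1 * (r * L)" by simp
        ultimately have "4 * exp 1 * (t * a) \<le> L * real n" by (simp only: r(2))
        then show ?thesis using n0 a0 by (simp add: field_simps)
      qed
      then have "(4 * exp 1 * t / real n) ^ n \<le> (L / a) ^ n" using t by (intro power_mono) auto
      also have "L / a = exp (ln L - ?\<Lambda>)" using lnL0 a0 by (simp add: exp_diff)
      also have "exp (ln L - ?\<Lambda>) ^ n = exp (real n * (ln L - ?\<Lambda>))" by (simp add: exp_of_nat_mult)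
      finally have q: "(4 * exp 1 * t / real n) ^ n \<le> exp (real n * (ln L - ?\<Lambda>))" .
      have "(4 * t) ^ n / fact n \<le> (4 * t) ^ n / (real n / exp 1) ^ n"
        using n0 t fact_ge_power_exp[of n] by (intro divide_left_mono) auto
      also have "\<dots> = (4 * exp 1 * t / real n) ^ n" by (simp add: power_divide power_mult_distrib)
      also note q
      finally have f: "(4 * t) ^ n / fact n \<le> exp (real n * (ln L - ?\<Lambda>))" .
      have "2 ^ n * (exp (env (real n) * t) * (t ^ n / fact n)) * 2 ^ n = exp (env (real n) * t) * ((4 * t) ^ n / fact n)"
      proof -
        have "(4 * t) ^ n = (2 * 2 * t) ^ n" by simp
        also have "\<dots> = 2 ^ n * 2 ^ n * t ^ n" by (simp only: power_mult_distrib)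
        finally show ?thesis by (simp only: times_divide_eq_right times_divide_eq_left mult_ac)
      qed
      also have "\<dots> \<le> exp (?\<Lambda> / 4 * real n) * exp (real n * (ln L - ?\<Lambda>))"
        using e f t by (intro mult_mono) auto
      also have "\<dots> = exp (?\<Lambda> / 4 * real n + real n * (ln L - ?\<Lambda>))" by (simp add: exp_add)
      also have "\<dots> \<le> exp (- (ln (2 / \<theta>0) + ?\<Lambda> + real N))"
      proof -
        \<comment> \<open>What remains is an exponent of at most \<open>- n * ln a / 2\<close>. One
          half of it covers \<open>N\<close>; the other half is at least \<open>4 * ln a\<close> and
          covers \<open>ln (2 / \<theta>0) + ln a\<close>.\<close>
        have "real n * ln L \<le> real n * (?\<Lambda> / 4)" using lnL by (intro mult_left_mono) auto
        then have "?\<Lambda> / 4 * real n + real n * (ln L - ?\<Lambda>) \<le> - (real n * (?\<Lambda> / 2))" by (simp add: algebra_simps)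
        moreover have "real N * (?\<Lambda> / 2) \<le> real n * (?\<Lambda> / 2)" using n \<Lambda> by (intro mult_right_mono) auto
        moreover have "16 * (?\<Lambda> / 4) \<le> real N * (?\<Lambda> / 4)" using N16 \<Lambda> by (intro mult_right_mono) auto
        moreover have "real N * 1 \<le> real N * (?\<Lambda> / 4)" using \<Lambda> by (intro mult_left_mono) auto
        ultimately have "?\<Lambda> / 4 * real n + real n * (ln L - ?\<Lambda>) \<le> - (ln (2 / \<theta>0) + ?\<Lambda> + real N)" using \<Lambda> by linarith
        then show ?thesis by simp
      qed
      also have "\<dots> = \<theta>0 / a * exp (- real N) / 2"
        using \<theta>0p a0 by (simp add: exp_diff exp_minus exp_add field_simps)
      finally have "2 ^ n * (exp (env (real n) * t) * (t ^ n / fact n)) * 2 ^ n \<le> \<theta>0 / a * exp (- real N) / 2" .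
      then have "2 ^ n * (exp (env (real n) * t) * (t ^ n / fact n)) \<le> \<theta>0 / a * exp (- real N) / 2 / 2 ^ n"
        by (subst pos_le_divide_eq) auto
      then show ?thesis by (simp add: env_def power_one_over)
    qed
    show "B * a * (1 + real N / r) powr (3 / 4) \<le> C3 * a"
    proof -
      have "real N / r \<le> C2 + 1"
        using N r1 by (subst pos_divide_le_eq) (auto simp: distrib_right)
      then have "(1 + real N / r) powr (3 / 4) \<le> (C2 + 2) powr (3 / 4)" using r1 by (intro powr_mono2) auto
      also have "\<dots> \<le> (C2 + 2) powr 1" using C2big by (intro powr_mono) auto
      finally have "B * a * (1 + real N / r) powr (3 / 4) \<le> B * a * (C2 + 2)"
        using B a0 C2big by (intro mult_left_mono) auto
      then show ?thesis by (simp add: C3 mult_ac)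
    qed
    show "1 \<le> L" using L0 by simp
    show "exp (- real d * ln (C3 * a)) * (L ^ N * exp (2 * t * (C3 * a) / L)) \<le> \<theta>0 / a * exp (- real N)"
    proof -
      have LN: "L ^ N = exp (real N * ln L)" using lnL0 by (simp add: exp_of_nat_mult)
      have tM: "2 * t * (C3 * a) / L = 2 * C3 * r" using r(2) lnL0 by (simp add: field_simps)
      have lnM: "?\<Lambda> \<le> ln (C3 * a)" using C3big a0 by simp
      have rh: "\<theta>0 / a * exp (- real N) = exp (ln \<theta>0 - ?\<Lambda> - real N)"
        using \<theta>0p a0 by (simp add: exp_diff exp_minus divide_inverse)
      \<comment> \<open>The saving \<open>\<delta> * r / 2 * ln a\<close> is spent in four equal
        parts: on \<open>L ^ N\<close>, on \<open>2 * C3 * r + N\<close>, on \<open>ln a\<close> and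
        on \<open>- ln \<theta>0\<close>.\<close>
      have "\<delta> * r / 2 * ?\<Lambda> \<le> real d * ln (C3 * a)" using dr lnM \<Lambda> \<delta> r1 by (intro mult_mono) auto
      moreover have "real N * ln L \<le> 2 * C2 * r * ln L" using N2 lnL0 by (intro mult_right_mono) auto
      moreover have "r * (2 * C2 * ln L) \<le> r * (\<delta> / 8 * ?\<Lambda>)" using lnL r1 by (intro mult_left_mono) auto
      moreover have "r * (2 * C3 + 2 * C2) \<le> r * (\<delta> / 8 * ?\<Lambda>)" using \<Lambda> r1 by (intro mult_left_mono) auto
      moreover have "1 * ?\<Lambda> \<le> r * \<delta> / 8 * ?\<Lambda>"
        using r8 \<delta> \<Lambda> by (intro mult_right_mono) (auto simp: field_simps)
      moreover have "- ln \<theta>0 \<le> ?\<Lambda>"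
      proof -
        have "ln (2 / \<theta>0) = ln 2 - ln \<theta>0" using \<theta>0p by (simp add: ln_div)
        moreover have "0 < ln (2::real)" by simp
        ultimately show ?thesis using \<Lambda>(3) by linarith
      qed
      ultimately have "- (real d * ln (C3 * a)) + (real N * ln L + 2 * C3 * r) \<le> ln \<theta>0 - ?\<Lambda> - real N"
        using N2 by (simp add: algebra_simps)
      then show ?thesis unfolding LN tM rh by (simp add: mult_exp_exp)
    qed
    show "2 * real N * (4 / (b / 4 * a)) ^ (2 * y0) \<le> \<theta>0 / a"
    proof -
      have "2 * real N * (4 / (b / 4 * a)) ^ (2 * y0) \<le> 2 * (2 * C2 * r) * ((16 / b) ^ (2 * y0) / a ^ (2 * y0))"
        using N2 b a0 by (intro mult_mono) (auto simp: power_divide power_mult_distrib)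
      also have "\<dots> = 4 * C2 * (16 / b) ^ (2 * y0) * (r / a ^ (2 * y0))" by simp
      also have "r / a ^ (2 * y0) \<le> 1 / (a * a)"
      proof -
        have "r * (a * a) = a powr (\<alpha> + 2)" using a0 by (simp add: r(1) powr_add power2_eq_square)
        also have "\<dots> \<le> a powr (real (2 * y0))" using a1 y0 by (intro powr_mono) auto
        also have "\<dots> = a ^ (2 * y0)" using a0 by (simp only: powr_realpow)
        finally show ?thesis using a0 by (simp add: field_simps)
      qed
      also have "4 * C2 * (16 / b) ^ (2 * y0) * (1 / (a * a)) \<le> \<theta>0 / a"
      proof -
        have "4 * C2 * (16 / b) ^ (2 * y0) \<le> a * \<theta>0" using near \<theta>0p by (simp add: pos_divide_le_eq)
        then have "4 * C2 * (16 / b) ^ (2 * y0) * (1 / (a * a)) \<le> a * \<theta>0 * (1 / (a * a))"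
          using a0 by (intro mult_right_mono) auto
        then show ?thesis using a0 by simp
      qed
      finally show ?thesis using C2big b by (simp add: mult_left_mono)
    qed
    show "2 * real N \<le> C3 * a * t"
    proof -
      have "2 * real N \<le> 4 * C2 * r" using N2 by simp
      also have "\<dots> \<le> L * r" using L1 r1 by (intro mult_right_mono) auto
      also have "\<dots> = 1 * (t * a)" using r(2) by (simp add: mult.commute)
      also have "\<dots> \<le> C3 * (t * a)" using C3big t a0 by (intro mult_right_mono) auto
      finally show ?thesis by (simp add: mult_ac)
    qed
    show "0 < \<theta>0 / a" using \<theta>0p a0 by simp
    show "\<theta>0 / a * (24 * exp 1 * (C3 * a)) \<le> 1" using a0 C3big by (simp add: \<theta>0)
    show "0 < d" using dr \<delta> r1 by (smt (verit) divide_pos_pos mult_pos_pos of_nat_0_less_iff)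
    show "d \<le> N"
    proof -
      have "\<delta> * r \<le> C2 * r" using \<delta> C2big r1 by (intro mult_right_mono) auto
      then show ?thesis using d N by linarith
    qed
    show "1 \<le> C3 * a" using mult_mono[of 1 C3 1 a] C3big a1 by simp
  qed
qed

lemma eta_nonneg_le:
  assumes "\<And>n. 0 \<le> p n \<and> p n \<le> 1"
  shows "0 \<le> eta p n" "eta p n \<le> n"
proof -
  show "0 \<le> eta p n" unfolding eta_def using assms by (intro sum_nonneg) auto
  have "eta p n \<le> (\<Sum>z=1..n. 1)" unfolding eta_def using assms by (intro sum_mono) auto
  then show "eta p n \<le> n" by simp
qed

lemma eta_split:
  assumes "1 \<le> k" "k \<le> n + 1"
  shows "eta p n = eta p (k - 1) + (\<Sum>y\<in>{k..n}. 1 - p y)"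
proof -
  have "{1..n} = {1..k - 1} \<union> {k..n}" using assms by auto
  moreover have "{1..k - 1} \<inter> {k..n} = {}" by auto
  ultimately show ?thesis unfolding eta_def by (simp add: sum.union_disjoint)
qed

text \<open>Averages of \<open>1 - p n\<close>, which tends to 0. The expected number of
  unduplicated values above \<open>m0\<close> within distance \<open>N\<close> is of order
  \<open>eta p N / r\<close>, so this makes them unlikely.\<close>

lemma eta_sublinear:
  assumes p: "\<And>n. 0 \<le> p n \<and> p n \<le> 1" and lim: "p \<longlonglongrightarrow> 1" and c: "0 < c"
  shows "\<forall>\<^sub>F n in sequentially. eta p n \<le> c * real n"
proof -
  have "\<forall>\<^sub>F n in sequentially. 1 - c / 2 < p n" by (rule order_tendstoD(1)[OF lim]) (use c in simp)
  then obtain m where m: "\<forall>n\<ge>m. 1 - c / 2 < p n" unfolding eventually_sequentially by blast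
  have m: "1 - p n \<le> c / 2" if "m \<le> n" for n using m[rule_format, OF that] by simp
  have "\<forall>\<^sub>F n in sequentially. 2 * real m / c \<le> real n"
    using filterlim_real_sequentially by (simp add: filterlim_at_top)
  then show ?thesis using eventually_ge_at_top[of m]
  proof eventually_elim
    case (elim n)
    have mc: "real m \<le> c / 2 * real n" using elim(1) c by (simp add: field_simps)
    have "eta p n = eta p (m + 1 - 1) + (\<Sum>y\<in>{m + 1..n}. 1 - p y)" by (rule eta_split) (use elim in auto)
    also have "\<dots> \<le> real m + (\<Sum>y\<in>{m + 1..n}. c / 2)"
      using eta_nonneg_le(2)[of p m] p m by (intro add_mono sum_mono) auto
    also have "(\<Sum>y\<in>{m + 1..n}. c / 2) \<le> c / 2 * real n" using c elim by simp
    finally show ?case using mc by simp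
  qed
qed

lemma eventually_ln_ln_le:
  assumes "0 < c"
  shows "\<forall>\<^sub>F t::real in at_top. ln (ln t) \<le> c * ln t"
proof -
  have "((\<lambda>t::real. ln (ln t) / ln t) \<longlongrightarrow> 0) at_top" by real_asymp
  from order_tendstoD(2)[OF this assms] show ?thesis
    using eventually_gt_at_top[of 1]
    by eventually_elim (simp add: pos_divide_less_eq)
qed

section \<open>Asymptotics of the height and distance scales\<close>

context
  fixes \<alpha> :: real
  assumes \<alpha>: "2 \<le> \<alpha>"
begin

definition height :: "real \<Rightarrow> real" where
  "height t = (t / ln t) powr (1 / (\<alpha> - 1))"

definition range_scale :: "real \<Rightarrow> real" where
  "range_scale t = height t powr \<alpha>"

lemma height_at_top: "filterlim height at_top at_top"
proof -
  have "0 < 1 / (\<alpha> - 1)" using \<alpha> by simp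
  then show ?thesis unfolding height_def by real_asymp
qed

lemma height_eqs:
  assumes t: "1 < t"
  shows "0 < height t" "range_scale t * ln t = t * height t" "ln (height t) = (ln t - ln (ln t)) / (\<alpha> - 1)"
proof -
  have L: "0 < ln t" using t by simp
  show h: "0 < height t" using t L by (simp add: height_def)
  have "height t powr (\<alpha> - 1) = t / ln t" using t L \<alpha> by (simp add: height_def powr_powr)
  moreover have "range_scale t = height t powr (1 + (\<alpha> - 1))" by (simp add: range_scale_def)
  ultimately have "range_scale t = height t * (t / ln t)" using h by (simp only: powr_add powr_one)
  then show "range_scale t * ln t = t * height t" using L by simp
  show "ln (height t) = (ln t - ln (ln t)) / (\<alpha> - 1)"
    using t L by (simp add: height_def ln_powr ln_div)
qed

lemma eventually_ln_le_height: "\<forall>\<^sub>F t in at_top. ln t \<le> 2 * (\<alpha> - 1) * ln (height t)"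
proof -
  have "\<forall>\<^sub>F t::real in at_top. ln (ln t) \<le> 1 / 2 * ln t" by (rule eventually_ln_ln_le) simp
  then show ?thesis using eventually_gt_at_top[of 1]
proof eventually_elim
  case (elim t)
  have "2 * (\<alpha> - 1) * ln (height t) = 2 * (ln t - ln (ln t))"
    using height_eqs(3)[OF elim(2)] \<alpha> by (simp add: field_simps)
  then show ?case using elim by simp
qed
qed

lemma eventually_ln_ln_le_height:
  assumes "0 < c"
  shows "\<forall>\<^sub>F t in at_top. ln (ln t) \<le> c * ln (height t)"
proof -
  have c: "0 < c / (2 * (\<alpha> - 1))" using assms \<alpha> by simp
  show ?thesis
    using eventually_ln_ln_le[OF c] eventually_ln_le_height
  proof eventually_elim
    case (elim t)
    have "c / (2 * (\<alpha> - 1)) * ln t \<le> c / (2 * (\<alpha> - 1)) * (2 * (\<alpha> - 1) * ln (height t))"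
      using elim c by (intro mult_left_mono) auto
    also have "\<dots> = c * ln (height t)" using \<alpha> by simp
    finally show ?case using elim by simp
  qed
qed

lemma eventually_ge_height: "\<forall>\<^sub>F t in at_top. C \<le> height t"
  using height_at_top by (simp add: filterlim_at_top)

lemma eventually_ge_ln_height: "\<forall>\<^sub>F t in at_top. C \<le> ln (height t)"
  using filterlim_compose[OF ln_at_top height_at_top] by (simp add: filterlim_at_top)

lemma range_scale_at_top: "filterlim range_scale at_top at_top"
proof (rule filterlim_at_top_mono[OF height_at_top])
  show "\<forall>\<^sub>F t in at_top. height t \<le> range_scale t"
    using eventually_ge_height[of 1]
  proof eventually_elim
    case (elim t)
    then show ?case using powr_mono[of 1 \<alpha> "height t"] \<alpha> by (simp add: range_scale_def)
  qed
qed

lemma eventually_ge_range_scale: "\<forall>\<^sub>F t in at_top. C \<le> range_scale t"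
  using range_scale_at_top by (simp add: filterlim_at_top)

lemma filterlim_nat_floor_range_scale:
  assumes "0 < c"
  shows "filterlim (\<lambda>t. nat \<lfloor>c * range_scale t\<rfloor>) at_top at_top"
proof -
  have "filterlim (\<lambda>t. c * range_scale t) at_top at_top"
    by (rule filterlim_tendsto_pos_mult_at_top[OF tendsto_const assms range_scale_at_top])
  then show ?thesis
    by (intro filterlim_compose[OF filterlim_nat_sequentially] filterlim_compose[OF filterlim_floor_sequentially])
qed

lemma filterlim_nat_ceiling_range_scale:
  assumes "0 < c"
  shows "filterlim (\<lambda>t. nat \<lceil>c * range_scale t\<rceil>) at_top at_top"
proof (rule filterlim_at_top_mono[OF filterlim_nat_floor_range_scale[OF assms]])
  show "\<forall>\<^sub>F t in at_top. nat \<lfloor>c * range_scale t\<rfloor> \<le> nat \<lceil>c * range_scale t\<rceil>"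
    by (intro always_eventually allI nat_mono) (simp add: floor_le_ceiling)
qed

end

lemma kappa_at_top:
  assumes "2 \<le> \<alpha>"
  shows "filterlim (kappa \<alpha>) at_top sequentially"
proof (cases "\<alpha> = 2")
  case True
  have "filterlim (\<lambda>n::nat. real n / ln (real n)) at_top sequentially" by real_asymp
  moreover have "kappa \<alpha> = (\<lambda>n. real n / ln (real n))" using True by (simp add: kappa_def fun_eq_iff)
  ultimately show ?thesis by (simp only:)
next
  case False
  then have "0 < 2 / \<alpha>" using assms by simp
  then have "filterlim (\<lambda>n::nat. real n powr (2 / \<alpha>)) at_top sequentially" by real_asymp
  moreover have "kappa \<alpha> = (\<lambda>n. real n powr (2 / \<alpha>))" using False assms by (simp add: kappa_def fun_eq_iff)
  ultimately show ?thesis by (simp only:)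
qed

context duplicated_env
begin

lemma dyadic_mean_nonneg: "0 \<le> dyadic_mean k"
  unfolding dyadic_mean_def by (intro sum_nonneg) simp

lemma dyadic_mean_ge:
  assumes "1 \<le> k"
  shows "4 powr (- \<alpha>) \<le> dyadic_mean k"
proof -
  have "(\<Sum>i\<in>{0::nat}. 4 ^ i * (4 * 2 ^ i) powr (- \<alpha>)) \<le> dyadic_mean k"
    unfolding dyadic_mean_def by (rule sum_mono2) (use assms in auto)
  then show ?thesis by simp
qed

lemma dyadic_mean_critical:
  assumes "\<alpha> = 2"
  shows "dyadic_mean k = real k / 16"
proof -
  have eq: "4 ^ i * (4 * 2 ^ i) powr (- \<alpha>) = 1 / 16" for i :: nat
  proof -
    have "(4 * 2 ^ i) powr (- \<alpha>) = 1 / ((4 * 2 ^ i) ^ 2 :: real)"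
      using powr_realpow[of "4 * 2 ^ i" 2] assms by (simp add: powr_minus_divide)
    also have "\<dots> = 1 / (16 * 4 ^ i)"
      by (simp add: power_mult_distrib power_mult[symmetric] mult.commute[of i 2] power_mult[of 2 2])
    finally show ?thesis by simp
  qed
  show ?thesis unfolding dyadic_mean_def eq by simp
qed

text \<open>For \<open>\<alpha> = 2\<close> the mean is \<open>k / 16\<close>, of order
  \<open>ln a\<close>, and cancels the logarithm in \<open>kappa\<close>. For
  \<open>\<alpha> > 2\<close> the mean is bounded below and \<open>r powr (2 / \<alpha>)\<close>
  equals \<open>a\<^sup>2\<close>.\<close>

lemma dyadic_mean_kappa_ge:
  assumes \<delta>: "0 < \<delta>" "\<delta> \<le> 1"
  shows "\<exists>c>0. \<forall>\<^sub>F t in at_top. c * (height \<alpha> t)\<^sup>2 \<le> dyadic_mean (nat \<lfloor>log 2 (height \<alpha> t)\<rfloor>) * kappa \<alpha> (nat \<lfloor>\<delta> * range_scale \<alpha> t\<rfloor>)"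
proof -
  let ?h = "height \<alpha>" and ?r = "range_scale \<alpha>"
  let ?d = "\<lambda>t. nat \<lfloor>\<delta> * ?r t\<rfloor>" and ?k = "\<lambda>t. nat \<lfloor>log 2 (?h t)\<rfloor>"
  have ev: "\<forall>\<^sub>F t in at_top. 4 \<le> ?h t \<and> 4 / \<delta> \<le> ?r t"
    by (intro eventually_conj eventually_ge_height eventually_ge_range_scale \<alpha>)
  have d: "\<delta> * ?r t / 2 \<le> real (?d t)" "real (?d t) \<le> ?r t" "2 \<le> real (?d t)" if "4 / \<delta> \<le> ?r t" for t
  proof -
    have 4: "4 \<le> \<delta> * ?r t" using that \<delta> by (simp add: pos_divide_le_eq mult.commute)
    have f: "real (?d t) = of_int \<lfloor>\<delta> * ?r t\<rfloor>" using 4 by simp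
    have "\<delta> * ?r t - 1 < real (?d t)" unfolding f by linarith
    then show "\<delta> * ?r t / 2 \<le> real (?d t)" "2 \<le> real (?d t)" using 4 by linarith+
    have "real (?d t) \<le> \<delta> * ?r t" unfolding f by linarith
    also have "\<dots> \<le> 1 * ?r t" using \<delta> by (intro mult_right_mono) (auto simp: range_scale_def[OF \<alpha>])
    finally show "real (?d t) \<le> ?r t" by simp
  qed
  have k: "2 \<le> log 2 (?h t)" "log 2 (?h t) / 2 \<le> real (?k t)" "1 \<le> ?k t" if "4 \<le> ?h t" for t
  proof -
    have "log 2 (2 ^ 2) \<le> log 2 (?h t)" using that by (intro log_mono) auto
    moreover have "log 2 (2 ^ 2) = (2::real)" by (subst log_nat_power) auto
    ultimately show l2: "2 \<le> log 2 (?h t)" by simp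
    then have "real (?k t) = of_int \<lfloor>log 2 (?h t)\<rfloor>" by simp
    moreover have "log 2 (?h t) - 1 < of_int \<lfloor>log 2 (?h t)\<rfloor>" by linarith
    ultimately show "log 2 (?h t) / 2 \<le> real (?k t)" using l2 by linarith
    then have "1 \<le> real (?k t)" using l2 by linarith
    then show "1 \<le> ?k t" by simp
  qed
  show ?thesis
  proof (cases "\<alpha> = 2")
    case True
    show ?thesis
    proof (intro exI[of _ "\<delta> / 128"] conjI)
      show "\<forall>\<^sub>F t in at_top. \<delta> / 128 * (?h t)\<^sup>2 \<le> dyadic_mean (?k t) * kappa \<alpha> (?d t)"
        using ev
      proof eventually_elim
        case (elim t)
        note d' = d[OF conjunct2[OF elim]] and k' = k[OF conjunct1[OF elim]]
        have h0: "0 < ?h t" using elim by simp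
        have r2: "?r t = (?h t)\<^sup>2" unfolding range_scale_def[OF \<alpha>] using powr_realpow[OF h0, of 2] True by simp
        have lnh: "0 < ln (?h t)" using elim by simp
        have "ln (?h t) \<le> log 2 (?h t)"
        proof -
          have "ln 2 \<le> (1::real)" using ln_le_minus_one[of "2::real"] by simp
          then have "ln (?h t) * ln 2 \<le> ln (?h t) * 1" using lnh by (intro mult_left_mono) auto
          then show ?thesis by (simp add: log_def pos_le_divide_eq)
        qed
        then have kk: "ln (?h t) / 2 / 16 \<le> dyadic_mean (?k t)"
          using k'(2) by (simp add: dyadic_mean_critical[OF True])
        have lnd: "0 < ln (real (?d t))" by (rule ln_gt_zero) (use d'(3) in linarith)
        have "0 < real (?d t)" using d'(3) by linarith
        moreover have "real (?d t) \<le> (?h t)\<^sup>2" using d'(2) by (simp only: r2)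
        ultimately have "ln (real (?d t)) \<le> ln ((?h t)\<^sup>2)" using ln_mono by blast
        also have "\<dots> = 2 * ln (?h t)" using h0 by (simp add: ln_realpow)
        finally have l2: "ln (real (?d t)) \<le> 2 * ln (?h t)" .
        have "\<delta> * (?h t)\<^sup>2 / 2 / (2 * ln (?h t)) \<le> real (?d t) / ln (real (?d t))"
          using d' \<delta> lnd l2 unfolding r2 by (intro frac_le) auto
        then have kp: "\<delta> * (?h t)\<^sup>2 / (4 * ln (?h t)) \<le> kappa \<alpha> (?d t)" using True by (simp add: kappa_def)
        have "\<delta> / 128 * (?h t)\<^sup>2 = ln (?h t) / 2 / 16 * (\<delta> * (?h t)\<^sup>2 / (4 * ln (?h t)))"
          using lnh by (simp add: field_simps)
        also have "\<dots> \<le> dyadic_mean (?k t) * kappa \<alpha> (?d t)"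
          using kk kp lnh \<delta> dyadic_mean_nonneg by (intro mult_mono) auto
        finally show ?case .
      qed
    qed (use \<delta> in simp)
  next
    case False
    then have \<alpha>2: "2 < \<alpha>" using \<alpha> by simp
    show ?thesis
    proof (intro exI[of _ "4 powr (- \<alpha>) * (\<delta> / 2) powr (2 / \<alpha>)"] conjI)
      show "\<forall>\<^sub>F t in at_top. 4 powr (- \<alpha>) * (\<delta> / 2) powr (2 / \<alpha>) * (?h t)\<^sup>2 \<le> dyadic_mean (?k t) * kappa \<alpha> (?d t)"
        using ev
      proof eventually_elim
        case (elim t)
        note d' = d[OF conjunct2[OF elim]] and k' = k[OF conjunct1[OF elim]]
        have h0: "0 < ?h t" using elim by simp
        have "?r t powr (2 / \<alpha>) = ?h t powr 2" using \<alpha> by (simp add: range_scale_def[OF \<alpha>] powr_powr)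
        also have "\<dots> = (?h t)\<^sup>2" using powr_realpow[OF h0, of 2] by simp
        finally have r2: "?r t powr (2 / \<alpha>) = (?h t)\<^sup>2" .
        have "(\<delta> / 2) powr (2 / \<alpha>) * (?h t)\<^sup>2 = (\<delta> / 2 * ?r t) powr (2 / \<alpha>)"
          unfolding r2[symmetric] using \<delta> by (subst powr_mult) (auto simp: range_scale_def[OF \<alpha>])
        also have "\<dots> \<le> real (?d t) powr (2 / \<alpha>)"
          using d' \<delta> \<alpha> by (intro powr_mono2) (auto simp: range_scale_def[OF \<alpha>])
        also have "\<dots> = kappa \<alpha> (?d t)" using \<alpha>2 by (simp add: kappa_def)
        finally have kp: "(\<delta> / 2) powr (2 / \<alpha>) * (?h t)\<^sup>2 \<le> kappa \<alpha> (?d t)" .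
        have "4 powr (- \<alpha>) * ((\<delta> / 2) powr (2 / \<alpha>) * (?h t)\<^sup>2) \<le> dyadic_mean (?k t) * kappa \<alpha> (?d t)"
          using dyadic_mean_ge[OF k'(3)] kp by (intro mult_mono dyadic_mean_nonneg) auto
        then show ?case by (simp only: mult.assoc)
      qed
    qed (use \<delta> in simp)
  qed
qed

text \<open>The place where \<open>kappa\<close> being negligible against \<open>eta\<close> enters.
  Leaving out the sites below \<open>y0\<close> costs a bounded part of \<open>eta\<close>, which is
  at most half of it, because \<open>eta\<close> dominates \<open>kappa\<close> and therefore
  diverges.\<close>

lemma expected_gap_sum_growth:
  assumes o: "kappa \<alpha> \<in> o(eta p)" and \<delta>: "0 < \<delta>" "\<delta> \<le> 1" and y0: "1 \<le> y0" and C: "0 < C"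
  shows "\<forall>\<^sub>F t in at_top. C * (height \<alpha> t)\<^sup>2 \<le> dyadic_mean (nat \<lfloor>log 2 (height \<alpha> t)\<rfloor>) * (1 - 2 powr (- \<alpha>))
    * (\<Sum>y\<in>{y0..nat \<lfloor>\<delta> * range_scale \<alpha> t\<rfloor>}. 1 - p y)"
proof -
  let ?d = "\<lambda>t. nat \<lfloor>\<delta> * range_scale \<alpha> t\<rfloor>" and ?k = "\<lambda>t. nat \<lfloor>log 2 (height \<alpha> t)\<rfloor>"
  obtain c where c: "0 < c" and
    cev: "\<forall>\<^sub>F t in at_top. c * (height \<alpha> t)\<^sup>2 \<le> dyadic_mean (?k t) * kappa \<alpha> (?d t)"
    using dyadic_mean_kappa_ge[OF \<delta>] by blast
  \<comment> \<open>The factor 3/8 is 3/4, a lower bound for \<open>1 - 2 powr (- \<alpha>)\<close>,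
    times the 1/2 lost with the sites below \<open>y0\<close>.\<close>
  define c' where "c' = 3 * c / (8 * C)"
  have c': "0 < c'" using c C by (simp add: c'_def)
  have en: "0 \<le> eta p n" for n by (rule eta_nonneg_le(1)) (rule p01)
  have "\<forall>\<^sub>F n in sequentially. \<bar>kappa \<alpha> n\<bar> \<le> c' * \<bar>eta p n\<bar>"
    using landau_o.smallD[OF o c'] by simp
  then have e1: "\<forall>\<^sub>F n in sequentially. kappa \<alpha> n \<le> c' * eta p n"
    by eventually_elim (use en in simp)
  have "\<forall>\<^sub>F n in sequentially. \<bar>kappa \<alpha> n\<bar> \<le> 1 * \<bar>eta p n\<bar>"
    using landau_o.smallD[OF o, of 1] by simp
  moreover have "\<forall>\<^sub>F n in sequentially. 2 * real y0 \<le> kappa \<alpha> n"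
    using kappa_at_top[OF \<alpha>] by (simp add: filterlim_at_top)
  ultimately have e2: "\<forall>\<^sub>F n in sequentially. 2 * real y0 \<le> eta p n"
    by eventually_elim (use en in simp)
  have e3: "\<forall>\<^sub>F n in sequentially. kappa \<alpha> n \<le> c' * eta p n \<and> 2 * real y0 \<le> eta p n \<and> y0 \<le> n"
    using e1 e2 eventually_ge_at_top[of y0] by eventually_elim simp
  have "\<forall>\<^sub>F t in at_top. kappa \<alpha> (?d t) \<le> c' * eta p (?d t) \<and> 2 * real y0 \<le> eta p (?d t) \<and> y0 \<le> ?d t"
    by (rule eventually_compose_filterlim[OF e3 filterlim_nat_floor_range_scale[OF \<alpha> \<delta>(1)]])
  then show ?thesis using cev
  proof eventually_elim
    case (elim t)
    let ?S = "\<Sum>y\<in>{y0..?d t}. 1 - p y"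
    have "eta p (?d t) = eta p (y0 - 1) + ?S" by (rule eta_split) (use elim y0 in auto)
    moreover have "eta p (y0 - 1) \<le> real (y0 - 1)" by (rule eta_nonneg_le(2)) (rule p01)
    ultimately have S: "eta p (?d t) / 2 \<le> ?S" using elim by linarith
    have pw: "3 / 4 \<le> 1 - 2 powr (- \<alpha>)"
    proof -
      have "2 powr (- \<alpha>) \<le> 2 powr (- (2::real))" using \<alpha> by (intro powr_mono) auto
      also have "\<dots> = 1 / 4" by (simp add: powr_minus_divide)
      finally show ?thesis by simp
    qed
    have "c * (height \<alpha> t)\<^sup>2 \<le> dyadic_mean (?k t) * (c' * eta p (?d t))"
      using elim dyadic_mean_nonneg[of "?k t"] by (meson mult_left_mono order_trans)
    then have "C * (height \<alpha> t)\<^sup>2 \<le> dyadic_mean (?k t) * (3 / 4) * (eta p (?d t) / 2)"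
      using c C by (simp add: c'_def field_simps)
    also have "\<dots> \<le> dyadic_mean (?k t) * (1 - 2 powr (- \<alpha>)) * ?S"
      using S pw en dyadic_mean_nonneg[of "?k t"] by (intro mult_mono mult_left_mono) auto
    finally show ?case .
  qed
qed

end

lemma nat_floor_bounds:
  fixes x :: real
  assumes "0 \<le> x"
  shows "real (nat \<lfloor>x\<rfloor>) \<le> x" "x \<le> real (nat \<lfloor>x\<rfloor>) + 1"
  using assms by (auto simp: of_nat_nat intro: less_imp_le)

lemma nat_ceiling_bounds:
  fixes x :: real
  assumes "0 \<le> x"
  shows "x \<le> real (nat \<lceil>x\<rceil>)" "real (nat \<lceil>x\<rceil>) \<le> x + 1"
  using assms by (auto simp: of_nat_nat)

context duplicated_env
begin

lemma log_ratio_small_prob: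
  assumes lim: "p \<longlonglongrightarrow> 1" and o: "kappa \<alpha> \<in> o(eta p)"
    and Z: "\<And>t. t > 0 \<Longrightarrow> AE \<omega> in M. Z t \<omega> \<in> Dset (potential (xi0 \<omega>) (coin \<omega>)) \<and>
            (\<forall>y \<in> Dset (potential (xi0 \<omega>) (coin \<omega>)).
               Psi (potential (xi0 \<omega>) (coin \<omega>)) t (int y) \<le> Psi (potential (xi0 \<omega>) (coin \<omega>)) t (int (Z t \<omega>)))"
    and \<epsilon>: "0 < \<epsilon>" and K: "1 \<le> K"
  shows "\<forall>\<^sub>F t in at_top. \<exists>A\<in>sets M.
     {\<omega> \<in> space M. \<bar>log_ratio t (Z t \<omega>) (potential (xi0 \<omega>) (coin \<omega>))\<bar> \<le> K} \<subseteq> A \<and> measure M A < \<epsilon>"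
proof -
  \<comment> \<open>Six error terms get \<open>\<epsilon> / 8\<close> each: the envelope
    (\<open>B\<close>), large values near 0 (\<open>\<delta>\<close>), large unduplicated values
    (\<open>c\<close>), a missing peak (\<open>b\<close>), a small gap sum (\<open>C\<close>) and
    the anticoncentration bound (\<open>v\<close>). The peak has \<open>h = b * a\<close>,
    \<open>m0 = h / 4\<close> and \<open>J\<close> about \<open>b / 2 * r\<close>.\<close>
  define B where "B = 48 / \<epsilon> + 1"
  define b where "b = 1 / (4 * (1 + 8 / \<epsilon>))"
  define \<delta> where "\<delta> = min 1 (\<epsilon> * (b / 8) powr \<alpha> / 24)"
  define C2 where "C2 = (16 * B * (\<alpha> - 1)) ^ 4"
  define C3 where "C3 = B * (C2 + 2)"
  define \<theta>0 where "\<theta>0 = 1 / (24 * exp 1 * C3)"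
  define y0 where "y0 = nat \<lceil>\<alpha> + 2\<rceil>"
  define v where "v = 32 * K / \<epsilon>"
  define C where "C = 32 / \<epsilon> + 2 * v\<^sup>2 * (4 * exp 1 * C3)\<^sup>2"
  define c where "c = \<epsilon> * (b / 4) powr \<alpha> / (32 * C2)"
  let ?a = "height \<alpha>" and ?r = "range_scale \<alpha>"
  let ?N = "\<lambda>t. nat \<lceil>C2 * ?r t\<rceil>" and ?d = "\<lambda>t. nat \<lfloor>\<delta> * ?r t\<rfloor>" and ?J = "\<lambda>t. nat \<lfloor>b / 2 * ?r t\<rfloor>"
    and ?k = "\<lambda>t. nat \<lfloor>log 2 (?a t)\<rfloor>"
  have B: "1 \<le> B" using \<epsilon> by (simp add: B_def)
  have b: "0 < b" "b \<le> 1"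
  proof -
    have "1 \<le> 4 * (1 + 8 / \<epsilon>)" using \<epsilon> by (simp add: add_increasing2)
    then show "0 < b" "b \<le> 1" unfolding b_def by (auto simp: divide_le_eq_1)
  qed
  have \<delta>: "0 < \<delta>" "\<delta> \<le> 1" using \<epsilon> b by (auto simp: \<delta>_def)
  have C2: "1 \<le> C2"
  proof -
    have "1 \<le> 16 * B * (\<alpha> - 1)" using mult_mono[of 1 B 1 "\<alpha> - 1"] B \<alpha> by simp
    then show ?thesis unfolding C2_def by (rule one_le_power)
  qed
  have C3: "1 \<le> C3" using mult_mono[of 1 B 1 "C2 + 2"] B C2 by (simp add: C3_def)
  have \<theta>0: "0 < \<theta>0" using C3 by (simp add: \<theta>0_def)
  have y0: "1 \<le> y0" "\<alpha> + 2 \<le> 2 * real y0"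
  proof -
    have 1: "\<alpha> + 2 \<le> real y0" unfolding y0_def by (rule nat_ceiling_bounds(1)) (use \<alpha> in simp)
    then show "\<alpha> + 2 \<le> 2 * real y0" by linarith
    have "1 \<le> real y0" using 1 \<alpha> by linarith
    then show "1 \<le> y0" by simp
  qed
  have v: "0 < v" using K \<epsilon> by (simp add: v_def)
  have C: "0 < C" "32 / \<epsilon> \<le> C" "2 * v\<^sup>2 * (4 * exp 1 * C3)\<^sup>2 \<le> C"
    using \<epsilon> by (auto simp: C_def intro: add_pos_nonneg)
  have c: "0 < c" using \<epsilon> b C2 by (simp add: c_def)
  have eta: "\<forall>\<^sub>F t in at_top. eta p (?N t) \<le> c * real (?N t)"
    by (rule eventually_compose_filterlim[OF eta_sublinear[OF p01 lim c] filterlim_nat_ceiling_range_scale[OF \<alpha>]])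
      (use C2 in simp)
  have "0 < \<delta> / (16 * C2)" using \<delta> C2 by simp
  note lnln = eventually_ln_ln_le_height[OF \<alpha> this]
  have lnln4: "\<forall>\<^sub>F t in at_top. ln (ln t) \<le> 1 / 4 * ln (?a t)"
    by (rule eventually_ln_ln_le_height[OF \<alpha>]) simp
  have L: "\<forall>\<^sub>F t in at_top. 4 * C2 \<le> ln (t::real)"
    using ln_at_top by (simp add: filterlim_at_top)
  note aev = eventually_ge_height[OF \<alpha>] and rev = eventually_ge_range_scale[OF \<alpha>] and lev = eventually_ge_ln_height[OF \<alpha>]
  show ?thesis
    using eventually_gt_at_top[of 1] L eventually_ln_le_height[OF \<alpha>] lnln lnln4 eta
      expected_gap_sum_growth[OF o \<delta> y0(1) C(1)]
      aev[of "32 / b"] aev[of "4 * C2 * (16 / b) ^ (2 * y0) / \<theta>0"]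
      lev[of 4] lev[of "2 * ln (4 / b)"] lev[of "ln (2 / \<theta>0)"] lev[of "(2 * C3 + 2 * C2) * 8 / \<delta>"]
      rev[of "8 / \<delta>"] rev[of "8 / b"]
  proof eventually_elim
    case (elim t)
    define a where "a = ?a t"
    define r where "r = ?r t"
    define L where "L = ln t"
    define \<mu> where "\<mu> = dyadic_mean (?k t) * (1 - 2 powr (- \<alpha>)) * (\<Sum>y\<in>{y0..?d t}. 1 - p y)"
    note E = elim[folded a_def r_def L_def]
    have a0: "0 < a" and rL: "r * L = t * a" and la: "ln a = (L - ln L) / (\<alpha> - 1)"
      using height_eqs[OF \<alpha> elim(1)] by (auto simp: a_def r_def L_def)
    have r: "r = a powr \<alpha>" by (simp add: r_def a_def range_scale_def[OF \<alpha>])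
    have "8 * 1 \<le> 8 / \<delta>" using \<delta> by (simp add: pos_le_divide_eq)
    then have r8: "8 \<le> r" using E(14) by linarith
    have a32: "32 \<le> b * a" using E(8) b by (simp add: pos_divide_le_eq mult.commute)
    have a1: "1 \<le> a"
    proof -
      have "b * a \<le> 1 * a" using b a0 by (intro mult_right_mono) auto
      then show ?thesis using a32 by simp
    qed
    have L1: "1 \<le> L" using E(2) C2 by linarith
    have d: "\<delta> * r \<le> real (?d t) + 1" "real (?d t) \<le> \<delta> * r"
      using nat_floor_bounds[of "\<delta> * r"] \<delta> r8 by (auto simp: r_def)
    have N: "C2 * r \<le> real (?N t)" "real (?N t) \<le> C2 * r + 1"
      using nat_ceiling_bounds[of "C2 * r"] C2 r8 by (auto simp: r_def)
    have J: "b / 2 * r \<le> real (?J t) + 1" "real (?J t) \<le> b / 2 * r"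
      using nat_floor_bounds[of "b / 2 * r"] b r8 by (auto simp: r_def)
    have br: "8 \<le> b * r" using E(15) b by (simp add: pos_divide_le_eq mult.commute)
    have J4: "b / 4 * r \<le> real (?J t)" using J(1) br by linarith
    have J1: "1 \<le> ?J t" using J4 br by linarith
    have \<delta>r: "8 \<le> \<delta> * r" using E(14) \<delta> by (simp add: pos_divide_le_eq mult.commute)
    have sc: "scales t a (b / 4 * a) (C3 * a) (\<theta>0 / a) L B r (?N t) (?d t) y0"
    proof (rule scalesI[OF \<alpha> B b \<delta> C2_def C3_def \<theta>0_def y0(2) _ L_def E(8) r rL N d E(2,3)])
      show "0 < t" using elim(1) by simp
      show "ln L \<le> ln a / 4" using E(5) by simp
      have "2 * C2 * ln L \<le> 2 * C2 * (\<delta> / (16 * C2) * ln a)" using E(4) C2 by (intro mult_left_mono) auto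
      also have "\<dots> = \<delta> / 8 * ln a" using C2 by simp
      finally show "2 * C2 * ln L \<le> \<delta> / 8 * ln a" .
      show "2 * C3 + 2 * C2 \<le> \<delta> / 8 * ln a" using E(13) \<delta> by (simp add: field_simps)
    qed (use E in auto)
    interpret S: env_scales M \<alpha> p xi0 coin t a "b / 4 * a" "C3 * a" "\<theta>0 / a" L B r "?N t" "?d t" y0 "\<lambda>x. B * a * (1 + x / r) powr (3 / 4)"
      by (intro env_scales.intro duplicated_env_axioms sc env_scales_axioms.intro y0) (rule reflexive)
    have \<mu>C: "C * a\<^sup>2 \<le> \<mu>" using elim(7) by (simp only: \<mu>_def a_def)
    have a2: "0 < a\<^sup>2" using a0 by simp
    have \<mu>0: "0 < \<mu>" using mult_pos_pos[OF C(1) a2] \<mu>C by linarith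
    have T5: "measure M {\<omega> \<in> space M. (\<Sum>y\<in>{y0..?d t}. (gap_weight (C3 * a) (potential (xi0 \<omega>) (coin \<omega>)) y)\<^sup>2) < v\<^sup>2} \<le> \<epsilon> / 8"
    proof -
      have "2 * (v\<^sup>2 * (4 * exp 1 * (C3 * a))\<^sup>2) = 2 * v\<^sup>2 * (4 * exp 1 * C3)\<^sup>2 * a\<^sup>2" by (simp add: power2_eq_square)
      also have "\<dots> \<le> C * a\<^sup>2" using C(3) by (intro mult_right_mono) auto
      finally have "2 * (v\<^sup>2 * (4 * exp 1 * (C3 * a))\<^sup>2) \<le> \<mu>" using \<mu>C by linarith
      note S.prob_gap_weights_small[OF \<mu>_def \<mu>0 this]
      also have "4 * 4 ^ ?k t / \<mu> \<le> \<epsilon> / 8"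
      proof -
        \<comment> \<open>The truncation level \<open>4 ^ k\<close> is at most
          \<open>a\<^sup>2\<close>, whereas \<open>\<mu>\<close> is at least
          \<open>C * a\<^sup>2\<close>.\<close>
        have "(2::real) ^ ?k t = 2 powr real (?k t)" by (simp add: powr_realpow)
        also have "\<dots> \<le> 2 powr log 2 a"
          using nat_floor_bounds(1)[of "log 2 a"] a1 by (intro powr_mono) (auto simp: a_def)
        also have "\<dots> = a" using a0 by simp
        finally have "((2::real) ^ ?k t)\<^sup>2 \<le> a\<^sup>2" by (intro power_mono) auto
        moreover have "((2::real) ^ ?k t)\<^sup>2 = 4 ^ ?k t"
          by (simp add: power_mult[symmetric] mult.commute[of "?k t" 2] power_mult[of 2 2])
        ultimately have "4 * 4 ^ ?k t \<le> 4 * a\<^sup>2" by simp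
        also have "\<dots> = \<epsilon> / 8 * (32 / \<epsilon> * a\<^sup>2)" using \<epsilon> by simp
        also have "\<dots> \<le> \<epsilon> / 8 * \<mu>"
        proof (intro mult_left_mono)
          have "32 / \<epsilon> * a\<^sup>2 \<le> C * a\<^sup>2" using C(2) by (intro mult_right_mono) auto
          then show "32 / \<epsilon> * a\<^sup>2 \<le> \<mu>" using \<mu>C by linarith
        qed (use \<epsilon> in simp)
        finally show ?thesis using \<mu>0 by (simp only: pos_divide_le_eq)
      qed
      finally show ?thesis .
    qed
    have powr_a: "(x * a) powr (- \<alpha>) = 1 / (x powr \<alpha> * r)" if "0 < x" for x
      using that a0 by (simp add: powr_minus_divide powr_mult r)
    have good: "measure M {\<omega> \<in> space M. \<not> S.good_env (?J t) (b * a) \<omega>} \<le> 4 * (\<epsilon> / 8)"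
    proof -
      have "measure M {\<omega> \<in> space M. \<not> S.good_env (?J t) (b * a) \<omega>} \<le> 6 * B powr (- \<alpha>)
        + (2 * real (?d t) + 1) * (b / 4 * a / 2) powr (- \<alpha>) + 2 * (b / 4 * a) powr (- \<alpha>) * eta p (?N t)
        + exp (- real (?J t) * (b * a) powr (- \<alpha>))"
        by (rule S.prob_not_good_env[OF r _ _ _ J1]) (use r8 a32 mult_mono[of 1 B 1 a] B a1 in auto)
      moreover have "6 * B powr (- \<alpha>) \<le> \<epsilon> / 8"
      proof -
        have "B powr (- \<alpha>) \<le> B powr (- 1)" using B \<alpha> by (intro powr_mono) auto
        also have "\<dots> = 1 / B" using B by (simp add: powr_minus_divide)
        also have "\<dots> \<le> 1 / (48 / \<epsilon>)" using \<epsilon> by (intro frac_le) (auto simp: B_def)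
        finally show ?thesis using \<epsilon> by simp
      qed
      moreover have "(2 * real (?d t) + 1) * (b / 4 * a / 2) powr (- \<alpha>) \<le> \<epsilon> / 8"
      proof -
        have e: "(b / 4 * a / 2) powr (- \<alpha>) = 1 / ((b / 8) powr \<alpha> * r)" using powr_a[of "b / 8"] b by simp
        have pos: "0 < (b / 8) powr \<alpha> * r" using b r8 by simp
        have "2 * real (?d t) + 1 \<le> 3 * (\<delta> * r)" using d \<delta>r by linarith
        also have "\<dots> \<le> 3 * (\<epsilon> * (b / 8) powr \<alpha> / 24 * r)"
          using r8 by (intro mult_left_mono mult_right_mono) (auto simp: \<delta>_def)
        finally have "2 * real (?d t) + 1 \<le> \<epsilon> / 8 * ((b / 8) powr \<alpha> * r)" by (simp add: mult_ac)
        then show ?thesis unfolding e by (simp only: times_divide_eq_right times_divide_eq_left mult_1_right pos_divide_le_eq[OF pos])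
      qed
      moreover have "2 * (b / 4 * a) powr (- \<alpha>) * eta p (?N t) \<le> \<epsilon> / 8"
      proof -
        have pos: "0 < (b / 4) powr \<alpha> * r" using b r8 by simp
        have e: "(b / 4 * a) powr (- \<alpha>) = 1 / ((b / 4) powr \<alpha> * r)" using b by (intro powr_a) auto
        have "1 * 1 \<le> C2 * r" using C2 r8 by (intro mult_mono) auto
        then have "real (?N t) \<le> 2 * C2 * r" using N(2) by simp
        then have "c * real (?N t) \<le> c * (2 * C2 * r)" using c by (intro mult_left_mono) auto
        then have "2 * eta p (?N t) \<le> 2 * (c * (2 * C2 * r))" using elim(6) by linarith
        also have "\<dots> = \<epsilon> / 8 * ((b / 4) powr \<alpha> * r)" using C2 by (simp add: c_def)
        finally show ?thesis unfolding e by (simp only: times_divide_eq_right times_divide_eq_left mult_1_right pos_divide_le_eq[OF pos])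
      qed
      moreover have "exp (- real (?J t) * (b * a) powr (- \<alpha>)) \<le> \<epsilon> / 8"
      proof -
        \<comment> \<open>\<open>J\<close> is at least \<open>b / 4 * r\<close> and
          \<open>h powr (- \<alpha>)\<close> equals \<open>1 / (b powr \<alpha> * r)\<close>. Since
          \<open>\<alpha> \<ge> 2\<close> and \<open>b \<le> 1\<close>, the product is at least
          \<open>1 / (4 * b) = 1 + 8 / \<epsilon>\<close>, which explains the choice of
          \<open>b\<close>.\<close>
        have ba: "0 < b powr \<alpha>" using b by simp
        have "b powr \<alpha> \<le> b powr 2" using b \<alpha> by (intro powr_mono') auto
        also have "\<dots> = b * b" using b powr_realpow[of b 2] by (simp add: power2_eq_square)
        finally have "(1 + 8 / \<epsilon>) * b powr \<alpha> \<le> (1 + 8 / \<epsilon>) * (b * b)" using \<epsilon> by (intro mult_left_mono) auto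
        also have "(1 + 8 / \<epsilon>) * (b * b) = b / 4"
        proof -
          have "1 + 8 / \<epsilon> \<noteq> 0" using \<epsilon> by (simp add: add_pos_pos less_imp_neq[symmetric])
          then have "(1 + 8 / \<epsilon>) * b = 1 / 4" by (simp add: b_def)
          then show ?thesis by (metis mult.assoc mult.commute mult_1 times_divide_eq_right)
        qed
        finally have "(1 + 8 / \<epsilon>) * b powr \<alpha> * r \<le> b / 4 * r" using r8 by (intro mult_right_mono) auto
        then have "(1 + 8 / \<epsilon>) * (b powr \<alpha> * r) \<le> real (?J t)" using J4 by (simp only: mult.assoc)
        then have "1 + 8 / \<epsilon> \<le> real (?J t) / (b powr \<alpha> * r)" using ba r8 by (subst pos_le_divide_eq) auto
        then have g: "8 / \<epsilon> \<le> real (?J t) * (b * a) powr (- \<alpha>)" unfolding powr_a[OF b(1)] by simp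
        have "8 / \<epsilon> \<le> exp (8 / \<epsilon>)" using exp_ge_add_one_self[of "8 / \<epsilon>"] by linarith
        also have "\<dots> \<le> exp (real (?J t) * (b * a) powr (- \<alpha>))" using g by simp
        finally have "1 / exp (real (?J t) * (b * a) powr (- \<alpha>)) \<le> 1 / (8 / \<epsilon>)"
          using \<epsilon> by (intro frac_le) auto
        then show ?thesis by (simp add: exp_minus inverse_eq_divide)
      qed
      ultimately show ?thesis by linarith
    qed
    have t0: "0 < t" using elim(1) by simp
    have rt: "r / t = a / L" using rL t0 L1 by (simp add: field_simps)
    have "real (?J t) / t \<le> b / 2 * r / t" using J(2) t0 by (intro divide_right_mono) auto
    also have "\<dots> = b / 2 * (a / L)" using rt by (simp only: times_divide_eq_right[symmetric])
    finally have Jt: "real (?J t) / t \<le> b / 2 * (a / L)" .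
    have "a / L \<le> a" using L1 a0 by (simp add: divide_le_eq)
    then have "b / 2 * (a / L) \<le> b / 2 * a" using b by (intro mult_left_mono) auto
    then have Jh: "real (?J t) / t \<le> b * a" using Jt b a0 by (smt (verit) mult_pos_pos field_sum_of_halves mult.commute times_divide_eq_left)
    have lnh: "0 \<le> ln (b * a)" "ln (b * a) \<le> L"
    proof -
      show "0 \<le> ln (b * a)" using a32 by simp
      have "ln (b * a) \<le> ln a" using a32 b a0 by (subst ln_le_cancel_iff) auto
      also have "\<dots> \<le> L / 1" unfolding la using L1 \<alpha> by (intro frac_le) auto
      finally show "ln (b * a) \<le> L" by simp
    qed
    \<comment> \<open>Travelling to the peak costs at most half of its height \<open>b * a\<close>,
      so \<open>Psi\<close> there stays above \<open>m0 = b / 4 * a\<close>.\<close>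
    have "real (?J t) / t * ln (b * a) \<le> b / 2 * (a / L) * L"
      using Jt lnh b a0 L1 by (intro mult_mono) auto
    also have "\<dots> = b / 2 * a" using L1 by simp
    finally have Jm: "b / 4 * a \<le> b * a - real (?J t) / t * ln (b * a)" using a32 by linarith
    have "real (?J t) \<le> real (?N t)"
    proof -
      have "b / 2 * r \<le> C2 * r" using b C2 r8 by (intro mult_right_mono) auto
      then show ?thesis using J(2) N(1) by linarith
    qed
    then have JN: "?J t \<le> ?N t" by simp
    obtain A where A: "A \<in> sets M" "{\<omega> \<in> space M. \<bar>log_ratio t (Z t \<omega>) (potential (xi0 \<omega>) (coin \<omega>))\<bar> \<le> K} \<subseteq> A"
      "measure M A \<le> measure M {\<omega> \<in> space M. \<not> S.good_env (?J t) (b * a) \<omega>}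
       + measure M {\<omega> \<in> space M. (\<Sum>y\<in>{y0..?d t}. (gap_weight (C3 * a) (potential (xi0 \<omega>) (coin \<omega>)) y)\<^sup>2) < v\<^sup>2} + 4 * K / v"
      using S.log_ratio_bound[OF Z[OF t0] JN _ Jh Jm K v] a32 by auto
    have "4 * K / v = \<epsilon> / 8" using K \<epsilon> by (simp add: v_def)
    then have "measure M A < \<epsilon>" using A(3) good T5 \<epsilon> by linarith
    then show ?case using A by blast
  qed
qed

end

theorem theorem1p3:
  fixes M :: "'a measure" and \<alpha> :: real
    and p :: "nat \<Rightarrow> real"
    and xi0 :: "'a \<Rightarrow> int \<Rightarrow> real" and coin :: "'a \<Rightarrow> nat \<Rightarrow> bool"
    and Z :: "real \<Rightarrow> 'a \<Rightarrow> nat"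
  assumes "prob_space M"
    and "\<alpha> \<ge> 2"
    and "\<And>n. 0 \<le> p n \<and> p n \<le> 1"
    and "\<exists>N. \<forall>m n. N \<le> m \<longrightarrow> m \<le> n \<longrightarrow> p m \<le> p n"
    and "p \<longlonglongrightarrow> 1"
    and "\<And>z. (\<lambda>\<omega>. xi0 \<omega> z) \<in> borel_measurable M"
    and "\<And>n. (\<lambda>\<omega>. coin \<omega> n) \<in> measurable M (count_space UNIV)"
    and "prob_space.indep_vars M (\<lambda>_. borel)
           (\<lambda>i \<omega>. case i of Inl z \<Rightarrow> xi0 \<omega> z | Inr n \<Rightarrow> of_bool (coin \<omega> n))
           (UNIV :: (int + nat) set)"
    and "\<And>z x. x \<ge> 1 \<Longrightarrow> measure M {\<omega> \<in> space M. xi0 \<omega> z > x} = x powr (- \<alpha>)"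
    and "\<And>n. measure M {\<omega> \<in> space M. coin \<omega> n} = p n"
    and "\<And>t. t > 0 \<Longrightarrow> AE \<omega> in M.
            Z t \<omega> \<in> Dset (potential (xi0 \<omega>) (coin \<omega>)) \<and>
            (\<forall>y \<in> Dset (potential (xi0 \<omega>) (coin \<omega>)).
               Psi (potential (xi0 \<omega>) (coin \<omega>)) t (int y)
                 \<le> Psi (potential (xi0 \<omega>) (coin \<omega>)) t (int (Z t \<omega>)))"
    and "kappa \<alpha> \<in> o(eta p)"
  shows "\<forall>K \<epsilon>. \<epsilon> > 0 \<longrightarrow> (\<forall>\<^sub>F t in at_top. \<exists>A \<in> sets M.
           {\<omega> \<in> space M.
              \<bar>ln (pam_u (potential (xi0 \<omega>) (coin \<omega>)) t (int (Z t \<omega>))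
                  / pam_u (potential (xi0 \<omega>) (coin \<omega>)) t (- int (Z t \<omega>)))\<bar> \<le> K} \<subseteq> A
           \<and> measure M A < \<epsilon>)"
proof (intro allI impI)
  fix K \<epsilon> :: real
  assume \<epsilon>: "0 < \<epsilon>"
  interpret duplicated_env M \<alpha> p xi0 coin
    by (intro duplicated_env.intro duplicated_env_axioms.intro) (rule assms; assumption?)+
  \<comment> \<open>The anticoncentration estimate asks for a threshold of at least 1; raising
    \<open>K\<close> only enlarges the event.\<close>
  have "\<forall>\<^sub>F t in at_top. \<exists>A\<in>sets M.
     {\<omega> \<in> space M. \<bar>log_ratio t (Z t \<omega>) (potential (xi0 \<omega>) (coin \<omega>))\<bar> \<le> max 1 K} \<subseteq> A \<and> measure M A < \<epsilon>"
    by (rule log_ratio_small_prob[OF assms(5,12) assms(11) \<epsilon>]) simp_all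
  then show "\<forall>\<^sub>F t in at_top. \<exists>A \<in> sets M.
           {\<omega> \<in> space M.
              \<bar>ln (pam_u (potential (xi0 \<omega>) (coin \<omega>)) t (int (Z t \<omega>))
                  / pam_u (potential (xi0 \<omega>) (coin \<omega>)) t (- int (Z t \<omega>)))\<bar> \<le> K} \<subseteq> A
           \<and> measure M A < \<epsilon>"
  proof eventually_elim
    case (elim t)
    then obtain A where A: "A \<in> sets M" "measure M A < \<epsilon>"
      "{\<omega> \<in> space M. \<bar>log_ratio t (Z t \<omega>) (potential (xi0 \<omega>) (coin \<omega>))\<bar> \<le> max 1 K} \<subseteq> A" by blast
    have "{\<omega> \<in> space M. \<bar>log_ratio t (Z t \<omega>) (potential (xi0 \<omega>) (coin \<omega>))\<bar> \<le> K} \<subseteq> A"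
      using A(3) by (auto simp: le_max_iff_disj)
    then show ?case unfolding log_ratio_def using A by blast
  qed
qed

end
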